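(* Consider the class of LQCI instances in which the hard specification $\mathcal{H}$ is given by a DFA, the cost function $\mathcal{K}$ and the label function $L$ are each given by a DFA whose states are annotated with integers and which assigns to a word the integer of the state on which its run ends, the length bounds $m,n$ are encoded in unary, and all other numerical parameters are encoded in binary. This class has a polynomial-time improvisation scheme.
   Context: Fix a finite alphabet $\Sigma$. An LQCI instance is a tuple $\mathcal{C}=(\mathcal{H},\mathcal{K},L,m,n,c,\lambda,\rho,\hat{\alpha},\hat{\beta})$ where $m\le n$ are natural numbers; $\mathcal{H}$ is a hard specification (a set of words over $\Sigma$); $\mathcal{K}:\Sigma^*\to\mathbb{Q}$ is a cost function; $L:\Sigma^*\to\Omega$ is a label function into a finite set $\Omega=\{\ell_1,\dots,\ell_{|\Omega|}\}$; $c\in\mathbb{Q}^+$; $0\le\lambda\le\rho\le1$ rationals; and for each $i$, rationals $0\le\hat{\alpha}_i\le\hat{\beta}_i\le1$. Let $I=\{w\in\Sigma^*: m\le|w|\le n,\ w\text{ satisfies }\mathcal{H}\}$ and $I_i=\{w\in I: L(w)=\ell_i\}$. A distribution $D$ over $\Sigma^*$ is improvising if: $\Pr[w\in I\mid w\leftarrow D]=1$; $E[\mathcal{K}(w)\mid w\leftarrow D]\le c$; for all $i$, $\lambda\le\Pr[w\in I_i\mid w\leftarrow D]\le\rho$; and for all $i$ and $y\in I_i$, $\hat{\alpha}_i\le\Pr[w=y\mid w\in I_i,w\leftarrow D]\le\hat{\beta}_i$. The instance is feasible if an improvising distribution exists. An improviser is a probabilistic algorithm taking no input, with finite expected running time,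 whose output distribution is improvising. The LQCI problem: given an instance, determine whether it is feasible and, if so, produce an improviser. An improvisation scheme for a class is a probabilistic algorithm with finite expected runtime solving the LQCI problem on that class; it is polynomial-time if it runs in time polynomial in the instance size and the improvisers it outputs run in expected time polynomial in the instance size. *)

theory Defs
  imports
    "HOL-Probability.Probability"
    "HOL-Library.Log_Nat"
    "HOL-Computational_Algebra.Polynomial"
begin

section \<open>LQCI instances and improvising distributions\<close>

text \<open>
  The alphabet is a parameter \<open>\<Sigma>\<close>. The finite label set is a field of the instance, and the
  bounds on the conditional probabilities are indexed by the labels themselves.
\<close>

record ('a, 'l) lqci =
  hard :: "'a list set"
  cost_of :: "'a list \<Rightarrow> rat"
  label_of :: "'a list \<Rightarrow> 'l"
  labels :: "'l set"
  min_len :: nat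
  max_len :: nat
  cost_bound :: rat
  label_lo :: rat
  label_hi :: rat
  word_lo :: "'l \<Rightarrow> rat"
  word_hi :: "'l \<Rightarrow> rat"

definition lqci_instance :: "'a set \<Rightarrow> ('a, 'l) lqci \<Rightarrow> bool" where
  "lqci_instance \<Sigma> C \<longleftrightarrow>
     hard C \<subseteq> lists \<Sigma> \<and>
     finite (labels C) \<and>
     label_of C ` lists \<Sigma> \<subseteq> labels C \<and>
     min_len C \<le> max_len C \<and>
     0 < cost_bound C \<and>
     0 \<le> label_lo C \<and> label_lo C \<le> label_hi C \<and> label_hi C \<le> 1 \<and>
     (\<forall>l\<in>labels C. 0 \<le> word_lo C l \<and> word_lo C l \<le> word_hi C l \<and> word_hi C l \<le> 1)"

definition improvisations :: "'a set \<Rightarrow> ('a, 'l) lqci \<Rightarrow> 'a list set" where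
  "improvisations \<Sigma> C =
     {w \<in> lists \<Sigma>. min_len C \<le> length w \<and> length w \<le> max_len C \<and> w \<in> hard C}"

definition label_class :: "'a set \<Rightarrow> ('a, 'l) lqci \<Rightarrow> 'l \<Rightarrow> 'a list set" where
  "label_class \<Sigma> C l = {w \<in> improvisations \<Sigma> C. label_of C w = l}"

text \<open>
  The bounds on the probability of a word conditional on its label class are imposed only for
  classes of positive probability, as the conditional probability is undefined otherwise
  (\<^const>\<open>cond_prob\<close> would yield \<open>0\<close>).
\<close>

definition improvising :: "'a set \<Rightarrow> ('a, 'l) lqci \<Rightarrow> 'a list pmf \<Rightarrow> bool" where
  "improvising \<Sigma> C D \<longleftrightarrow>
     set_pmf D \<subseteq> lists \<Sigma> \<and>
     measure_pmf.prob D (improvisations \<Sigma> C) = 1 \<and>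
     measure_pmf.expectation D (\<lambda>w. real_of_rat (cost_of C w)) \<le> real_of_rat (cost_bound C) \<and>
     (\<forall>l\<in>labels C.
        real_of_rat (label_lo C) \<le> measure_pmf.prob D (label_class \<Sigma> C l) \<and>
        measure_pmf.prob D (label_class \<Sigma> C l) \<le> real_of_rat (label_hi C)) \<and>
     (\<forall>l\<in>labels C. measure_pmf.prob D (label_class \<Sigma> C l) > 0 \<longrightarrow>
        (\<forall>y\<in>label_class \<Sigma> C l.
           real_of_rat (word_lo C l) \<le> \<P>(w in D. w = y \<bar> w \<in> label_class \<Sigma> C l) \<and>
           \<P>(w in D. w = y \<bar> w \<in> label_class \<Sigma> C l) \<le> real_of_rat (word_hi C l)))"

definition feasible :: "'a set \<Rightarrow> ('a, 'l) lqci \<Rightarrow> bool" where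
  "feasible \<Sigma> C \<longleftrightarrow> (\<exists>D. improvising \<Sigma> C D)"


section \<open>Probabilistic algorithms\<close>

text \<open>
  Algorithms are programs of a first-order Lisp-like language with fair coin flips. Data are binary
  trees with integer leaves. Every evaluation step costs one unit, and a step that creates or copies
  a value is charged its bit size in addition (integers in binary, trees without sharing), as in the
  logarithmic cost criterion for random access machines. Hence running times agree up to a
  polynomial with those of probabilistic Turing machines.
\<close>

datatype val = Num int | Branch val val

primrec vsize :: "val \<Rightarrow> nat" where
  "vsize (Num i) = 1 + floorlog 2 (nat \<bar>i\<bar>)"
| "vsize (Branch a b) = 1 + vsize a + vsize b"

datatype uop = Fst | Snd | Is_Branch
datatype bop = Mk_Branch | Add | Sub | Mul | Div | Less

datatype expr =
    Const val
  | Var nat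
  | Un_Op uop expr
  | Bin_Op bop expr expr
  | Cond expr expr expr
  | Bind expr expr
  | Call nat expr
  | Flip

primrec num :: "val \<Rightarrow> int" where
  "num (Num i) = i"
| "num (Branch a b) = 0"

fun apply_uop :: "uop \<Rightarrow> val \<Rightarrow> val" where
  "apply_uop Fst (Branch a b) = a"
| "apply_uop Snd (Branch a b) = b"
| "apply_uop Is_Branch (Branch a b) = Num 1"
| "apply_uop _ (Num i) = Num 0"

fun apply_bop :: "bop \<Rightarrow> val \<Rightarrow> val \<Rightarrow> val" where
  "apply_bop Mk_Branch u v = Branch u v"
| "apply_bop Add u v = Num (num u + num v)"
| "apply_bop Sub u v = Num (num u - num v)"
| "apply_bop Mul u v = Num (num u * num v)"
| "apply_bop Div u v = Num (num u div num v)"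
| "apply_bop Less u v = Num (of_bool (num u < num v))"

text \<open>
  A program is a list of unary function bodies; function \<open>0\<close> is the main function. Variables are de
  Bruijn indices into the environment, \<^const>\<open>Bind\<close> binds a local variable, and in
  \<^const>\<open>Cond\<close> every value other than \<open>Num 0\<close> counts as true. Undefined variables and
  functions yield \<open>Num 0\<close>.
\<close>

type_synonym program = "expr list"

definition lookup :: "val list \<Rightarrow> nat \<Rightarrow> val" where
  "lookup \<rho> i = (if i < length \<rho> then \<rho> ! i else Num 0)"

definition body :: "program \<Rightarrow> nat \<Rightarrow> expr" where
  "body P f = (if f < length P then P ! f else Const (Num 0))"

text \<open>
  The semantics is the joint subdistribution of the result and the cost. The mass missing to \<open>1\<close> is
  the probability of nontermination.
\<close>

partial_function (spmf) eval_expr :: "program \<Rightarrow> expr \<Rightarrow> val list \<Rightarrow> (val \<times> nat) spmf" where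
  "eval_expr P e \<rho> = (case e of
     Const v \<Rightarrow> return_spmf (v, 1 + vsize v)
   | Var i \<Rightarrow> return_spmf (lookup \<rho> i, 1 + vsize (lookup \<rho> i))
   | Un_Op f e1 \<Rightarrow>
       bind_spmf (eval_expr P e1 \<rho>) (\<lambda>(v1, t1).
       return_spmf (apply_uop f v1, t1 + 1 + vsize (apply_uop f v1)))
   | Bin_Op f e1 e2 \<Rightarrow>
       bind_spmf (eval_expr P e1 \<rho>) (\<lambda>(v1, t1).
       bind_spmf (eval_expr P e2 \<rho>) (\<lambda>(v2, t2).
       return_spmf (apply_bop f v1 v2, t1 + t2 + 1 + vsize (apply_bop f v1 v2))))
   | Cond e1 e2 e3 \<Rightarrow>
       bind_spmf (eval_expr P e1 \<rho>) (\<lambda>(v1, t1).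
       bind_spmf (eval_expr P (if v1 \<noteq> Num 0 then e2 else e3) \<rho>) (\<lambda>(v, t).
       return_spmf (v, t1 + t + 1)))
   | Bind e1 e2 \<Rightarrow>
       bind_spmf (eval_expr P e1 \<rho>) (\<lambda>(v1, t1).
       bind_spmf (eval_expr P e2 (v1 # \<rho>)) (\<lambda>(v, t).
       return_spmf (v, t1 + t + 1)))
   | Call f e1 \<Rightarrow>
       bind_spmf (eval_expr P e1 \<rho>) (\<lambda>(v1, t1).
       bind_spmf (eval_expr P (body P f) [v1]) (\<lambda>(v, t).
       return_spmf (v, t1 + t + 1)))
   | Flip \<Rightarrow> map_spmf (\<lambda>b. (Num (of_bool b), 1 + vsize (Num (of_bool b)))) coin_spmf)"

definition run :: "program \<Rightarrow> val \<Rightarrow> (val \<times> nat) spmf" where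
  "run P v = eval_expr P (body P 0) [v]"

definition output_dist :: "program \<Rightarrow> val \<Rightarrow> val spmf" where
  "output_dist P v = map_spmf fst (run P v)"

definition expected_time :: "program \<Rightarrow> val \<Rightarrow> ennreal" where
  "expected_time P v =
     (if lossless_spmf (run P v) then \<integral>\<^sup>+ (x, t). of_nat t \<partial>measure_spmf (run P v) else \<infinity>)"


section \<open>Encodings\<close>

definition enc_list :: "('a \<Rightarrow> val) \<Rightarrow> 'a list \<Rightarrow> val" where
  "enc_list f xs = foldr (\<lambda>x v. Branch (f x) v) xs (Num 0)"

definition enc_nat :: "nat \<Rightarrow> val" where
  "enc_nat n = Num (int n)"

definition enc_unary :: "nat \<Rightarrow> val" where
  "enc_unary n = enc_list Num (replicate n 0)"

definition enc_rat :: "rat \<Rightarrow> val" where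
  "enc_rat r = (case quotient_of r of (a, b) \<Rightarrow> Branch (Num a) (Num b))"

definition enc_bool :: "bool \<Rightarrow> val" where
  "enc_bool b = Num (of_bool b)"

definition enc_word :: "nat list \<Rightarrow> val" where
  "enc_word = enc_list enc_nat"

primrec enc_uop :: "uop \<Rightarrow> val" where
  "enc_uop Fst = Num 0"
| "enc_uop Snd = Num 1"
| "enc_uop Is_Branch = Num 2"

primrec enc_bop :: "bop \<Rightarrow> val" where
  "enc_bop Mk_Branch = Num 0"
| "enc_bop Add = Num 1"
| "enc_bop Sub = Num 2"
| "enc_bop Mul = Num 3"
| "enc_bop Div = Num 4"
| "enc_bop Less = Num 5"

primrec enc_expr :: "expr \<Rightarrow> val" where
  "enc_expr (Const v) = Branch (Num 0) v"
| "enc_expr (Var i) = Branch (Num 1) (enc_nat i)"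
| "enc_expr (Un_Op f e) = Branch (Num 2) (Branch (enc_uop f) (enc_expr e))"
| "enc_expr (Bin_Op f e1 e2) = Branch (Num 3) (Branch (enc_bop f) (Branch (enc_expr e1) (enc_expr e2)))"
| "enc_expr (Cond e1 e2 e3) =
     Branch (Num 4) (Branch (enc_expr e1) (Branch (enc_expr e2) (enc_expr e3)))"
| "enc_expr (Bind e1 e2) = Branch (Num 5) (Branch (enc_expr e1) (enc_expr e2))"
| "enc_expr (Call f e) = Branch (Num 6) (Branch (enc_nat f) (enc_expr e))"
| "enc_expr Flip = Branch (Num 7) (Num 0)"

definition enc_program :: "program \<Rightarrow> val" where
  "enc_program = enc_list enc_expr"

lemma inj_enc_list: "inj f \<Longrightarrow> inj (enc_list f)"
proof (rule injI)
  fix xs ys assume "inj f" "enc_list f xs = enc_list f ys"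
  then show "xs = ys"
  proof (induction xs arbitrary: ys)
    case Nil
    then show ?case by (cases ys) (auto simp: enc_list_def)
  next
    case (Cons x xs)
    then show ?case by (cases ys) (auto simp: enc_list_def dest: injD)
  qed
qed

lemma inj_enc_word: "inj enc_word"
  unfolding enc_word_def by (rule inj_enc_list) (auto simp: inj_def enc_nat_def)

lemma enc_uop_eq_iff: "enc_uop f = enc_uop g \<longleftrightarrow> f = g"
  by (cases f; cases g) auto

lemma enc_bop_eq_iff: "enc_bop f = enc_bop g \<longleftrightarrow> f = g"
  by (cases f; cases g) auto

lemma inj_enc_expr: "inj enc_expr"
proof (rule injI)
  fix e e' assume "enc_expr e = enc_expr e'"
  then show "e = e'"
  proof (induction e arbitrary: e')
    case (Const v) then show ?case by (cases e') auto
  next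
    case (Var i) then show ?case by (cases e') (auto simp: enc_nat_def)
  next
    case (Un_Op f e) then show ?case by (cases e') (auto simp: enc_uop_eq_iff)
  next
    case (Bin_Op f e1 e2) then show ?case by (cases e') (auto simp: enc_bop_eq_iff)
  next
    case (Cond e1 e2 e3) then show ?case by (cases e') auto
  next
    case (Bind e1 e2) then show ?case by (cases e') auto
  next
    case (Call f e) then show ?case by (cases e') (auto simp: enc_nat_def)
  next
    case Flip then show ?case by (cases e') auto
  qed
qed

lemma inj_enc_program: "inj enc_program"
  unfolding enc_program_def by (rule inj_enc_list) (rule inj_enc_expr)


section \<open>Improvisers and improvisation schemes\<close>

text \<open>
  An improviser takes no input: it is run on the dummy argument \<open>Num 0\<close>.
\<close>

definition improviser :: "nat set \<Rightarrow> (nat, 'l) lqci \<Rightarrow> program \<Rightarrow> bool" where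
  "improviser \<Sigma> C P \<longleftrightarrow>
     expected_time P (Num 0) < \<infinity> \<and>
     (\<exists>D. improvising \<Sigma> C D \<and>
          output_dist P (Num 0) = spmf_of_pmf (map_pmf enc_word D))"

definition answer_infeasible :: val where
  "answer_infeasible = Num 0"

definition answer_improviser :: "program \<Rightarrow> val" where
  "answer_improviser P = Branch (Num 1) (enc_program P)"

definition correct_answer :: "nat set \<Rightarrow> (nat, 'l) lqci \<Rightarrow> val \<Rightarrow> bool" where
  "correct_answer \<Sigma> C v \<longleftrightarrow>
     (if feasible \<Sigma> C then \<exists>P. improviser \<Sigma> C P \<and> v = answer_improviser P
      else v = answer_infeasible)"

text \<open>
  A class of instances is given by a set \<open>\<C>\<close> of representations, the map \<open>sem\<close> from representations to
  the LQCI instances they denote, and the encoding \<open>enc\<close> of representations as input data. The size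
  of an instance is the size of its encoding.
\<close>

definition improvisation_scheme ::
    "nat set \<Rightarrow> 'c set \<Rightarrow> ('c \<Rightarrow> (nat, 'l) lqci) \<Rightarrow> ('c \<Rightarrow> val) \<Rightarrow> program \<Rightarrow> bool" where
  "improvisation_scheme \<Sigma> \<C> sem enc S \<longleftrightarrow>
     (\<forall>c\<in>\<C>. expected_time S (enc c) < \<infinity> \<and>
        (\<forall>v\<in>set_spmf (output_dist S (enc c)). correct_answer \<Sigma> (sem c) v))"

text \<open>
  The running time of the scheme itself is bounded in the worst case over its coin flips, the
  running time of the improvisers in expectation.
\<close>

definition polynomial_time_scheme ::
    "nat set \<Rightarrow> 'c set \<Rightarrow> ('c \<Rightarrow> (nat, 'l) lqci) \<Rightarrow> ('c \<Rightarrow> val) \<Rightarrow> program \<Rightarrow> bool" where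
  "polynomial_time_scheme \<Sigma> \<C> sem enc S \<longleftrightarrow>
     improvisation_scheme \<Sigma> \<C> sem enc S \<and>
     (\<exists>p :: nat poly. \<forall>c\<in>\<C>. \<forall>(v, t)\<in>set_spmf (run S (enc c)). t \<le> poly p (vsize (enc c))) \<and>
     (\<exists>q :: nat poly. \<forall>c\<in>\<C>. \<forall>P. answer_improviser P \<in> set_spmf (output_dist S (enc c)) \<longrightarrow>
        expected_time P (Num 0) \<le> of_nat (poly q (vsize (enc c))))"


section \<open>Instances given by DFAs\<close>

text \<open>
  A DFA over the alphabet \<open>{..<k}\<close> has states \<open>{..<N}\<close>; row \<open>q\<close> of the transition table lists the
  successors of state \<open>q\<close>, and \<open>annot\<close> lists the annotations of the states. An ordinary DFA is
  annotated with acceptance bits.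
\<close>

record 'o dfa =
  start :: nat
  delta :: "nat list list"
  annot :: "'o list"

definition dfa_wf :: "nat \<Rightarrow> 'o dfa \<Rightarrow> bool" where
  "dfa_wf k A \<longleftrightarrow>
     start A < length (annot A) \<and>
     length (delta A) = length (annot A) \<and>
     (\<forall>row\<in>set (delta A). length row = k \<and> (\<forall>q\<in>set row. q < length (annot A)))"

definition dfa_output :: "'o dfa \<Rightarrow> nat list \<Rightarrow> 'o" where
  "dfa_output A w = annot A ! foldl (\<lambda>q a. delta A ! q ! a) (start A) w"

record dfa_lqci =
  hard_dfa :: "bool dfa"
  cost_dfa :: "int dfa"
  label_dfa :: "int dfa"
  lo_len :: nat
  hi_len :: nat
  cbound :: rat
  lam :: rat
  rho :: rat
  label_specs :: "(int \<times> rat \<times> rat) list"  (* label, lower and upper bound on its words *)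

definition lqci_of_dfa :: "nat \<Rightarrow> dfa_lqci \<Rightarrow> (nat, int) lqci" where
  "lqci_of_dfa k c =
     \<lparr> hard = {w \<in> lists {..<k}. dfa_output (hard_dfa c) w},
       cost_of = (\<lambda>w. of_int (dfa_output (cost_dfa c) w)),
       label_of = dfa_output (label_dfa c),
       labels = fst ` set (label_specs c),
       min_len = lo_len c,
       max_len = hi_len c,
       cost_bound = cbound c,
       label_lo = lam c,
       label_hi = rho c,
       word_lo = (\<lambda>l. fst (the (map_of (label_specs c) l))),
       word_hi = (\<lambda>l. snd (the (map_of (label_specs c) l))) \<rparr>"

definition dfa_lqci_class :: "nat \<Rightarrow> dfa_lqci set" where
  "dfa_lqci_class k =
     {c. dfa_wf k (hard_dfa c) \<and> dfa_wf k (cost_dfa c) \<and> dfa_wf k (label_dfa c) \<and>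
         distinct (map fst (label_specs c)) \<and> lqci_instance {..<k} (lqci_of_dfa k c)}"

definition enc_dfa :: "('o \<Rightarrow> val) \<Rightarrow> 'o dfa \<Rightarrow> val" where
  "enc_dfa f A =
     Branch (enc_nat (start A)) (Branch (enc_list (enc_list enc_nat) (delta A)) (enc_list f (annot A)))"

definition enc_dfa_lqci :: "dfa_lqci \<Rightarrow> val" where
  "enc_dfa_lqci c = enc_list (\<lambda>v. v)
     [enc_dfa enc_bool (hard_dfa c), enc_dfa Num (cost_dfa c), enc_dfa Num (label_dfa c),
      enc_unary (lo_len c), enc_unary (hi_len c),
      enc_rat (cbound c), enc_rat (lam c), enc_rat (rho c),
      enc_list (\<lambda>(l, a, b). Branch (Num l) (Branch (enc_rat a) (enc_rat b))) (label_specs c)]"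

end

(* Call a cell the set of the words of a given length that lead to a given state of the product of
   the three DFAs. The words of a cell agree in cost, label and acceptance, and dynamic programming
   over the length counts them. By averaging, an improvising distribution may be taken uniform on
   every cell, so that only the masses of the cells matter. For each label, minimizing the expected
   cost of the conditional distribution is a fractional knapsack problem over the cells; the
   probabilities of the labels then solve a second one, in which a label costs its conditional
   minimum. Both are solved greedily, and the instance is feasible iff the ranges of the two problems
   are consistent and the optimal cost is at most c.

   If Q is the product of all denominators, the optimal solutions are integral in units of 1/Q, so
   with P the product of the sizes of the cells the resulting distribution is the image of the uniform
   distribution on the integers below Q^2 P: such an integer determines a cell and the rank of a word
   in it, and the word is decoded by following the table of counts backwards. The uniform integer is
   obtained from coin flips by rejection.

   Running times are bounded compositionally: the functions that relocatable program fragments compute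
   in polynomial time are closed under composition and under iteration over a list, provided that
   the accumulator stays polynomially bounded. *)

theory Submission
  imports Defs
begin
section \<open>Polynomially bounded functions on encoded data\<close>

text \<open>The scheme compiles nothing that depends on the instance: the improviser is one fixed
  sampler in which the encoded instance occurs as a constant. Its code is therefore assembled in
  polynomial time, and one polynomial-time decoding function bounds the expected time of all
  improvisers. Polynomial time is a property of total functions, ill-formed data included; this is
  why selection and greedy allocation are clamped so that no intermediate value outgrows its input,
  even where the weights make no sense.

  The two knapsack problems separate because the bounds on words are conditional: the admissible
  conditional distributions of a label do not depend on its probability, so the cost is linear in
  the label probabilities and the conditional minimum can be fixed beforehand. Of the two factors Q,
  one is due to the label and one to the cell within the label.

  Functions are called by absolute index, so a fragment can be combined with others only if it is
  available for every position; hence the relocatable form.\<close>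

class enc = fixes encode :: "'a \<Rightarrow> val"

instantiation int :: enc begin
definition encode_int :: "int \<Rightarrow> val" where "encode_int = Num"
instance ..
end

instantiation bool :: enc begin
definition encode_bool :: "bool \<Rightarrow> val" where "encode_bool = enc_bool"
instance ..
end

instantiation unit :: enc begin
definition encode_unit :: "unit \<Rightarrow> val" where "encode_unit = (\<lambda>_. Num 0)"
instance ..
end

text \<open>Trees encode themselves, so that the code emitted by the scheme is again a result of an
  encodable type.\<close>

instantiation val :: enc begin
definition encode_val :: "val \<Rightarrow> val" where "encode_val = (\<lambda>v. v)"
instance ..
end

instantiation prod :: (enc, enc) enc begin
definition encode_prod :: "'a \<times> 'b \<Rightarrow> val" where
  "encode_prod p = Branch (encode (fst p)) (encode (snd p))"
instance ..
end

instantiation list :: (enc) enc begin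
definition encode_list :: "'a list \<Rightarrow> val" where "encode_list = enc_list encode"
instance ..
end

abbreviation sz :: "'a::enc \<Rightarrow> nat" where "sz x \<equiv> vsize (encode x)"

lemma encode_simps [simp]:
  "encode i = Num i"
  "encode b = Num (of_bool b)"
  "encode () = Num 0"
  "encode v = v"
  "encode (x, y) = Branch (encode x) (encode y)"
  "encode [] = Num 0"
  "encode (z # zs) = Branch (encode z) (encode zs)"
  for x :: "'a::enc" and y :: "'b::enc" and z :: "'c::enc"
  by (auto simp: encode_int_def encode_bool_def enc_bool_def encode_unit_def encode_val_def
      encode_prod_def encode_list_def enc_list_def)

lemma vsize_pos: "vsize v > 0"
  by (cases v) auto

lemma two_le_power_vsize: "(2::int) \<le> 2 ^ vsize v"
  using power_increasing[of 1 "vsize v" "2::int"] vsize_pos[of v] by simp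

lemma sz_bool: "sz (b::bool) \<le> 2"
  by (cases b) (auto simp: floorlog_def)

lemma sz_fst: "sz (fst p) \<le> sz p" and sz_snd: "sz (snd p) \<le> sz p"
  by (cases p; simp)+

lemma abs_less_power_sz: "\<bar>i\<bar> < 2 ^ sz (i::int)"
proof -
  have "nat \<bar>i\<bar> < 2 ^ floorlog 2 (nat \<bar>i\<bar>)"
    using floorlog_leD[of 2 "nat \<bar>i\<bar>" "floorlog 2 (nat \<bar>i\<bar>)"] by simp
  also have "\<dots> \<le> 2 ^ sz i" by simp
  finally have "int (nat \<bar>i\<bar>) < int (2 ^ sz i)" by (simp only: of_nat_less_iff)
  then show ?thesis by simp
qed

lemma sz_le_of_abs_less:
  fixes i :: int
  assumes "\<bar>i\<bar> < 2 ^ n"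
  shows "sz i \<le> Suc n"
proof -
  have "nat \<bar>i\<bar> < 2 ^ n" using assms by (simp add: nat_less_iff)
  then show ?thesis using floorlog_leI[of "nat \<bar>i\<bar>" 2 n] by simp
qed

lemma sz_of_abs_le: "\<bar>i\<bar> \<le> \<bar>j\<bar> \<Longrightarrow> sz (i::int) \<le> Suc (sz (j::int))"
  by (rule sz_le_of_abs_less) (use abs_less_power_sz[of j] in linarith)

lemma sz_add: "sz (i + j :: int) \<le> sz i + sz j + 1"
proof -
  have "(2::int) ^ sz i \<ge> 2" "(2::int) ^ sz j \<ge> 2"
    using two_le_power_vsize by blast+
  \<comment> \<open>For x, y \<ge> 2 the inequality (x - 1)(y - 1) \<ge> 1 says x + y \<le> x y.
    Sizes are positive, so both powers are at least 2.\<close>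
  then have "(2 ^ sz i - 1) * (2 ^ sz j - 1) \<ge> (1 * 1 :: int)"
    by (intro mult_mono) linarith+
  then have "(2::int) ^ sz i + 2 ^ sz j \<le> 2 ^ (sz i + sz j)"
    by (simp add: algebra_simps power_add)
  then have "\<bar>i + j\<bar> < 2 ^ (sz i + sz j)"
    using abs_less_power_sz[of i] abs_less_power_sz[of j] by linarith
  then show ?thesis using sz_le_of_abs_less by fastforce
qed

lemma sz_minus: "sz (- i :: int) = sz i"
  by simp

lemma sz_mult: "sz (i * j :: int) \<le> sz i + sz j + 1"
proof -
  have "\<bar>i * j\<bar> < 2 ^ (sz i + sz j)"
    unfolding abs_mult power_add using abs_less_power_sz[of i] abs_less_power_sz[of j]
    by (intro mult_strict_mono') auto
  then show ?thesis using sz_le_of_abs_less by fastforce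
qed

lemma sz_div: "sz (i div j :: int) \<le> sz i + 1"
proof -
  have "\<bar>i div j\<bar> \<le> \<bar>i\<bar>"
  proof (cases "j = 0")
    case False
    have 1: "j > 0 \<Longrightarrow> \<bar>i div j\<bar> \<le> \<bar>i\<bar>" for i j :: int
    proof -
      assume j: "j > 0"
      show ?thesis
      proof (cases "i \<ge> 0")
        case True
        then show ?thesis using j div_by_1[of i] zdiv_mono2[of i 1 j]
          by (simp add: pos_imp_zdiv_nonneg_iff)
      next
        case False
        \<comment> \<open>Floor division rounds a negative quotient away from zero; dividing
          \<open>i * j \<le> i\<close> by \<open>j\<close> shows that it still does not fall below
          \<open>i\<close>.\<close>
        have "i \<le> i div j"
        proof -
          have "i * j \<le> i * 1" using False j by (intro mult_left_mono_neg) auto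
          then show ?thesis using j zdiv_mono1[of "i * j" i j] by simp
        qed
        moreover have "i div j < 0" using False j by (simp add: pos_imp_zdiv_neg_iff)
        ultimately show ?thesis using False by linarith
      qed
    qed
    show ?thesis
    proof (cases "j > 0")
      case True then show ?thesis using 1 by blast
    next
      case False
      then show ?thesis using 1[of "-j" "-i"] \<open>j \<noteq> 0\<close> by simp
    qed
  qed simp
  then show ?thesis using sz_of_abs_le by fastforce
qed

lemma sz_Cons: "sz (x # xs) = 1 + sz x + sz xs"
  by simp

lemma sz_list: "sz xs = 1 + (\<Sum>x\<leftarrow>xs. sz x + 1)"
  by (induction xs) (auto simp: floorlog_def)

lemma sz_append: "sz (xs @ ys) + 1 = sz xs + sz ys"
  by (simp add: sz_list)

lemma sz_member: "x \<in> set xs \<Longrightarrow> sz x < sz xs"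
  by (induction xs) (auto simp: less_Suc_eq)

lemma length_less_sz: "length xs < sz xs"
  by (induction xs) (auto simp: floorlog_def)

text \<open>The base exceeds 1, so a single power absorbs constants, and products of bounds merely
  add exponents. Genuine polynomials are recovered in \<open>pb_poly\<close>.\<close>

definition pb :: "('a::enc \<Rightarrow> nat) \<Rightarrow> bool" where
  "pb g \<longleftrightarrow> (\<exists>d. \<forall>x. g x \<le> (sz x + 2) ^ d)"

lemma pb_mono: "pb g \<Longrightarrow> (\<And>x. f x \<le> g x) \<Longrightarrow> pb f"
  unfolding pb_def by (meson le_trans)

lemma pb_const [intro]: "pb (\<lambda>_. c)"
proof -
  have "c \<le> (sz x + 2) ^ c" for x :: 'a
  proof -
    have "c \<le> 2 ^ c" by (simp add: less_imp_le)
    also have "\<dots> \<le> (sz x + 2) ^ c" by (rule power_mono) auto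
    finally show ?thesis .
  qed
  then show ?thesis unfolding pb_def by blast
qed

lemma pb_sz [intro]: "pb (\<lambda>x. sz x)"
  unfolding pb_def by (rule exI[of _ 1]) simp

lemma pb_mult [intro]: "pb f \<Longrightarrow> pb g \<Longrightarrow> pb (\<lambda>x. f x * g x)"
  unfolding pb_def by (metis mult_le_mono power_add)

text \<open>The inequality f + g \<le> (f + 1)(g + 1) reduces sums to products.\<close>

lemma pb_add [intro]:
  assumes "pb f" "pb g" shows "pb (\<lambda>x. f x + g x)"
proof -
  have "pb (\<lambda>x. (f x + 1) * (g x + 1))"
  proof (rule pb_mult)
    have *: "pb (\<lambda>x. h x + 1)" if h: "pb h" for h :: "'a \<Rightarrow> nat"
    proof -
      obtain d where d: "\<And>x. h x \<le> (sz x + 2) ^ d" using h unfolding pb_def by blast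
      have "h x + 1 \<le> (sz x + 2) ^ Suc d" for x
      proof -
        have "h x + 1 \<le> (sz x + 2) ^ d * 2" using d[of x] one_le_power[of "sz x + 2" d] by linarith
        also have "\<dots> \<le> (sz x + 2) ^ Suc d" by simp
        finally show ?thesis .
      qed
      then show ?thesis unfolding pb_def by blast
    qed
    show "pb (\<lambda>x. f x + 1)" "pb (\<lambda>x. g x + 1)" using assms * by auto
  qed
  then show ?thesis by (rule pb_mono) simp
qed

lemma pb_Suc [intro]: "pb f \<Longrightarrow> pb (\<lambda>x. Suc (f x))"
  using pb_add[OF _ pb_const[of 1], of f] by simp

lemma pb_power [intro]: "pb f \<Longrightarrow> pb (\<lambda>x. f x ^ d)"
  by (induction d) auto

text \<open>An argument of \<open>T\<close> is later known only through a bound \<open>S\<close> on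
  its size, so \<open>T\<close> is majorized by a monotone function of the size. \<open>S\<close>
  may be a function on another type than \<open>T\<close>.\<close>

lemma pb_comp_bound:
  assumes "pb T"
  obtains T' where "\<And>x. T x \<le> T' (sz x)" "mono T'"
    "\<And>S :: 'b::enc \<Rightarrow> nat. pb S \<Longrightarrow> pb (\<lambda>x. T' (S x))"
proof -
  obtain d where d: "\<And>x. T x \<le> (sz x + 2) ^ d" using assms unfolding pb_def by blast
  show ?thesis
  proof (rule that[of "\<lambda>s. (s + 2) ^ d"])
    show "mono (\<lambda>s::nat. (s + 2) ^ d)" by (auto intro!: monoI power_mono)
    show "pb (\<lambda>x. (S x + 2) ^ d)" if "pb S" for S :: "'b \<Rightarrow> nat"
      by (rule pb_power[OF pb_add[OF that pb_const]])
  qed (rule d)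
qed

lemma pb_comp:
  assumes T: "pb T" and f: "pb (\<lambda>x. sz (f x))"
  shows "pb (\<lambda>x. T (f x))"
proof -
  obtain T' where "\<And>x. T x \<le> T' (sz x)" "pb (\<lambda>x. T' (sz (f x)))"
    using pb_comp_bound[OF T] f by metis
  then show ?thesis by (blast intro: pb_mono)
qed

section \<open>Evaluation\<close>

context
  fixes P :: program and \<rho> :: "val list"
begin

lemma eval_Const: "eval_expr P (Const v) \<rho> = return_spmf (v, 1 + vsize v)"
  by (subst eval_expr.simps) simp

lemma eval_Var: "eval_expr P (Var i) \<rho> = return_spmf (lookup \<rho> i, 1 + vsize (lookup \<rho> i))"
  by (subst eval_expr.simps) simp

lemma eval_Un_Op: "eval_expr P (Un_Op f e) \<rho> =
    bind_spmf (eval_expr P e \<rho>) (\<lambda>(v, t).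
      return_spmf (apply_uop f v, t + 1 + vsize (apply_uop f v)))"
  by (subst eval_expr.simps) simp

lemma eval_Bin_Op: "eval_expr P (Bin_Op f e1 e2) \<rho> =
    bind_spmf (eval_expr P e1 \<rho>) (\<lambda>(v1, t1). bind_spmf (eval_expr P e2 \<rho>) (\<lambda>(v2, t2).
      return_spmf (apply_bop f v1 v2, t1 + t2 + 1 + vsize (apply_bop f v1 v2))))"
  by (subst eval_expr.simps) simp

lemma eval_Cond: "eval_expr P (Cond e1 e2 e3) \<rho> =
    bind_spmf (eval_expr P e1 \<rho>) (\<lambda>(v1, t1).
      bind_spmf (eval_expr P (if v1 \<noteq> Num 0 then e2 else e3) \<rho>) (\<lambda>(v, t).
        return_spmf (v, t1 + t + 1)))"
  by (subst eval_expr.simps) simp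

lemma eval_Bind: "eval_expr P (Bind e1 e2) \<rho> =
    bind_spmf (eval_expr P e1 \<rho>) (\<lambda>(v1, t1).
      bind_spmf (eval_expr P e2 (v1 # \<rho>)) (\<lambda>(v, t). return_spmf (v, t1 + t + 1)))"
  by (subst eval_expr.simps) simp

lemma eval_Call: "eval_expr P (Call f e) \<rho> =
    bind_spmf (eval_expr P e \<rho>) (\<lambda>(v1, t1).
      bind_spmf (eval_expr P (body P f) [v1]) (\<lambda>(v, t). return_spmf (v, t1 + t + 1)))"
  by (subst eval_expr.simps) simp

lemma eval_Flip: "eval_expr P Flip \<rho> =
    map_spmf (\<lambda>b. (Num (of_bool b), 1 + vsize (Num (of_bool b)))) coin_spmf"
  by (subst eval_expr.simps) simp

lemmas eval_simps = eval_Const eval_Var eval_Un_Op eval_Bin_Op eval_Cond eval_Bind eval_Call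

end

lemma lookup_simps [simp]: "lookup (v # \<rho>) 0 = v" "lookup (v # \<rho>) (Suc i) = lookup \<rho> i"
  by (auto simp: lookup_def)

lemma vsize_apply_uop: "vsize (apply_uop f v) \<le> vsize v + 1"
  by (cases f; cases v) (auto simp: floorlog_def)

lemma num_sz: "sz (num v) \<le> vsize v"
  by (cases v) (auto simp: floorlog_def)

lemma vsize_apply_bop: "vsize (apply_bop f u v) \<le> vsize u + vsize v + 1"
proof -
  note [simp del] = vsize.simps encode_simps
  have "sz (num u + num v) \<le> vsize u + vsize v + 1"
    using sz_add[of "num u" "num v"] num_sz[of u] num_sz[of v] by linarith
  moreover have "sz (num u - num v) \<le> vsize u + vsize v + 1"
    using sz_add[of "num u" "- num v"] sz_minus[of "num v"] num_sz[of u] num_sz[of v]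
    by (simp only: diff_conv_add_uminus)
  moreover have "sz (num u * num v) \<le> vsize u + vsize v + 1"
    using sz_mult[of "num u" "num v"] num_sz[of u] num_sz[of v] by linarith
  moreover have "sz (num u div num v) \<le> vsize u + vsize v + 1"
    using sz_div[of "num u" "num v"] num_sz[of u] by linarith
  moreover have "vsize (Num (of_bool (num u < num v))) \<le> vsize u + vsize v + 1"
    using sz_bool[of "num u < num v"] vsize_pos[of u] unfolding encode_simps by linarith
  ultimately show ?thesis by (cases f) (simp_all only: apply_bop.simps encode_simps vsize.simps)
qed


section \<open>Polynomial-time functions\<close>

text \<open>
  Fragments of programs are relocatable: \<open>n\<close> is the index at which the auxiliary functions \<open>P\<close> are
  placed.
\<close>

definition implements ::
    "nat \<Rightarrow> program \<Rightarrow> expr \<Rightarrow> ('a::enc \<Rightarrow> 'b::enc) \<Rightarrow> ('a \<Rightarrow> nat) \<Rightarrow> bool" where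
  "implements n P e f T \<longleftrightarrow> (\<forall>A B \<rho> x. length A = n \<longrightarrow>
     (\<exists>t\<le>T x. eval_expr (A @ P @ B) e (encode x # \<rho>) = return_spmf (encode (f x), t)))"

text \<open>One bound \<open>T\<close> serves all positions \<open>n\<close>, so that moving a
  fragment does not change its time. It bounds the size of the result as well, which is what the
  next fragment of a composition receives.\<close>

definition ptime :: "('a::enc \<Rightarrow> 'b::enc) \<Rightarrow> bool" where
  "ptime f \<longleftrightarrow> (\<exists>T. pb T \<and> (\<forall>x. sz (f x) \<le> T x) \<and> (\<forall>n. \<exists>P e. implements n P e f T))"

lemma implementsD:
  assumes "implements n P e f T" "length A = n"
  obtains t where "t \<le> T x" "eval_expr (A @ P @ B) e (encode x # \<rho>) = return_spmf (encode (f x), t)"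
  using assms unfolding implements_def by blast

lemma implements_append1: "implements n P e f T \<Longrightarrow> implements n (P @ P') e f T"
  unfolding implements_def by simp

lemma implements_append2:
  assumes "implements (n + length P') P e f T" shows "implements n (P' @ P) e f T"
  unfolding implements_def
proof (intro allI impI)
  fix A B :: program and \<rho> x assume "length A = n"
  then have "length (A @ P') = n + length P'" by simp
  from implementsD[OF assms this, of x B \<rho>]
  show "\<exists>t\<le>T x. eval_expr (A @ (P' @ P) @ B) e (encode x # \<rho>) = return_spmf (encode (f x), t)"
    by (metis append_assoc)
qed

lemma ptimeE:
  assumes "ptime f"
  obtains T where "pb T" "\<And>x. sz (f x) \<le> T x" "\<And>n. \<exists>P e. implements n P e f T"
  using assms unfolding ptime_def by blast

lemma ptime_pb: "ptime f \<Longrightarrow> pb (\<lambda>x. sz (f x))"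
  by (meson pb_mono ptimeE)

text \<open>The second fragment is chosen after the first, for the position at which the first ends;
  then both run over the concatenated list of auxiliary functions.\<close>

lemma implements2:
  assumes "\<And>n. \<exists>P e. implements n P e f T" "\<And>n. \<exists>P e. implements n P e g S"
  shows "\<exists>P e e'. implements n P e f T \<and> implements n P e' g S"
proof -
  obtain P e where 1: "implements n P e f T" using assms(1) by blast
  obtain P' e' where 2: "implements (n + length P) P' e' g S" using assms(2) by blast
  show ?thesis using implements_append1[OF 1, of P'] implements_append2[OF 2] by blast
qed

lemma implements3:
  assumes "\<And>n. \<exists>P e. implements n P e f T" "\<And>n. \<exists>P e. implements n P e g S"
    "\<And>n. \<exists>P e. implements n P e h R"
  shows "\<exists>P e e' e''. implements n P e f T \<and> implements n P e' g S \<and> implements n P e'' h R"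
proof -
  obtain P e e' where 1: "implements n P e f T" "implements n P e' g S"
    using implements2[OF assms(1,2)] by blast
  obtain P' e'' where 2: "implements (n + length P) P' e'' h R" using assms(3) by blast
  show ?thesis using 1[THEN implements_append1, of P'] implements_append2[OF 2] by blast
qed

lemma ptime_id [simp, intro]: "ptime (\<lambda>x. x)"
  unfolding ptime_def
proof (intro exI[of _ "\<lambda>x. 1 + sz x"] conjI allI)
  fix n show "\<exists>P e. implements n P e (\<lambda>x. x) (\<lambda>x. 1 + sz x)"
    by (rule exI[of _ "[]"], rule exI[of _ "Var 0"]) (simp add: implements_def eval_simps)
qed auto

lemma ptime_const [simp, intro]: "ptime (\<lambda>x. c)"
  unfolding ptime_def
proof (intro exI[of _ "\<lambda>x. 1 + sz c"] conjI allI)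
  fix n show "\<exists>P e. implements n P e (\<lambda>x. c) (\<lambda>x. 1 + sz c)"
    by (rule exI[of _ "[]"], rule exI[of _ "Const (encode c)"]) (simp add: implements_def eval_simps)
qed auto

text \<open>\<open>Bind\<close> puts the intermediate value at index 0, where the fragment for
  \<open>g\<close> expects its argument, with the old environment behind it; fragments tolerate any
  such rest.\<close>

lemma ptime_comp:
  assumes "ptime f" "ptime g"
  shows "ptime (\<lambda>x. g (f x))"
proof -
  obtain Tf where Tf: "pb Tf" "\<And>x. sz (f x) \<le> Tf x" "\<And>n. \<exists>P e. implements n P e f Tf"
    using ptimeE[OF assms(1)] by blast
  obtain Tg where Tg: "pb Tg" "\<And>x. sz (g x) \<le> Tg x" "\<And>n. \<exists>P e. implements n P e g Tg"
    using ptimeE[OF assms(2)] by blast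
  let ?T = "\<lambda>x. Tf x + Tg (f x) + 1"
  have "\<exists>P e. implements n P e (\<lambda>x. g (f x)) ?T" for n
  proof -
    obtain P ef eg where f: "implements n P ef f Tf" and g: "implements n P eg g Tg"
      using implements2[OF Tf(3) Tg(3)] by blast
    have "implements n P (Bind ef eg) (\<lambda>x. g (f x)) ?T"
      unfolding implements_def
    proof (intro allI impI)
      fix A B :: program and \<rho> x assume A: "length A = n"
      obtain t where t: "t \<le> Tf x"
        "eval_expr (A @ P @ B) ef (encode x # \<rho>) = return_spmf (encode (f x), t)"
        using implementsD[OF f A] by blast
      obtain t' where t': "t' \<le> Tg (f x)" "eval_expr (A @ P @ B) eg (encode (f x) # encode x # \<rho>)
          = return_spmf (encode (g (f x)), t')"
        using implementsD[OF g A] by blast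
      show "\<exists>t\<le>?T x. eval_expr (A @ P @ B) (Bind ef eg) (encode x # \<rho>)
          = return_spmf (encode (g (f x)), t)"
        using t t' by (simp add: eval_simps)
    qed
    then show ?thesis by blast
  qed
  moreover have "pb ?T"
    using Tf Tg pb_comp[OF Tg(1)] ptime_pb[OF assms(1)] by (intro pb_add) auto
  moreover have "sz (g (f x)) \<le> ?T x" for x using Tg(2)[of "f x"] by simp
  ultimately show ?thesis unfolding ptime_def by blast
qed

lemma ptime_uop:
  assumes "ptime f" and eq: "\<And>x. encode (g x) = apply_uop u (encode (f x))"
  shows "ptime g"
proof -
  obtain Tf where Tf: "pb Tf" "\<And>x. sz (f x) \<le> Tf x" "\<And>n. \<exists>P e. implements n P e f Tf"
    using ptimeE[OF assms(1)] by blast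
  let ?T = "\<lambda>x. Tf x + 2 + Tf x"
  have "\<exists>P e. implements n P e g ?T" for n
  proof -
    obtain P ef where f: "implements n P ef f Tf" using Tf by blast
    have "implements n P (Un_Op u ef) g ?T"
      unfolding implements_def
    proof (intro allI impI)
      fix A B :: program and \<rho> x assume A: "length A = n"
      obtain t where t: "t \<le> Tf x"
        "eval_expr (A @ P @ B) ef (encode x # \<rho>) = return_spmf (encode (f x), t)"
        using implementsD[OF f A] by blast
      show "\<exists>t\<le>?T x. eval_expr (A @ P @ B) (Un_Op u ef) (encode x # \<rho>) = return_spmf (encode (g x), t)"
        using t Tf(2)[of x] vsize_apply_uop[of u "encode (f x)"] by (simp add: eval_simps eq)
    qed
    then show ?thesis by blast
  qed
  moreover have "pb ?T" by (intro pb_add pb_const Tf(1))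
  moreover have "sz (g x) \<le> ?T x" for x
    using Tf(2)[of x] vsize_apply_uop[of u "encode (f x)"] by (simp add: eq)
  ultimately show ?thesis unfolding ptime_def by blast
qed

text \<open>The hypothesis compares encodings rather than typed values, so one machine operation
  implements several typed functions: \<open>Mk_Branch\<close> serves for pairs, for lists and for
  raw trees.\<close>

lemma ptime_bop:
  assumes "ptime f" "ptime g"
    and eq: "\<And>x. encode (h x) = apply_bop b (encode (f x)) (encode (g x))"
  shows "ptime h"
proof -
  obtain Tf where Tf: "pb Tf" "\<And>x. sz (f x) \<le> Tf x" "\<And>n. \<exists>P e. implements n P e f Tf"
    using ptimeE[OF assms(1)] by blast
  obtain Tg where Tg: "pb Tg" "\<And>x. sz (g x) \<le> Tg x" "\<And>n. \<exists>P e. implements n P e g Tg"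
    using ptimeE[OF assms(2)] by blast
  let ?T = "\<lambda>x. Tf x + Tf x + Tg x + Tg x + 2"
  have "\<exists>P e. implements n P e h ?T" for n
  proof -
    obtain P ef eg where f: "implements n P ef f Tf" and g: "implements n P eg g Tg"
      using implements2[OF Tf(3) Tg(3)] by blast
    have "implements n P (Bin_Op b ef eg) h ?T"
      unfolding implements_def
    proof (intro allI impI)
      fix A B :: program and \<rho> x assume A: "length A = n"
      obtain t where t: "t \<le> Tf x"
        "eval_expr (A @ P @ B) ef (encode x # \<rho>) = return_spmf (encode (f x), t)"
        using implementsD[OF f A] by blast
      obtain t' where t': "t' \<le> Tg x"
        "eval_expr (A @ P @ B) eg (encode x # \<rho>) = return_spmf (encode (g x), t')"
        using implementsD[OF g A] by blast
      show "\<exists>t\<le>?T x. eval_expr (A @ P @ B) (Bin_Op b ef eg) (encode x # \<rho>)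
          = return_spmf (encode (h x), t)"
        using t t' Tf(2)[of x] Tg(2)[of x] vsize_apply_bop[of b "encode (f x)" "encode (g x)"]
        by (simp add: eval_simps eq)
    qed
    then show ?thesis by blast
  qed
  moreover have "pb ?T" by (intro pb_add pb_const Tf(1) Tg(1))
  moreover have "sz (h x) \<le> ?T x" for x
    using Tf(2)[of x] Tg(2)[of x] vsize_apply_bop[of b "encode (f x)" "encode (g x)"]
    by (simp add: eq)
  ultimately show ?thesis unfolding ptime_def by blast
qed

lemma ptime_if:
  assumes "ptime p" "ptime f" "ptime g"
  shows "ptime (\<lambda>x. if p x then f x else g x)"
proof -
  obtain Tp where Tp: "pb Tp" "\<And>x. sz (p x) \<le> Tp x" "\<And>n. \<exists>P e. implements n P e p Tp"
    using ptimeE[OF assms(1)] by blast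
  obtain Tf where Tf: "pb Tf" "\<And>x. sz (f x) \<le> Tf x" "\<And>n. \<exists>P e. implements n P e f Tf"
    using ptimeE[OF assms(2)] by blast
  obtain Tg where Tg: "pb Tg" "\<And>x. sz (g x) \<le> Tg x" "\<And>n. \<exists>P e. implements n P e g Tg"
    using ptimeE[OF assms(3)] by blast
  let ?T = "\<lambda>x. Tp x + Tf x + Tg x + 1"
  have "\<exists>P e. implements n P e (\<lambda>x. if p x then f x else g x) ?T" for n
  proof -
    obtain P ep ef eg where p: "implements n P ep p Tp"
      and f: "implements n P ef f Tf" and g: "implements n P eg g Tg"
      using implements3[OF Tp(3) Tf(3) Tg(3)] by blast
    have "implements n P (Cond ep ef eg) (\<lambda>x. if p x then f x else g x) ?T"
      unfolding implements_def
    proof (intro allI impI)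
      fix A B :: program and \<rho> x assume A: "length A = n"
      obtain t where t: "t \<le> Tp x"
        "eval_expr (A @ P @ B) ep (encode x # \<rho>) = return_spmf (encode (p x), t)"
        using implementsD[OF p A] by blast
      obtain t' where t': "t' \<le> Tf x"
        "eval_expr (A @ P @ B) ef (encode x # \<rho>) = return_spmf (encode (f x), t')"
        using implementsD[OF f A] by blast
      obtain t'' where t'': "t'' \<le> Tg x"
        "eval_expr (A @ P @ B) eg (encode x # \<rho>) = return_spmf (encode (g x), t'')"
        using implementsD[OF g A] by blast
      show "\<exists>t\<le>?T x. eval_expr (A @ P @ B) (Cond ep ef eg) (encode x # \<rho>)
          = return_spmf (encode (if p x then f x else g x), t)"
        using t t' t'' by (cases "p x") (simp_all add: eval_simps)
    qed
    then show ?thesis by blast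
  qed
  moreover have "pb ?T" by (intro pb_add pb_const Tp(1) Tf(1) Tg(1))
  moreover have "sz (if p x then f x else g x) \<le> ?T x" for x
    using Tf(2)[of x] Tg(2)[of x] by simp
  ultimately show ?thesis unfolding ptime_def by blast
qed

lemma ptime_Pair: "ptime f \<Longrightarrow> ptime g \<Longrightarrow> ptime (\<lambda>x. (f x, g x))"
  by (rule ptime_bop[of f g _ Mk_Branch]) auto

lemma ptime_Cons: "ptime f \<Longrightarrow> ptime g \<Longrightarrow> ptime (\<lambda>x. f x # g x)"
  by (rule ptime_bop[of f g _ Mk_Branch]) auto

lemma ptime_fst: "ptime f \<Longrightarrow> ptime (\<lambda>x. fst (f x))"
  by (rule ptime_uop[of f _ Fst]) (auto simp: encode_prod_def)

lemma ptime_snd: "ptime f \<Longrightarrow> ptime (\<lambda>x. snd (f x))"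
  by (rule ptime_uop[of f _ Snd]) (auto simp: encode_prod_def)

lemma ptime_add: "ptime f \<Longrightarrow> ptime g \<Longrightarrow> ptime (\<lambda>x. f x + g x :: int)"
  by (rule ptime_bop[of f g _ Add]) auto

lemma ptime_diff: "ptime f \<Longrightarrow> ptime g \<Longrightarrow> ptime (\<lambda>x. f x - g x :: int)"
  by (rule ptime_bop[of f g _ Sub]) auto

lemma ptime_mult: "ptime f \<Longrightarrow> ptime g \<Longrightarrow> ptime (\<lambda>x. f x * g x :: int)"
  by (rule ptime_bop[of f g _ Mul]) auto

lemma ptime_div: "ptime f \<Longrightarrow> ptime g \<Longrightarrow> ptime (\<lambda>x. f x div g x :: int)"
  by (rule ptime_bop[of f g _ Div]) auto

lemma ptime_less: "ptime f \<Longrightarrow> ptime g \<Longrightarrow> ptime (\<lambda>x. (f x :: int) < g x)"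
  by (rule ptime_bop[of f g _ Less]) auto

lemma ptime_not: "ptime p \<Longrightarrow> ptime (\<lambda>x. \<not> p x)"
  using ptime_if[of p "\<lambda>_. False" "\<lambda>_. True"] by (simp add: if_bool_eq_disj cong: if_cong)

lemma ptime_conj: "ptime p \<Longrightarrow> ptime q \<Longrightarrow> ptime (\<lambda>x. p x \<and> q x)"
  using ptime_if[of p q "\<lambda>_. False"] by (simp add: if_bool_eq_disj conj_commute cong: if_cong)

lemma ptime_disj: "ptime p \<Longrightarrow> ptime q \<Longrightarrow> ptime (\<lambda>x. p x \<or> q x)"
  using ptime_not[OF ptime_conj[OF ptime_not[of p] ptime_not[of q]]] by simp

lemma ptime_le: "ptime f \<Longrightarrow> ptime g \<Longrightarrow> ptime (\<lambda>x. (f x :: int) \<le> g x)"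
  using ptime_not[OF ptime_less[of g f]] by (simp add: not_less)

lemma ptime_eq: "ptime f \<Longrightarrow> ptime g \<Longrightarrow> ptime (\<lambda>x. (f x :: int) = g x)"
  using ptime_conj[OF ptime_le[of f g] ptime_le[of g f]] by (simp add: order_eq_iff)

lemma ptime_mod: "ptime f \<Longrightarrow> ptime g \<Longrightarrow> ptime (\<lambda>x. f x mod g x :: int)"
  unfolding minus_div_mult_eq_mod[symmetric] by (intro ptime_diff ptime_mult ptime_div)

lemma ptime_max: "ptime f \<Longrightarrow> ptime g \<Longrightarrow> ptime (\<lambda>x. max (f x) (g x) :: int)"
  unfolding max_def by (intro ptime_if ptime_le)

lemma ptime_min: "ptime f \<Longrightarrow> ptime g \<Longrightarrow> ptime (\<lambda>x. min (f x) (g x) :: int)"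
  unfolding min_def by (intro ptime_if ptime_le)

lemma ptime_Let:
  assumes "ptime f" "ptime (\<lambda>p. g (fst p) (snd p))"
  shows "ptime (\<lambda>x. let y = f x in g x y)"
  using ptime_comp[OF ptime_Pair[OF ptime_id assms(1)] assms(2)] by (simp add: Let_def)

section \<open>Iteration over lists\<close>

text \<open>A loop as tail recursion: the function at index \<open>n\<close> calls itself on the
  triple of a fixed context, the accumulator and the remaining list. A nonempty list is recognized
  by being a \<open>Branch\<close>.\<close>

definition fold_body :: "nat \<Rightarrow> expr \<Rightarrow> expr" where
  "fold_body n eF =
     Cond (Un_Op Is_Branch (Un_Op Snd (Un_Op Snd (Var 0))))
       (Call n (Bin_Op Mk_Branch (Un_Op Fst (Var 0))
         (Bin_Op Mk_Branch
           (Bind (Bin_Op Mk_Branch (Un_Op Fst (Var 0)) (Bin_Op Mk_Branch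
              (Un_Op Fst (Un_Op Snd (Var 0))) (Un_Op Fst (Un_Op Snd (Un_Op Snd (Var 0)))))) eF)
           (Un_Op Snd (Un_Op Snd (Un_Op Snd (Var 0)))))))
       (Un_Op Fst (Un_Op Snd (Var 0)))"

lemma body_append: "length A = n \<Longrightarrow> body (A @ (e # P) @ B) n = e"
  by (simp add: body_def nth_append)

text \<open>\<open>W\<close> bounds the time of one step and \<open>D\<close> all sizes involved;
  \<open>100 * D + 100\<close> generously covers taking the triple apart and rebuilding it. Both
  bounds are asked only along prefixes of the list, that is, for accumulators that occur.\<close>

lemma fold_body_eval:
  fixes F :: "'c::enc \<times> 's::enc \<times> 'a::enc \<Rightarrow> 's" and A B :: program
  assumes F: "implements (Suc n) P eF F T" and A: "length A = n"
    and bd: "\<And>ys' y ys''. ys = ys' @ y # ys'' \<Longrightarrow>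
      T (c, foldl (\<lambda>s y. F (c, s, y)) s ys', y) \<le> W"
      "\<And>ys' ys''. ys = ys' @ ys'' \<Longrightarrow> sz (foldl (\<lambda>s y. F (c, s, y)) s ys') \<le> D"
      "sz c \<le> D" "sz ys \<le> D"
  shows "\<exists>t \<le> (length ys + 1) * (W + 100 * D + 100).
    eval_expr (A @ (fold_body n eF # P) @ B) (fold_body n eF) [encode (c, s, ys)]
      = return_spmf (encode (foldl (\<lambda>s y. F (c, s, y)) s ys), t)"
  using bd
proof (induction ys arbitrary: s)
  case Nil
  have [simp]: "Suc 0 + x = Suc x" for x by simp
  have "sz s \<le> D" using Nil(2)[of "[]"] by simp
  then show ?case using Nil
    by (simp add: fold_body_def eval_simps floorlog_def)
next
  case (Cons y ys)
  define Q where "Q = A @ fold_body n eF # P @ B"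
  have Q: "A @ (fold_body n eF # P) @ B = Q" "(A @ [fold_body n eF]) @ P @ B = Q"
    by (simp_all add: Q_def)
  let ?P = Q
  let ?s' = "F (c, s, y)"
  \<comment> \<open>The loop itself occupies index \<open>n\<close>, so the auxiliary functions of
    its step begin at \<open>Suc n\<close>.\<close>
  have A': "length (A @ [fold_body n eF]) = Suc n" using A by simp
  obtain t where t: "t \<le> T (c, s, y)" "\<And>\<rho>. eval_expr ((A @ [fold_body n eF]) @ P @ B) eF
      (encode (c, s, y) # [encode (c, s, y # ys)]) = return_spmf (encode ?s', t)"
    using implementsD[OF F A', of "(c, s, y)" B "[encode (c, s, y # ys)]"] by blast
  have tW: "t \<le> W" using t(1) Cons.prems(1)[of "[]" y ys] by simp
  have D: "sz s \<le> D" "sz ?s' \<le> D" "sz c \<le> D" "sz y + sz ys + 1 \<le> D"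
    using Cons.prems(2)[of "[]"] Cons.prems(2)[of "[y]"] Cons.prems(3,4) by auto
  have "\<exists>t \<le> (length ys + 1) * (W + 100 * D + 100).
    eval_expr ?P (fold_body n eF) [encode (c, ?s', ys)]
      = return_spmf (encode (foldl (\<lambda>s y. F (c, s, y)) ?s' ys), t)"
    unfolding Q(1)[symmetric]
  proof (rule Cons.IH)
    fix ys' z ys'' assume "ys = ys' @ z # ys''"
    then show "T (c, foldl (\<lambda>s y. F (c, s, y)) ?s' ys', z) \<le> W"
      using Cons.prems(1)[of "y # ys'" z ys''] by simp
  next
    fix ys' ys'' assume "ys = ys' @ ys''"
    then show "sz (foldl (\<lambda>s y. F (c, s, y)) ?s' ys') \<le> D"
      using Cons.prems(2)[of "y # ys'" ys''] by simp
  qed (use D in auto)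
  then obtain t' where t': "t' \<le> (length ys + 1) * (W + 100 * D + 100)"
    "eval_expr ?P (fold_body n eF) [encode (c, ?s', ys)]
      = return_spmf (encode (foldl (\<lambda>s y. F (c, s, y)) ?s' ys), t')" by blast
  have b: "body ?P n = fold_body n eF" using A unfolding Q(1)[symmetric] by (rule body_append)
  define u where "u = encode ?s'"
  have "\<exists>r \<le> t' + t + 100 * D + 100. eval_expr ?P (fold_body n eF) [encode (c, s, y # ys)]
      = return_spmf (encode (foldl (\<lambda>s y. F (c, s, y)) s (y # ys)), r)"
    apply (subst fold_body_def)
    using t(2) t'(2) D b unfolding Q
    by (simp add: eval_simps floorlog_def u_def[symmetric])
  then obtain r where r: "r \<le> t' + t + 100 * D + 100"
    "eval_expr ?P (fold_body n eF) [encode (c, s, y # ys)]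
      = return_spmf (encode (foldl (\<lambda>s y. F (c, s, y)) s (y # ys)), r)" by blast
  have "r \<le> (length (y # ys) + 1) * (W + 100 * D + 100)"
    using r(1) t'(1) tW by simp
  then show ?case using r(2) unfolding Q(1) by blast
qed

lemma implements_mono:
  "implements n P e f T \<Longrightarrow> (\<And>x. T x \<le> S x) \<Longrightarrow> implements n P e f S"
  unfolding implements_def
  apply (intro allI impI)
  subgoal premises p for A B \<rho> x
    using p(1)[rule_format, OF p(3), of x B \<rho>] p(2)[of x] le_trans by blast
  done

lemma ptime_comp2:
  assumes "ptime (\<lambda>p. F (fst p) (snd p))" "ptime f" "ptime g"
  shows "ptime (\<lambda>x. F (f x) (g x))"
  using ptime_comp[OF ptime_Pair[OF assms(2,3)] assms(1)] by simp

text \<open>A step that doubles the length of its accumulator is polynomial-time, yet its iteration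
  is not; \<open>B\<close> rules this out. As only accumulators reached from \<open>i x\<close> are
  concerned, \<open>bd\<close> may be proved from an invariant of the computation.\<close>

lemma ptime_foldl:
  fixes F :: "'c::enc \<times> 's::enc \<times> 'a::enc \<Rightarrow> 's"
  assumes F: "ptime F" and i: "ptime i" and xs: "ptime xs" and B: "pb B"
    and bd: "\<And>x ys zs. xs x = ys @ zs \<Longrightarrow> sz (foldl (\<lambda>s y. F (x, s, y)) (i x) ys) \<le> B x"
  shows "ptime (\<lambda>x. foldl (\<lambda>s y. F (x, s, y)) (i x) (xs x))"
proof -
  obtain Ti where Ti: "pb Ti" "\<And>x. sz (i x) \<le> Ti x" "\<And>n. \<exists>P e. implements n P e i Ti"
    using ptimeE[OF i] by blast
  obtain Tx where Tx: "pb Tx" "\<And>x. sz (xs x) \<le> Tx x" "\<And>n. \<exists>P e. implements n P e xs Tx"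
    using ptimeE[OF xs] by blast
  obtain TF where TF: "pb TF" "\<And>x. sz (F x) \<le> TF x" "\<And>n. \<exists>P e. implements n P e F TF"
    using ptimeE[OF F] by blast
  obtain TF' where TF': "\<And>x. TF x \<le> TF' (sz x)" "mono TF'"
    "\<And>S :: 'c \<Rightarrow> nat. pb S \<Longrightarrow> pb (\<lambda>x. TF' (S x))"
    using pb_comp_bound[OF TF(1), where 'b = 'c] by metis
  define D where "D = (\<lambda>x. sz x + B x + Tx x)"
  \<comment> \<open>A triple of context, accumulator and list element consists of three parts of
    size at most \<open>D x\<close> and two branchings.\<close>
  define W where "W = (\<lambda>x. TF' (3 * D x + 2))"
  define T where "T = (\<lambda>x. (Tx x + 1) * (W x + 100 * D x + 100) + 100 + 10 * Ti x + 10 * Tx x + 10 * sz x)"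
  have pD: "pb D" unfolding D_def by (intro pb_add pb_sz B Tx(1))
  have pW: "pb W" unfolding W_def by (intro TF'(3) pb_add pb_mult pb_const pD)
  have pT: "pb T" unfolding T_def by (intro pb_add pb_mult pb_const pb_sz pW pD Tx(1) Ti(1))
  let ?f = "\<lambda>x. foldl (\<lambda>s y. F (x, s, y)) (i x) (xs x)"
  have "\<exists>P e. implements n P e ?f T" for n
  proof -
    obtain P ei ex eF where i: "implements (Suc n) P ei i Ti" and x: "implements (Suc n) P ex xs Tx"
      and F: "implements (Suc n) P eF F TF"
      using implements3[OF Ti(3) Tx(3) TF(3)] by blast
    have i: "implements n (fold_body n eF # P) ei i Ti" and x: "implements n (fold_body n eF # P) ex xs Tx"
      using implements_append2[of n "[fold_body n eF]"] i x by auto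
    have "implements n (fold_body n eF # P)
       (Call n (Bin_Op Mk_Branch (Var 0) (Bin_Op Mk_Branch ei ex))) ?f T"
      unfolding implements_def
    proof (intro allI impI)
      fix A B' :: program and \<rho> x assume A: "length A = n"
      let ?P = "A @ (fold_body n eF # P) @ B'"
      obtain t where t: "t \<le> Ti x" "eval_expr ?P ei (encode x # \<rho>) = return_spmf (encode (i x), t)"
        using implementsD[OF i A] by blast
      obtain t' where t': "t' \<le> Tx x" "eval_expr ?P ex (encode x # \<rho>) = return_spmf (encode (xs x), t')"
        using implementsD[OF x A] by blast
      have "\<exists>t \<le> (length (xs x) + 1) * (W x + 100 * D x + 100).
         eval_expr ?P (fold_body n eF) [encode (x, i x, xs x)] = return_spmf (encode (?f x), t)"
      proof (rule fold_body_eval[OF F A])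
        fix ys' y ys'' assume ys: "xs x = ys' @ y # ys''"
        have "sz (x, foldl (\<lambda>s y. F (x, s, y)) (i x) ys', y) \<le> 3 * D x + 2"
          using bd[OF ys] sz_member[of y "xs x"] Tx(2)[of x] ys by (auto simp: D_def)
        then show "TF (x, foldl (\<lambda>s y. F (x, s, y)) (i x) ys', y) \<le> W x"
          unfolding W_def using TF'(1,2) by (meson le_trans monoD)
      next
        fix ys' ys'' assume ys: "xs x = ys' @ ys''"
        show "sz (foldl (\<lambda>s y. F (x, s, y)) (i x) ys') \<le> D x" using bd[OF ys] by (simp add: D_def)
      qed (use Tx(2)[of x] in \<open>simp_all add: D_def\<close>)
      then obtain t'' where t'': "t'' \<le> (length (xs x) + 1) * (W x + 100 * D x + 100)"
        "eval_expr ?P (fold_body n eF) [encode (x, i x, xs x)] = return_spmf (encode (?f x), t'')"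
        by blast
      have "(length (xs x) + 1) * (W x + 100 * D x + 100) \<le> (Tx x + 1) * (W x + 100 * D x + 100)"
        using length_less_sz[of "xs x"] Tx(2)[of x] by (intro mult_right_mono) auto
      then have t''': "t'' \<le> (Tx x + 1) * (W x + 100 * D x + 100)" using t''(1) by linarith
      have b: "body ?P n = fold_body n eF" using A by (rule body_append)
      have "\<exists>r \<le> t'' + 100 + 10 * Ti x + 10 * Tx x + 10 * sz x.
         eval_expr ?P (Call n (Bin_Op Mk_Branch (Var 0) (Bin_Op Mk_Branch ei ex))) (encode x # \<rho>)
          = return_spmf (encode (?f x), r)"
        using t t' t''(2) b Ti(2)[of x] Tx(2)[of x] by (simp add: eval_simps)
      then show "\<exists>r \<le> T x.
         eval_expr ?P (Call n (Bin_Op Mk_Branch (Var 0) (Bin_Op Mk_Branch ei ex))) (encode x # \<rho>)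
          = return_spmf (encode (?f x), r)" 
        using t''' by (elim exE conjE, intro exI conjI) (auto simp: T_def)
    qed
    then show ?thesis by blast
  qed
  \<comment> \<open>\<open>ptime\<close> wants one function to bound both the time and the size of
    the result; \<open>B\<close> is added for the latter.\<close>
  then have "\<exists>P e. implements n P e ?f (\<lambda>x. T x + B x)" for n
  proof -
    obtain P e where "implements n P e ?f T" using \<open>\<And>n. \<exists>P e. implements n P e ?f T\<close> by blast
    then have "implements n P e ?f (\<lambda>x. T x + B x)" by (rule implements_mono) (rule le_add1)
    then show ?thesis by (intro exI)
  qed
  moreover have "sz (?f x) \<le> T x + B x" for x using bd[of x "xs x" "[]"] by simp
  ultimately show ?thesis
    unfolding ptime_def by (intro exI[of _ "\<lambda>x. T x + B x"] conjI allI pb_add pT B)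
qed

lemma ptime_foldl':
  assumes "ptime (\<lambda>p. F (fst p) (fst (snd p)) (snd (snd p)))" "ptime i" "ptime xs" "pb B"
    and "\<And>x ys zs. xs x = ys @ zs \<Longrightarrow> sz (foldl (F x) (i x) ys) \<le> B x"
  shows "ptime (\<lambda>x. foldl (F x) (i x) (xs x))"
  using ptime_foldl[OF assms(1-4)] assms(5) by simp

section \<open>List operations, sums and products in polynomial time\<close>

lemma ptime_rev:
  fixes f :: "'a::enc \<Rightarrow> 'b::enc list"
  assumes "ptime f" shows "ptime (\<lambda>x. rev (f x))"
proof -
  have eq: "foldl (\<lambda>s y. y # s) zs ys = rev ys @ zs" for zs ys :: "'b list"
    by (induction ys arbitrary: zs) auto
  have "ptime (\<lambda>x. foldl (\<lambda>s y. y # s) [] (f x))"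
  proof (rule ptime_foldl'[where B = "\<lambda>x. sz (f x)"])
    fix x ys zs assume "f x = ys @ zs"
    then show "sz (foldl (\<lambda>s y. y # s) [] ys) \<le> sz (f x)"
      by (simp add: eq sz_list rev_map[symmetric] del: encode_simps)
  qed (auto intro!: assms ptime_Cons ptime_fst ptime_snd ptime_pb)
  then show ?thesis by (simp add: eq)
qed

lemma ptime_append:
  fixes f g :: "'a::enc \<Rightarrow> 'b::enc list"
  assumes "ptime f" "ptime g" shows "ptime (\<lambda>x. f x @ g x)"
proof -
  have eq: "foldl (\<lambda>s y. y # s) zs ys = rev ys @ zs" for zs ys :: "'b list"
    by (induction ys arbitrary: zs) auto
  have "ptime (\<lambda>x. foldl (\<lambda>s y. y # s) (g x) (rev (f x)))"
  proof (rule ptime_foldl'[where B = "\<lambda>x. sz (f x) + sz (g x)"])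
    fix x ys zs assume *: "rev (f x) = ys @ zs"
    have "(\<Sum>y\<leftarrow>ys. Suc (sz y)) \<le> (\<Sum>y\<leftarrow>rev (f x). Suc (sz y))" unfolding * by simp
    then show "sz (foldl (\<lambda>s y. y # s) (g x) ys) \<le> sz (f x) + sz (g x)"
      by (simp add: eq sz_list rev_map[symmetric] del: encode_simps)
  qed (auto intro!: assms ptime_Cons ptime_fst ptime_snd ptime_pb ptime_rev)
  then show ?thesis by (simp add: eq)
qed

lemma sum_list_le_length:
  "(\<And>x. x \<in> set xs \<Longrightarrow> f x \<le> c) \<Longrightarrow> sum_list (map f xs) \<le> length xs * (c::nat)"
  by (induction xs) (auto simp: add_mono)

lemma pb_sum_list:
  assumes g: "pb g" and xs: "pb (\<lambda>x. sz (xs x))"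
  shows "pb (\<lambda>x. \<Sum>y\<leftarrow>xs x. g (x, y))"
proof -
  obtain g' where g': "\<And>x. g x \<le> g' (sz x)" "mono g'"
    "\<And>S :: 'a \<Rightarrow> nat. pb S \<Longrightarrow> pb (\<lambda>x. g' (S x))"
    using pb_comp_bound[OF g, where 'b = 'a] by metis
  have "pb (\<lambda>x. sz (xs x) * g' (sz x + sz (xs x) + 1))"
    by (intro pb_mult g'(3) pb_add pb_sz xs pb_const)
  then show ?thesis
  proof (rule pb_mono)
    fix x
    have "(\<Sum>y\<leftarrow>xs x. g (x, y)) \<le> length (xs x) * g' (sz x + sz (xs x) + 1)"
    proof (rule sum_list_le_length)
      fix y assume "y \<in> set (xs x)"
      then have "sz (x, y) \<le> sz x + sz (xs x) + 1" using sz_member[of y "xs x"] by simp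
      then show "g (x, y) \<le> g' (sz x + sz (xs x) + 1)" using g' by (meson le_trans monoD)
    qed
    also have "\<dots> \<le> sz (xs x) * g' (sz x + sz (xs x) + 1)"
      using length_less_sz[of "xs x"] by (intro mult_right_mono) auto
    finally show "(\<Sum>y\<leftarrow>xs x. g (x, y)) \<le> \<dots>" .
  qed
qed

lemma sz_concat_map: "sz (concat (map F ys)) \<le> 1 + (\<Sum>y\<leftarrow>ys. sz (F y))"
proof (induction ys)
  case (Cons y ys)
  then show ?case using sz_append[of "F y" "concat (map F ys)"] by (simp del: encode_simps(1-5))
qed (simp add: floorlog_def)

text \<open>The common source of mapping and filtering, where each element contributes a list of at
  most one entry.\<close>

lemma ptime_concat_map:
  fixes F :: "'a::enc \<Rightarrow> 'b::enc \<Rightarrow> 'c::enc list"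
  assumes F: "ptime (\<lambda>p. F (fst p) (snd p))" and xs: "ptime xs"
  shows "ptime (\<lambda>x. concat (map (F x) (xs x)))"
proof -
  have eq: "foldl (\<lambda>s y. s @ F x y) zs ys = zs @ concat (map (F x) ys)" for x zs ys
    by (induction ys arbitrary: zs) auto
  have "ptime (\<lambda>x. foldl (\<lambda>s y. s @ F x y) [] (xs x))"
  proof (rule ptime_foldl'[where F = "\<lambda>x s y. s @ F x y"
        and B = "\<lambda>x. 1 + (\<Sum>y\<leftarrow>xs x. sz (F (fst (x, y)) (snd (x, y))))"])
    show "pb (\<lambda>x. 1 + (\<Sum>y\<leftarrow>xs x. sz (F (fst (x, y)) (snd (x, y)))))"
      by (intro pb_add pb_const pb_sum_list ptime_pb[OF F] ptime_pb[OF xs])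
    fix x ys zs assume *: "xs x = ys @ zs"
    show "sz (foldl (\<lambda>s y. s @ F x y) [] ys) \<le> 1 + (\<Sum>y\<leftarrow>xs x. sz (F (fst (x, y)) (snd (x, y))))"
      using sz_concat_map[of "F x" ys] by (simp add: eq * del: encode_simps)
  next
    show "ptime (\<lambda>p. fst (snd p) @ F (fst p) (snd (snd p)))"
      by (rule ptime_append[OF ptime_fst[OF ptime_snd[OF ptime_id]] ptime_comp2[OF F ptime_fst[OF ptime_id] ptime_snd[OF ptime_snd[OF ptime_id]]]])
  qed (auto intro: xs)
  then show ?thesis by (simp add: eq)
qed

lemma ptime_map:
  assumes "ptime (\<lambda>p. F (fst p) (snd p))" "ptime xs"
  shows "ptime (\<lambda>x. map (F x) (xs x))"
proof -
  have "concat (map (\<lambda>y. [F x y]) ys) = map (F x) ys" for x ys by (induction ys) auto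
  then show ?thesis
    using ptime_concat_map[of "\<lambda>x y. [F x y]" xs] assms by (simp add: ptime_Cons)
qed

lemma ptime_filter:
  assumes "ptime (\<lambda>p. F (fst p) (snd p))" "ptime xs"
  shows "ptime (\<lambda>x. filter (F x) (xs x))"
proof -
  have "concat (map (\<lambda>y. if F x y then [y] else []) ys) = filter (F x) ys" for x ys
    by (induction ys) auto
  then show ?thesis
    using ptime_concat_map[of "\<lambda>x y. if F x y then [y] else []" xs] assms
    by (simp add: ptime_Cons ptime_if ptime_snd)
qed

lemma sz_sum_list: "sz (\<Sum>y\<leftarrow>ys. f y :: int) \<le> 2 + (\<Sum>y\<leftarrow>ys. sz (f y) + 1)"
proof (induction ys)
  case (Cons y ys)
  then show ?case using sz_add[of "f y" "\<Sum>y\<leftarrow>ys. f y"] by (simp del: encode_simps)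
qed (simp add: floorlog_def)

lemma ptime_sum_list:
  fixes F :: "'a::enc \<Rightarrow> 'b::enc \<Rightarrow> int"
  assumes F: "ptime (\<lambda>p. F (fst p) (snd p))" and xs: "ptime xs"
  shows "ptime (\<lambda>x. \<Sum>y\<leftarrow>xs x. F x y)"
proof -
  have eq: "foldl (\<lambda>s y. s + F x y) z ys = z + (\<Sum>y\<leftarrow>ys. F x y)" for x z ys
    by (induction ys arbitrary: z) auto
  have "ptime (\<lambda>x. foldl (\<lambda>s y. s + F x y) 0 (xs x))"
  proof (rule ptime_foldl'[where F = "\<lambda>x s y. s + F x y"
        and B = "\<lambda>x. 2 + (\<Sum>y\<leftarrow>xs x. sz (F (fst (x, y)) (snd (x, y))) + 1)"])
    show "pb (\<lambda>x. 2 + (\<Sum>y\<leftarrow>xs x. sz (F (fst (x, y)) (snd (x, y))) + 1))"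
      by (intro pb_add pb_const pb_sum_list[where g = "\<lambda>p. sz (F (fst p) (snd p)) + 1"] ptime_pb[OF F] ptime_pb[OF xs])
    fix x ys zs assume *: "xs x = ys @ zs"
    show "sz (foldl (\<lambda>s y. s + F x y) 0 ys) \<le> 2 + (\<Sum>y\<leftarrow>xs x. sz (F (fst (x, y)) (snd (x, y))) + 1)"
      using sz_sum_list[of "F x" ys] by (simp add: eq * del: encode_simps)
  next
    show "ptime (\<lambda>p. fst (snd p) + F (fst p) (snd (snd p)))"
      by (rule ptime_add[OF ptime_fst[OF ptime_snd[OF ptime_id]] ptime_comp2[OF F ptime_fst[OF ptime_id] ptime_snd[OF ptime_snd[OF ptime_id]]]])
  qed (auto intro: xs)
  then show ?thesis by (simp add: eq)
qed

lemma sz_prod_list: "sz (\<Prod>y\<leftarrow>ys. f y :: int) \<le> 2 + (\<Sum>y\<leftarrow>ys. sz (f y) + 1)"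
proof (induction ys)
  case (Cons y ys)
  then show ?case using sz_mult[of "f y" "\<Prod>y\<leftarrow>ys. f y"] by (simp del: encode_simps)
qed (simp add: floorlog_def compute_floorlog)

lemma ptime_prod_list:
  fixes F :: "'a::enc \<Rightarrow> 'b::enc \<Rightarrow> int"
  assumes F: "ptime (\<lambda>p. F (fst p) (snd p))" and xs: "ptime xs"
  shows "ptime (\<lambda>x. \<Prod>y\<leftarrow>xs x. F x y)"
proof -
  have eq: "foldl (\<lambda>s y. s * F x y) z ys = z * (\<Prod>y\<leftarrow>ys. F x y)" for x z ys
    by (induction ys arbitrary: z) auto
  have "ptime (\<lambda>x. foldl (\<lambda>s y. s * F x y) 1 (xs x))"
  proof (rule ptime_foldl'[where F = "\<lambda>x s y. s * F x y"
        and B = "\<lambda>x. 2 + (\<Sum>y\<leftarrow>xs x. sz (F (fst (x, y)) (snd (x, y))) + 1)"])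
    show "pb (\<lambda>x. 2 + (\<Sum>y\<leftarrow>xs x. sz (F (fst (x, y)) (snd (x, y))) + 1))"
      by (intro pb_add pb_const pb_sum_list[where g = "\<lambda>p. sz (F (fst p) (snd p)) + 1"] ptime_pb[OF F] ptime_pb[OF xs])
    fix x ys zs assume *: "xs x = ys @ zs"
    show "sz (foldl (\<lambda>s y. s * F x y) 1 ys) \<le> 2 + (\<Sum>y\<leftarrow>xs x. sz (F (fst (x, y)) (snd (x, y))) + 1)"
      using sz_prod_list[of "F x" ys] by (simp add: eq * del: encode_simps)
  next
    show "ptime (\<lambda>p. fst (snd p) * F (fst p) (snd (snd p)))"
      by (rule ptime_mult[OF ptime_fst[OF ptime_snd[OF ptime_id]] ptime_comp2[OF F ptime_fst[OF ptime_id] ptime_snd[OF ptime_snd[OF ptime_id]]]])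
  qed (auto intro: xs)
  then show ?thesis by (simp add: eq)
qed

text \<open>Counting the elements that violate the predicate reduces the test to a sum.\<close>

lemma ptime_ball:
  assumes "ptime (\<lambda>p. F (fst p) (snd p))" "ptime xs"
  shows "ptime (\<lambda>x. list_all (F x) (xs x))"
proof -
  have "(\<Sum>y\<leftarrow>ys. if F x y then 0 else 1) \<ge> (0::int) \<and>
    (list_all (F x) ys \<longleftrightarrow> (\<Sum>y\<leftarrow>ys. if F x y then 0 else 1) < (1::int))" for x ys
    by (induction ys) auto
  then have "list_all (F x) ys = ((\<Sum>y\<leftarrow>ys. if F x y then 0 else 1) < (1::int))" for x ys by blast
  then show ?thesis
    by (simp add: assms ptime_less ptime_sum_list ptime_if)
qed

lemma ptime_length:
  assumes "ptime xs" shows "ptime (\<lambda>x. int (length (xs x)))"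
proof -
  have "int (length ys) = (\<Sum>y\<leftarrow>ys. 1)" for ys :: "'b list" by (induction ys) auto
  then show ?thesis by (simp add: assms ptime_sum_list)
qed

lemma ptime_comp3:
  assumes "ptime (\<lambda>p. F (fst p) (fst (snd p)) (snd (snd p)))" "ptime f" "ptime g" "ptime h"
  shows "ptime (\<lambda>x. F (f x) (g x) (h x))"
  using ptime_comp[OF ptime_Pair[OF assms(2) ptime_Pair[OF assms(3,4)]] assms(1)] by simp

lemma ptime_eq_prod:
  fixes f g :: "'a::enc \<Rightarrow> 'b::enc \<times> 'c::enc"
  assumes "ptime (\<lambda>x. fst (f x) = fst (g x))" "ptime (\<lambda>x. snd (f x) = snd (g x))"
  shows "ptime (\<lambda>x. f x = g x)"
  unfolding prod_eq_iff by (intro ptime_conj assms)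

text \<open>With these rules a function is polynomial-time by the syntax of its definition; only
  iterations need a separate bound. Functions of two or three arguments join the collection through
  \<open>ptime_comp2\<close> and \<open>ptime_comp3\<close>.\<close>

named_theorems ptime_intros

lemmas [ptime_intros] =
  ptime_id ptime_const ptime_Pair ptime_Cons ptime_fst ptime_snd ptime_add ptime_diff ptime_mult
  ptime_div ptime_mod ptime_less ptime_le ptime_eq ptime_eq_prod ptime_not ptime_conj ptime_disj
  ptime_max ptime_min ptime_if ptime_Let ptime_rev ptime_append ptime_concat_map ptime_map
  ptime_filter ptime_sum_list ptime_prod_list ptime_ball ptime_length

section \<open>Selecting from weighted lists\<close>

text \<open>The state is (found, (item, rest)). A negative weight stops the search: subtracting it
  would enlarge the rest, which has to stay within its initial absolute value on every
  input.\<close>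

definition pick_step :: "bool \<times> 'a \<times> int \<Rightarrow> 'a \<times> int \<Rightarrow> bool \<times> 'a \<times> int" where
  "pick_step s y =
     (if fst s then s
      else if snd (snd s) < snd y \<or> snd y < 0 then (True, (fst y, snd (snd s)))
      else (False, (fst (snd s), snd (snd s) - snd y)))"

text \<open>With the weights as lengths of intervals laid end to end from 0, this locates the
  interval that contains \<open>u\<close> and the offset of \<open>u\<close> in it, as in the
  inversion of a cumulative distribution.\<close>

definition pick :: "'a \<Rightarrow> ('a \<times> int) list \<Rightarrow> int \<Rightarrow> 'a \<times> int" where
  "pick d xs u = snd (foldl pick_step (False, (d, u)) xs)"

lemma pick_fold:
  "\<bar>snd (snd (foldl pick_step s xs))\<bar> \<le> \<bar>snd (snd s)\<bar> \<and>
   fst (snd (foldl pick_step s xs)) \<in> insert (fst (snd s)) (fst ` set xs)"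
proof (induction xs arbitrary: s)
  case (Cons x xs)
  have "\<bar>snd (snd (pick_step s x))\<bar> \<le> \<bar>snd (snd s)\<bar>"
    "fst (snd (pick_step s x)) \<in> {fst (snd s), fst x}"
    by (auto simp: pick_step_def)
  then show ?case using Cons[of "pick_step s x"] by auto
qed simp

lemma pick_abs_le: "\<bar>snd (pick d xs u)\<bar> \<le> \<bar>u\<bar>"
  and pick_fst_in: "fst (pick d xs u) \<in> insert d (fst ` set xs)"
  using pick_fold[of "(False, (d, u))" xs] by (simp_all add: pick_def)

lemma sz_prod: "sz p = 1 + sz (fst p) + sz (snd p)"
  by (cases p) simp

lemma sz_fst_member: "x \<in> fst ` set xs \<Longrightarrow> sz x \<le> sz xs"
  using sz_member[of _ xs] sz_fst by (metis imageE less_imp_le_nat order_trans)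

lemma ptime_pick_step: "ptime (\<lambda>p. pick_step (fst p) (snd p))"
  unfolding pick_step_def by (intro ptime_intros)

lemma ptime_pick0:
  "ptime (\<lambda>p. pick (fst p :: 'a::enc) (fst (snd p)) (snd (snd p)))"
  unfolding pick_def
proof (intro ptime_snd ptime_foldl'[where F = "\<lambda>_. pick_step"
      and B = "\<lambda>p. 2 * sz p + 10"] ptime_comp2[OF ptime_pick_step] ptime_intros)
  show "pb (\<lambda>p :: 'a \<times> ('a \<times> int) list \<times> int. 2 * sz p + 10)"
    by (intro pb_add pb_mult pb_sz pb_const)
  fix p :: "'a \<times> ('a \<times> int) list \<times> int" and ys zs
  assume *: "fst (snd p) = ys @ zs"
  let ?s = "foldl pick_step (False, fst p, snd (snd p)) ys"
  have "\<bar>snd (snd ?s)\<bar> \<le> \<bar>snd (snd p)\<bar>" "fst (snd ?s) \<in> insert (fst p) (fst ` set ys)"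
    using pick_fold[of "(False, fst p, snd (snd p))" ys] by auto
  moreover have "sz ys \<le> sz (ys @ zs)" using sz_append[of ys zs] vsize_pos[of "encode zs"] by linarith
  ultimately have "sz (snd (snd ?s)) \<le> Suc (sz (snd (snd p)))"
    "sz (fst (snd ?s)) \<le> sz (fst p) + sz (fst (snd p))"
    using sz_of_abs_le[of "snd (snd ?s)" "snd (snd p)"] sz_fst_member[of "fst (snd ?s)" ys]
    unfolding * insert_iff by (blast, fastforce simp del: encode_simps)
  then show "sz ?s \<le> 2 * sz p + 10"
    using sz_bool[of "fst ?s"] unfolding sz_prod[of ?s] sz_prod[of "snd ?s"] sz_prod[of p] sz_prod[of "snd p"]
    by (simp del: encode_simps vsize.simps)
qed

lemmas ptime_pick [ptime_intros] = ptime_comp3[OF ptime_pick0]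

text \<open>Indexing is selection with unit weights. An index out of range yields the first or the
  last element; the default is returned for the empty list only.\<close>

definition nthd :: "'a \<Rightarrow> 'a list \<Rightarrow> int \<Rightarrow> 'a" where
  "nthd d xs i = fst (pick d (map (\<lambda>x. (x, 1)) xs) i)"

lemma ptime_nthd0: "ptime (\<lambda>p. nthd (fst p) (fst (snd p)) (snd (snd p)))"
  unfolding nthd_def by (intro ptime_intros)

lemmas ptime_nthd [ptime_intros] = ptime_comp3[OF ptime_nthd0]

text \<open>Ranges are produced from the length of a list and never from a number in binary, whose
  value may be exponential in its size.\<close>

definition idx :: "'a list \<Rightarrow> int list" where
  "idx xs = foldl (\<lambda>s _. s @ [int (length s)]) [] xs"

lemma idx_eq: "idx xs = map int [0..<length xs]"
proof -
  have "foldl (\<lambda>s _. s @ [int (length s)]) (map int [0..<n]) xs = map int [0..<n + length xs]" for n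
  proof (induction xs arbitrary: n)
    case (Cons x xs)
    then show ?case using Cons[of "Suc n"] by simp
  qed simp
  from this[of 0] show ?thesis by (simp add: idx_def)
qed

lemma sz_int_le: "sz (int n) \<le> n + 1"
  using sz_le_of_abs_less[of "int n" n] by (simp add: of_nat_less_two_power)

lemma sz_idx: "sz (idx xs) \<le> 1 + length xs * (length xs + 2)"
proof -
  have "(\<Sum>x\<leftarrow>idx xs. sz x + 1) \<le> length (idx xs) * (length xs + 2)"
  proof (rule sum_list_le_length)
    fix x assume "x \<in> set (idx xs)"
    then obtain i where "x = int i" "i < length xs" by (auto simp: idx_eq)
    then show "sz x + 1 \<le> length xs + 2" using sz_int_le[of i] by simp
  qed
  then have "sz (idx xs) \<le> 1 + length (idx xs) * (length xs + 2)" unfolding sz_list[of "idx xs"] by linarith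
  then show ?thesis by (simp add: idx_eq)
qed

lemma ptime_idx0: "ptime (idx :: 'a::enc list \<Rightarrow> int list)"
  unfolding idx_def
proof (intro ptime_foldl'[where F = "\<lambda>_ s _. s @ [int (length s)]"
      and B = "\<lambda>p. 1 + sz p * (sz p + 2)"] ptime_intros)
  show "pb (\<lambda>p :: 'a list. 1 + sz p * (sz p + 2))"
    by (intro pb_add pb_mult pb_sz pb_const)
  fix xs ys zs :: "'a list" assume *: "xs = ys @ zs"
  have "length ys * (length ys + 2) \<le> sz xs * (sz xs + 2)"
    using length_less_sz[of xs] by (intro mult_mono) (auto simp: *)
  then show "sz (foldl (\<lambda>s _. s @ [int (length s)]) [] ys) \<le> 1 + sz xs * (sz xs + 2)"
    using sz_idx[of ys] by (simp add: idx_def)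
qed

lemmas ptime_idx [ptime_intros] = ptime_comp[OF _ ptime_idx0]


section \<open>Greedy allocation\<close>

type_synonym 't item = "'t \<times> int \<times> int \<times> int"

abbreviation (input) icost :: "'t item \<Rightarrow> int" where "icost y \<equiv> fst (snd y)"
abbreviation (input) ilo :: "'t item \<Rightarrow> int" where "ilo y \<equiv> fst (snd (snd y))"
abbreviation (input) ihi :: "'t item \<Rightarrow> int" where "ihi y \<equiv> snd (snd (snd y))"

definition insert_item :: "'t item list \<Rightarrow> 't item \<Rightarrow> 't item list" where
  "insert_item xs x =
     filter (\<lambda>y. icost y \<le> icost x) xs @ x # filter (\<lambda>y. icost x < icost y) xs"

definition sort_items :: "'t item list \<Rightarrow> 't item list" where
  "sort_items xs = foldl insert_item [] xs"

text \<open>Every item receives its lower bound in any case; the number in the state is the surplus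
  still to be distributed. On sensible inputs the clamping at 0 does nothing, and on others it keeps
  the surplus from growing in absolute value.\<close>

definition fill_step ::
    "int \<times> ('t \<times> int \<times> int) list \<Rightarrow> 't item \<Rightarrow> int \<times> ('t \<times> int \<times> int) list" where
  "fill_step s y = (let d = max 0 (min (ihi y - ilo y) (fst s)) in
     (fst s - d, (fst y, (icost y, ilo y + d)) # snd s))"

definition greedy :: "'t item list \<Rightarrow> int \<Rightarrow> ('t \<times> int \<times> int) list" where
  "greedy xs N = snd (foldl fill_step (N - (\<Sum>y\<leftarrow>xs. ilo y), []) (sort_items xs))"

lemma mset_insert_item: "mset (insert_item xs x) = add_mset x (mset xs)"
proof -
  have "filter (\<lambda>y. icost x < icost y) xs = filter (\<lambda>y. \<not> icost y \<le> icost x) xs"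
    by (simp add: not_le)
  then show ?thesis
    unfolding insert_item_def mset_append mset.simps mset_filter
    using multiset_partition[of "mset xs" "\<lambda>y. icost y \<le> icost x"] by (simp add: not_le)
qed

lemma mset_sort_items: "mset (sort_items xs) = mset xs"
proof -
  have "mset (foldl insert_item ys xs) = mset ys + mset xs" for ys
    by (induction xs arbitrary: ys) (auto simp: mset_insert_item)
  then show ?thesis by (simp add: sort_items_def)
qed

lemma sz_list_mset: "mset xs = mset ys \<Longrightarrow> sz xs = sz ys"
  unfolding sz_list by (metis mset_map sum_mset_sum_list)

lemma ptime_insert_item: "ptime (\<lambda>p. insert_item (fst p) (snd p))"
  unfolding insert_item_def by (intro ptime_intros)

lemma ptime_sort_items0: "ptime (sort_items :: 't::enc item list \<Rightarrow> 't item list)"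
  unfolding sort_items_def
proof (intro ptime_foldl'[where F = "\<lambda>_. insert_item" and B = "\<lambda>p. sz p"]
    ptime_comp2[OF ptime_insert_item] ptime_intros)
  fix xs ys zs :: "'t item list" assume *: "xs = ys @ zs"
  have "sz (foldl insert_item [] ys) = sz ys"
    using mset_sort_items[of ys] by (intro sz_list_mset) (simp add: sort_items_def)
  then show "sz (foldl insert_item [] ys) \<le> sz xs"
    using sz_append[of ys zs] vsize_pos[of "encode zs"] unfolding * by linarith
qed (rule pb_sz)

lemmas ptime_sort_items [ptime_intros] = ptime_comp[OF _ ptime_sort_items0]

lemma ptime_fill_step: "ptime (\<lambda>p. fill_step (fst p) (snd p))"
  unfolding fill_step_def by (intro ptime_intros)

lemma sz_fill:
  assumes "\<bar>fst s\<bar> \<le> \<bar>R\<bar>"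
  shows "\<bar>fst (foldl fill_step s ys)\<bar> \<le> \<bar>R\<bar> \<and>
   sz (snd (foldl fill_step s ys)) \<le> sz (snd s) + (sz R + 10) * sz ys"
  using assms
proof (induction ys arbitrary: s)
  case (Cons y ys)
  define d where "d = max 0 (min (ihi y - ilo y) (fst s))"
  have d: "\<bar>d\<bar> \<le> \<bar>R\<bar>" "\<bar>fst s - d\<bar> \<le> \<bar>R\<bar>" using Cons.prems by (auto simp: d_def)
  have step: "fill_step s y = (fst s - d, (fst y, (icost y, ilo y + d)) # snd s)"
    by (simp add: fill_step_def d_def Let_def)
  note IH = Cons.IH[of "fill_step s y"]
  have 1: "sz (ilo y + d) \<le> sz (ilo y) + sz R + 2"
    using sz_add[of "ilo y" d] sz_of_abs_le[OF d(1)] by linarith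
  have "sz (snd (fill_step s y)) \<le> sz (snd s) + sz R + sz y + 5"
    using 1 vsize_pos[of "encode (ihi y)"]
    unfolding step snd_conv sz_Cons sz_prod[of "(a, b)" for a :: 'a and b :: "int \<times> int"] sz_prod[of "(a, b)" for a b :: int] sz_prod[of y] sz_prod[of "snd y"]
      sz_prod[of "snd (snd y)"] fst_conv by linarith
  moreover have "sz R + sz y + 5 \<le> (sz R + 10) * (1 + sz y)"
    by (simp add: algebra_simps del: encode_simps vsize.simps)
  moreover have "(sz R + 10) * sz (y # ys) = (sz R + 10) * (1 + sz y) + (sz R + 10) * sz ys"
    unfolding sz_Cons by (simp add: algebra_simps)
  ultimately have "sz (snd (foldl fill_step (fill_step s y) ys)) \<le> sz (snd s) + (sz R + 10) * sz (y # ys)"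
    using IH d(2) unfolding step fst_conv snd_conv by linarith
  then show ?case using IH d(2) unfolding foldl.simps step fst_conv by blast
qed simp

lemma ptime_greedy0: "ptime (\<lambda>p. greedy (fst p :: 't::enc item list) (snd p))"
  unfolding greedy_def
proof (intro ptime_snd ptime_foldl'[where F = "\<lambda>_. fill_step"] ptime_comp2[OF ptime_fill_step]
      ptime_intros)
  let ?R = "\<lambda>p :: 't item list \<times> int. snd p - (\<Sum>y\<leftarrow>fst p. ilo y)"
  have "ptime ?R" by (intro ptime_intros)
  then show "pb (\<lambda>p. 5 + sz (?R p) + (sz (?R p) + 10) * sz p)"
    by (intro pb_add pb_mult pb_sz pb_const ptime_pb)
  fix p :: "'t item list \<times> int" and ys zs
  assume *: "sort_items (fst p) = ys @ zs"
  have nil: "sz ([] :: ('t \<times> int \<times> int) list) = 1" by (simp add: floorlog_def)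
  have "sz ys \<le> sz (sort_items (fst p))"
    using sz_append[of ys zs] vsize_pos[of "encode zs"] unfolding * by linarith
  also have "\<dots> = sz (fst p)" by (intro sz_list_mset mset_sort_items)
  also have "\<dots> \<le> sz p" by (rule sz_fst)
  finally have "(sz (?R p) + 10) * sz ys \<le> (sz (?R p) + 10) * sz p" by (rule mult_left_mono) simp
  then show "sz (foldl fill_step (?R p, []) ys) \<le> 5 + sz (?R p) + (sz (?R p) + 10) * sz p"
    using sz_fill[of "(?R p, [])" "?R p" ys] sz_of_abs_le[of "fst (foldl fill_step (?R p, []) ys)" "?R p"]
      nil
    unfolding sz_prod[of "foldl fill_step (?R p, []) ys"] fst_conv snd_conv by linarith
qed

lemmas ptime_greedy [ptime_intros] = ptime_comp2[OF ptime_greedy0]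

section \<open>The algorithm\<close>

text \<open>
  An instance as typed data whose encoding is that of the instance: hard, cost and label DFA, the
  length bounds in unary, the cost bound, \<open>\<lambda>\<close>, \<open>\<rho>\<close>, and the labels with their bounds. A state of the
  product automaton is a triple of states.
\<close>

type_synonym fraction = "int \<times> int"
type_synonym label_spec = "int \<times> fraction \<times> fraction"
type_synonym data =
  "(int \<times> int list list \<times> bool list) \<times> (int \<times> int list list \<times> int list) \<times>
   (int \<times> int list list \<times> int list) \<times> int list \<times> int list \<times>
   fraction \<times> fraction \<times> fraction \<times> label_spec list \<times> unit"
type_synonym state = "int \<times> int \<times> int"
type_synonym row = "(state \<times> int) list"
type_synonym cell = "state \<times> int \<times> row list"

abbreviation (input) hard_part :: "data \<Rightarrow> int \<times> int list list \<times> bool list" where "hard_part r \<equiv> fst r"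
abbreviation (input) cost_part :: "data \<Rightarrow> int \<times> int list list \<times> int list" where "cost_part r \<equiv> fst (snd r)"
abbreviation (input) label_part :: "data \<Rightarrow> int \<times> int list list \<times> int list" where "label_part r \<equiv> fst (snd (snd r))"
abbreviation (input) lo_part :: "data \<Rightarrow> int list" where "lo_part r \<equiv> fst (snd (snd (snd r)))"
abbreviation (input) hi_part :: "data \<Rightarrow> int list" where "hi_part r \<equiv> fst (snd (snd (snd (snd r))))"
abbreviation (input) bound_part :: "data \<Rightarrow> fraction" where "bound_part r \<equiv> fst (snd (snd (snd (snd (snd r)))))"
abbreviation (input) lam_part :: "data \<Rightarrow> fraction" where "lam_part r \<equiv> fst (snd (snd (snd (snd (snd (snd r))))))"
abbreviation (input) rho_part :: "data \<Rightarrow> fraction" where "rho_part r \<equiv> fst (snd (snd (snd (snd (snd (snd (snd r)))))))"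
abbreviation (input) specs_part :: "data \<Rightarrow> label_spec list" where "specs_part r \<equiv> fst (snd (snd (snd (snd (snd (snd (snd (snd r))))))))"

definition letters :: "nat \<Rightarrow> int list" where
  "letters k = map int [0..<k]"

definition pstep :: "data \<Rightarrow> state \<Rightarrow> int \<Rightarrow> state" where
  "pstep r q a =
     (nthd 0 (nthd [] (fst (snd (hard_part r))) (fst q)) a,
      (nthd 0 (nthd [] (fst (snd (cost_part r))) (fst (snd q))) a,
       nthd 0 (nthd [] (fst (snd (label_part r))) (snd (snd q))) a))"

definition pstart :: "data \<Rightarrow> state" where
  "pstart r = (fst (hard_part r), (fst (cost_part r), fst (label_part r)))"

definition pstates :: "data \<Rightarrow> state list" where
  "pstates r = concat (map (\<lambda>h. concat (map (\<lambda>c. map (\<lambda>l. (h, (c, l)))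
     (idx (snd (snd (label_part r))))) (idx (snd (snd (cost_part r))))))
     (idx (snd (snd (hard_part r)))))"

definition accepts :: "data \<Rightarrow> state \<Rightarrow> bool" where
  "accepts r q = nthd False (snd (snd (hard_part r))) (fst q)"

definition state_cost :: "data \<Rightarrow> state \<Rightarrow> int" where
  "state_cost r q = nthd 0 (snd (snd (cost_part r))) (fst (snd q))"

definition state_label :: "data \<Rightarrow> state \<Rightarrow> int" where
  "state_label r q = nthd 0 (snd (snd (label_part r))) (snd (snd q))"

text \<open>Row \<open>j\<close> lists for every state the number of words of length \<open>j\<close> that lead to it.\<close>

definition row0 :: "data \<Rightarrow> row" where
  "row0 r = map (\<lambda>q. (q, if q = pstart r then 1 else 0)) (pstates r)"

definition next_row :: "nat \<Rightarrow> data \<Rightarrow> row \<Rightarrow> row" where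
  "next_row k r rw = map (\<lambda>y. (fst y, \<Sum>z\<leftarrow>rw. \<Sum>a\<leftarrow>letters k.
     if pstep r (fst z) a = fst y then snd z else 0)) rw"

text \<open>A level is a row together with the rows of all smaller lengths, latest first, which is
  the order in which decoding visits them. The number of these earlier rows is the word length of
  the level.\<close>

definition level_step ::
    "nat \<Rightarrow> data \<Rightarrow> (row \<times> row list) \<times> (row \<times> row list) list \<Rightarrow>
     (row \<times> row list) \<times> (row \<times> row list) list" where
  "level_step k r s =
     (let y = (next_row k r (fst (fst s)), fst (fst s) # snd (fst s)) in (y, y # snd s))"

text \<open>The length bound in unary is itself the list iterated over: here the unary encoding
  keeps the table polynomial.\<close>

definition levels :: "nat \<Rightarrow> data \<Rightarrow> (row \<times> row list) list" where
  "levels k r = snd (foldl (\<lambda>s _. level_step k r s) ((row0 r, []), [(row0 r, [])]) (hi_part r))"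

text \<open>A cell is (state, (number of words, earlier rows)). Carrying the rows provides the
  counts for decoding, and their number gives the word length.\<close>

definition cells :: "nat \<Rightarrow> data \<Rightarrow> cell list" where
  "cells k r = concat (map
     (\<lambda>y. map (\<lambda>z. (fst z, (snd z, snd y))) (filter (\<lambda>z. accepts r (fst z)) (fst y)))
     (filter (\<lambda>y. int (length (lo_part r)) \<le> int (length (snd y))) (levels k r)))"

text \<open>The denominator of the cost bound is left out: this bound never becomes a mass and is
  compared by cross-multiplication in \<open>check\<close>.\<close>

definition denom :: "data \<Rightarrow> int" where
  "denom r = snd (lam_part r) * snd (rho_part r) *
     (\<Prod>s\<leftarrow>specs_part r. snd (fst (snd s)) * snd (snd (snd s)))"

definition scaled :: "data \<Rightarrow> fraction \<Rightarrow> int" where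
  "scaled r x = fst x * (denom r div snd x)"

text \<open>The masses are conditional on the label, in units of 1/\<open>denom r\<close>. As a cell
  is to be weighted uniformly, the bounds on a single word are multiplied by the number of words in
  the cell.\<close>

definition label_items :: "nat \<Rightarrow> data \<Rightarrow> label_spec \<Rightarrow> cell item list" where
  "label_items k r s = map
     (\<lambda>y. (y, (state_cost r (fst y), (scaled r (fst (snd s)) * fst (snd y), scaled r (snd (snd s)) * fst (snd y)))))
     (filter (\<lambda>y. state_label r (fst y) = fst s) (cells k r))"

definition label_alloc :: "nat \<Rightarrow> data \<Rightarrow> label_spec \<Rightarrow> (cell \<times> int \<times> int) list" where
  "label_alloc k r s = greedy (label_items k r s) (denom r)"

definition alloc_cost :: "('t \<times> int \<times> int) list \<Rightarrow> int" where
  "alloc_cost xs = (\<Sum>y\<leftarrow>xs. fst (snd y) * snd (snd y))"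

definition in_range :: "'t item list \<Rightarrow> int \<Rightarrow> bool" where
  "in_range xs N \<longleftrightarrow> (\<Sum>y\<leftarrow>xs. ilo y) \<le> N \<and> N \<le> (\<Sum>y\<leftarrow>xs. ihi y)"

text \<open>
  A label whose class admits no conditional distribution within the bounds gets probability \<open>0\<close>.
\<close>

definition top_items :: "nat \<Rightarrow> data \<Rightarrow> (int \<times> (cell \<times> int \<times> int) list) item list" where
  "top_items k r = map
     (\<lambda>s. ((fst s, label_alloc k r s), (alloc_cost (label_alloc k r s), (scaled r (lam_part r),
        if in_range (label_items k r s) (denom r) then scaled r (rho_part r) else 0))))
     (specs_part r)"

definition top_alloc :: "nat \<Rightarrow> data \<Rightarrow> ((int \<times> (cell \<times> int \<times> int) list) \<times> int \<times> int) list" where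
  "top_alloc k r = greedy (top_items k r) (denom r)"

text \<open>On valid instances the first conjunct fails exactly if \<lambda> is positive and some
  label has no admissible conditional distribution. The cost carries two factors
  \<open>denom r\<close>, one from the allocation among the labels and one from the allocation
  within a label.\<close>

definition check :: "nat \<Rightarrow> data \<Rightarrow> bool" where
  "check k r \<longleftrightarrow> list_all (\<lambda>y. ilo y \<le> ihi y) (top_items k r) \<and>
     in_range (top_items k r) (denom r) \<and>
     alloc_cost (top_alloc k r) * snd (bound_part r) \<le> fst (bound_part r) * (denom r * denom r)"

text \<open>This factor makes the number of draws that fall into a cell divisible by the size of the cell.\<close>

definition count_prod :: "nat \<Rightarrow> data \<Rightarrow> int" where
  "count_prod k r = (\<Prod>y\<leftarrow>cells k r. max 1 (fst (snd y)))"

definition total_mass :: "nat \<Rightarrow> data \<Rightarrow> int" where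
  "total_mass k r = denom r * denom r * count_prod k r"

text \<open>The number of draws that fall into a cell is the mass of its label times its own mass
  within the label, times \<open>count_prod\<close>.\<close>

definition blocks :: "nat \<Rightarrow> data \<Rightarrow> (cell \<times> int) list" where
  "blocks k r = concat (map
     (\<lambda>y. map (\<lambda>z. (fst z, snd (snd y) * snd (snd z) * count_prod k r)) (snd (fst y)))
     (top_alloc k r))"

text \<open>A word leading to \<open>q\<close> is determined by its last letter, the state before
  that letter and a word leading to that state; the weight counts the choices of the latter.\<close>

definition predecessors :: "nat \<Rightarrow> data \<Rightarrow> row \<Rightarrow> state \<Rightarrow> ((state \<times> int) \<times> int) list" where
  "predecessors k r rw q = concat (map
     (\<lambda>z. map (\<lambda>a. ((fst z, a), snd z)) (filter (\<lambda>a. pstep r (fst z) a = q) (letters k))) rw)"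

text \<open>Letters are found from the last to the first, and consing restores their order. The
  offset returned by \<open>pick\<close> is the rank among the words leading to the preceding
  state.\<close>

definition unrank_step ::
    "nat \<Rightarrow> data \<Rightarrow> state \<times> int \<times> int list \<Rightarrow> row \<Rightarrow> state \<times> int \<times> int list" where
  "unrank_step k r s rw =
     (let z = pick ((0, (0, 0)), 0) (predecessors k r rw (fst s)) (fst (snd s))
      in (fst (fst z), (snd z, snd (fst z) # snd (snd s))))"

definition unrank :: "nat \<Rightarrow> data \<Rightarrow> state \<times> int \<times> row list \<Rightarrow> int list" where
  "unrank k r y = snd (snd (foldl (unrank_step k r) (fst y, (fst (snd y), [])) (snd (snd y))))"

text \<open>The offset in a block is reduced modulo the size of the cell; for a block whose length
  is a multiple of this size, all words of the cell become equally likely.\<close>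

definition draw :: "nat \<Rightarrow> data \<times> int \<Rightarrow> int list" where
  "draw k x = (let z = pick ((0, (0, 0)), (0, [])) (blocks k (fst x)) (snd x)
     in unrank k (fst x) (fst (fst z), (snd z mod fst (snd (fst z)), snd (snd (fst z)))))"

section \<open>Polynomial running time of the algorithm\<close>

lemma ptime_pstep: "ptime (\<lambda>p. pstep (fst p) (fst (snd p)) (snd (snd p)))"
  unfolding pstep_def by (intro ptime_intros)
lemmas [ptime_intros] = ptime_comp3[OF ptime_pstep]

lemma ptime_pstates: "ptime pstates"
  unfolding pstates_def by (intro ptime_intros)
lemmas [ptime_intros] = ptime_comp[OF _ ptime_pstates]

lemma ptime_pstart: "ptime pstart"
  unfolding pstart_def by (intro ptime_intros)
lemmas [ptime_intros] = ptime_comp[OF _ ptime_pstart]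

lemma ptime_accepts: "ptime (\<lambda>p. accepts (fst p) (snd p))"
  unfolding accepts_def by (intro ptime_intros)
lemmas [ptime_intros] = ptime_comp2[OF ptime_accepts]

lemma ptime_state_cost: "ptime (\<lambda>p. state_cost (fst p) (snd p))"
  unfolding state_cost_def by (intro ptime_intros)
lemmas [ptime_intros] = ptime_comp2[OF ptime_state_cost]

lemma ptime_state_label: "ptime (\<lambda>p. state_label (fst p) (snd p))"
  unfolding state_label_def by (intro ptime_intros)
lemmas [ptime_intros] = ptime_comp2[OF ptime_state_label]

lemma ptime_row0: "ptime row0"
  unfolding row0_def by (intro ptime_intros)
lemmas [ptime_intros] = ptime_comp[OF _ ptime_row0]

lemma ptime_next_row: "ptime (\<lambda>p. next_row k (fst p) (snd p))"
  unfolding next_row_def by (intro ptime_intros)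
lemmas [ptime_intros] = ptime_comp2[OF ptime_next_row]

lemma ptime_level_step: "ptime (\<lambda>p. level_step k (fst p) (snd p))"
  unfolding level_step_def by (intro ptime_intros)
lemmas [ptime_intros] = ptime_comp2[OF ptime_level_step]

definition row_at :: "nat \<Rightarrow> data \<Rightarrow> nat \<Rightarrow> row" where
  "row_at k r j = (next_row k r ^^ j) (row0 r)"

definition level :: "nat \<Rightarrow> data \<Rightarrow> nat \<Rightarrow> row \<times> row list" where
  "level k r j = (row_at k r j, map (row_at k r) (rev [0..<j]))"

lemma levels_fold:
  "foldl (\<lambda>s _. level_step k r s) ((row0 r, []), [(row0 r, [])]) xs
   = (level k r (length xs), map (level k r) (rev [0..<Suc (length xs)]))"
  by (induction xs rule: rev_induct) (auto simp: level_def row_at_def level_step_def Let_def)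

lemma levels_eq: "levels k r = map (level k r) (rev [0..<Suc (length (hi_part r))])"
  unfolding levels_def levels_fold by simp

lemma map_fst_row_at: "map fst (row_at k r j) = pstates r"
  by (induction j) (auto simp: row_at_def row0_def next_row_def o_def)

lemma length_row_at: "length (row_at k r j) = length (pstates r)"
  using map_fst_row_at[of k r j] by (metis length_map)

lemma abs_sum_list_le:
  "(\<And>x. x \<in> set xs \<Longrightarrow> \<bar>f x\<bar> \<le> (c::int)) \<Longrightarrow> \<bar>sum_list (map f xs)\<bar> \<le> int (length xs) * c"
proof (induction xs)
  case (Cons x xs)
  then have "\<bar>f x\<bar> \<le> c" "\<bar>sum_list (map f xs)\<bar> \<le> int (length xs) * c" by auto
  then show ?case by (simp add: algebra_simps)
qed simp

text \<open>An entry of the next row adds up at most one entry of the previous row for each pair of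
  a state and a letter. Ill-formed data are included, so pairs are counted instead of words; the
  value is exponential in \<open>j\<close>, but its number of bits is polynomial.\<close>

lemma row_at_bound:
  "x \<in> set (row_at k r j) \<Longrightarrow> \<bar>snd x\<bar> \<le> int (length (pstates r) * k) ^ j"
proof (induction j arbitrary: x)
  case 0
  then show ?case by (auto simp: row_at_def row0_def)
next
  case (Suc j)
  let ?V = "int (length (pstates r) * k)"
  have R: "row_at k r (Suc j) = next_row k r (row_at k r j)" by (simp add: row_at_def)
  obtain q where "snd x = (\<Sum>z\<leftarrow>row_at k r j. \<Sum>a\<leftarrow>letters k. if pstep r (fst z) a = q then snd z else 0)"
    using Suc.prems by (auto simp: R next_row_def)
  also have "\<bar>\<dots>\<bar> \<le> int (length (row_at k r j)) * (int (length (letters k)) * ?V ^ j)"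
  proof (intro abs_sum_list_le)
    fix z a assume "z \<in> set (row_at k r j)"
    then show "\<bar>if pstep r (fst z) a = q then snd z else 0\<bar> \<le> ?V ^ j"
      using Suc.IH[of z] by auto
  qed
  also have "\<dots> = ?V ^ Suc j" by (simp add: length_row_at letters_def)
  finally show ?case .
qed

lemma sz_row_at:
  "sz (row_at k r j) \<le> 1 + length (pstates r) * (sz (pstates r) + length (pstates r) * k * j + 5)"
proof -
  let ?V = "length (pstates r) * k"
  have "(\<Sum>x\<leftarrow>row_at k r j. sz x + 1) \<le> length (row_at k r j) * (sz (pstates r) + ?V * j + 5)"
  proof (rule sum_list_le_length)
    fix x assume x: "x \<in> set (row_at k r j)"
    then have "fst x \<in> set (pstates r)" using map_fst_row_at[of k r j] by (metis image_eqI set_map)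
    then have 1: "sz (fst x) < sz (pstates r)" by (rule sz_member)
    have "\<bar>snd x\<bar> \<le> int ?V ^ j" using row_at_bound[OF x] .
    also have "\<dots> \<le> (2 ^ ?V) ^ j"
      using of_nat_less_two_power[of ?V, where 'a = int] by (intro power_mono) auto
    also have "\<dots> < 2 ^ (?V * j + 1)" by (simp add: power_mult)
    finally have "sz (snd x) \<le> ?V * j + 2" using sz_le_of_abs_less by fastforce
    then show "sz x + 1 \<le> sz (pstates r) + ?V * j + 5" using 1 unfolding sz_prod[of x] by linarith
  qed
  then show ?thesis unfolding sz_list[of "row_at k r j"] length_row_at by linarith
qed

lemma ptime_levels: "ptime (levels k)"
  unfolding levels_def
proof (intro ptime_snd ptime_foldl'[where F = "\<lambda>r s _. level_step k r s"] ptime_intros)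
  \<comment> \<open>\<open>E\<close> bounds the size of a row and \<open>G\<close> that of a level.
    The row number \<open>j\<close> is replaced by \<open>sz r\<close>, which exceeds the length of
    the unary bound contained in \<open>r\<close>.\<close>
  define E where "E r = 1 + length (pstates r) * (sz (pstates r) + length (pstates r) * k * sz r + 5)" for r
  define G where "G r = 5 + E r + (sz r + 1) * (E r + 1)" for r
  have "pb (\<lambda>r. length (pstates r))"
    by (intro pb_mono[OF ptime_pb[OF ptime_pstates]] less_imp_le length_less_sz)
  then have E: "pb E" unfolding E_def
    by (intro pb_add pb_mult pb_const pb_sz ptime_pb ptime_pstates)
  have G: "pb G" unfolding G_def by (intro pb_add pb_mult pb_const pb_sz E)
  show "pb (\<lambda>r. 5 + G r + (sz r + 1) * (G r + 1))" by (intro pb_add pb_mult pb_const pb_sz G)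
  fix r ys zs assume *: "hi_part r = ys @ zs"
  have "sz (hi_part r) \<le> sz r" by (intro order_trans[OF sz_fst] order_trans[OF sz_snd]) simp
  then have len: "length ys < sz r" using length_less_sz[of "ys @ zs"] unfolding * by simp
  have rw: "sz (row_at k r j) \<le> E r" if "j \<le> length ys" for j
  proof -
    have "length (pstates r) * (sz (pstates r) + length (pstates r) * k * j + 5)
       \<le> length (pstates r) * (sz (pstates r) + length (pstates r) * k * sz r + 5)"
      using that len by (intro mult_left_mono add_mono) auto
    then show ?thesis using sz_row_at[of k r j] unfolding E_def by linarith
  qed
  have level: "sz (level k r j) \<le> G r" if j: "j \<le> length ys" for j
  proof -
    have "(\<Sum>i\<leftarrow>rev [0..<j]. sz (row_at k r i) + 1) \<le> length (rev [0..<j]) * (E r + 1)"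
      using rw j by (intro sum_list_le_length) auto
    also have "\<dots> \<le> (sz r + 1) * (E r + 1)" using j len by (intro mult_right_mono) auto
    finally have "sz (map (row_at k r) (rev [0..<j])) \<le> 1 + (sz r + 1) * (E r + 1)"
      unfolding sz_list[of "map (row_at k r) (rev [0..<j])"] map_map o_def by linarith
    then show ?thesis using rw[OF j] unfolding level_def sz_prod[of "(a, b)" for a :: row and b :: "row list"] G_def
      fst_conv snd_conv by linarith
  qed
  have "(\<Sum>i\<leftarrow>rev [0..<Suc (length ys)]. sz (level k r i) + 1) \<le> length (rev [0..<Suc (length ys)]) * (G r + 1)"
    using level by (intro sum_list_le_length) (auto simp: less_Suc_eq_le)
  also have "\<dots> \<le> (sz r + 1) * (G r + 1)" using len by (intro mult_right_mono) auto
  finally have "sz (map (level k r) (rev [0..<Suc (length ys)])) \<le> 1 + (sz r + 1) * (G r + 1)"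
    unfolding sz_list[of "map (level k r) (rev [0..<Suc (length ys)])"] map_map o_def by linarith
  then show "sz (foldl (\<lambda>s _. level_step k r s) ((row0 r, []), [(row0 r, [])]) ys)
      \<le> 5 + G r + (sz r + 1) * (G r + 1)"
    using level[OF order_refl]
    unfolding levels_fold sz_prod[of "(a, b)" for a :: "row \<times> row list" and b :: "(row \<times> row list) list"]
      fst_conv snd_conv by linarith
qed
lemmas [ptime_intros] = ptime_comp[OF _ ptime_levels]

lemma ptime_cells: "ptime (cells k)"
  unfolding cells_def by (intro ptime_intros)
lemmas [ptime_intros] = ptime_comp[OF _ ptime_cells]

lemma ptime_denom: "ptime denom"
  unfolding denom_def by (intro ptime_intros)
lemmas [ptime_intros] = ptime_comp[OF _ ptime_denom]

lemma ptime_scaled: "ptime (\<lambda>p. scaled (fst p) (snd p))"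
  unfolding scaled_def by (intro ptime_intros)
lemmas [ptime_intros] = ptime_comp2[OF ptime_scaled]

lemma ptime_label_items: "ptime (\<lambda>p. label_items k (fst p) (snd p))"
  unfolding label_items_def by (intro ptime_intros)
lemmas [ptime_intros] = ptime_comp2[OF ptime_label_items]

lemma ptime_label_alloc: "ptime (\<lambda>p. label_alloc k (fst p) (snd p))"
  unfolding label_alloc_def by (intro ptime_intros)
lemmas [ptime_intros] = ptime_comp2[OF ptime_label_alloc]

lemma ptime_alloc_cost: "ptime alloc_cost"
  unfolding alloc_cost_def by (intro ptime_intros)
lemmas [ptime_intros] = ptime_comp[OF _ ptime_alloc_cost]

lemma ptime_in_range: "ptime (\<lambda>p. in_range (fst p) (snd p))"
  unfolding in_range_def by (intro ptime_intros)
lemmas [ptime_intros] = ptime_comp2[OF ptime_in_range]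

lemma ptime_top_items: "ptime (top_items k)"
  unfolding top_items_def by (intro ptime_intros)
lemmas [ptime_intros] = ptime_comp[OF _ ptime_top_items]

lemma ptime_top_alloc: "ptime (top_alloc k)"
  unfolding top_alloc_def by (intro ptime_intros)
lemmas [ptime_intros] = ptime_comp[OF _ ptime_top_alloc]

lemma ptime_check: "ptime (check k)"
  unfolding check_def by (intro ptime_intros)

lemma ptime_count_prod: "ptime (count_prod k)"
  unfolding count_prod_def by (intro ptime_intros)
lemmas [ptime_intros] = ptime_comp[OF _ ptime_count_prod]

lemma ptime_total_mass: "ptime (total_mass k)"
  unfolding total_mass_def by (intro ptime_intros)

lemma ptime_blocks: "ptime (blocks k)"
  unfolding blocks_def by (intro ptime_intros)
lemmas [ptime_intros] = ptime_comp[OF _ ptime_blocks]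

lemma ptime_predecessors: "ptime (\<lambda>p. predecessors k (fst p) (fst (snd p)) (snd (snd p)))"
  unfolding predecessors_def by (intro ptime_intros)
lemmas [ptime_intros] = ptime_comp3[OF ptime_predecessors]

lemma ptime_unrank_step: "ptime (\<lambda>p. unrank_step k (fst p) (fst (snd p)) (snd (snd p)))"
  unfolding unrank_step_def by (intro ptime_intros)

text \<open>Selection never increases the offset in absolute value, and it returns a state of the
  current row and a letter, or else the default. The constants 10 leave room for the sizes of the
  default state and the default letter.\<close>

lemma unrank_fold:
  fixes ys :: "row list"
  assumes "\<bar>fst (snd s)\<bar> \<le> \<bar>u\<bar>" "sz (fst s) \<le> D" "10 \<le> D" "\<And>rw. rw \<in> set ys \<Longrightarrow> sz rw \<le> D"
    "sz (letters k) \<le> E" "10 \<le> E"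
  shows "\<bar>fst (snd (foldl (unrank_step k r) s ys))\<bar> \<le> \<bar>u\<bar> \<and>
    sz (fst (foldl (unrank_step k r) s ys)) \<le> D \<and>
    sz (snd (snd (foldl (unrank_step k r) s ys))) \<le> sz (snd (snd s)) + length ys * (E + 1)"
  using assms
proof (induction ys arbitrary: s)
  case (Cons rw ys)
  define z where "z = pick ((0, (0, 0)), 0) (predecessors k r rw (fst s)) (fst (snd s))"
  have step: "unrank_step k r s rw = (fst (fst z), (snd z, snd (fst z) # snd (snd s)))"
    by (simp add: unrank_step_def z_def Let_def)
  have 1: "\<bar>snd z\<bar> \<le> \<bar>u\<bar>"
    using pick_abs_le[of "((0, (0, 0)), 0)" "predecessors k r rw (fst s)" "fst (snd s)"] Cons.prems(1)
    unfolding z_def by linarith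
  have zin: "fst z \<in> insert ((0, (0, 0)), 0) (fst ` set (predecessors k r rw (fst s)))"
    unfolding z_def by (rule pick_fst_in)
  have 2: "sz (fst (fst z)) \<le> D" "sz (snd (fst z)) \<le> E"
  proof -
    have "fst (fst z) = (0, (0, 0)) \<and> snd (fst z) = 0 \<or>
      fst (fst z) \<in> fst ` set rw \<and> snd (fst z) \<in> set (letters k)"
      using zin by (force simp: predecessors_def)
    moreover have "sz ((0, (0, 0)) :: state) \<le> D" "sz (0 :: int) \<le> E"
      using Cons.prems by (auto simp: floorlog_def)
    moreover have "sz q \<le> D" if "q \<in> fst ` set rw" for q
      using sz_fst_member[OF that] Cons.prems(4)[of rw] by simp
    moreover have "sz a \<le> E" if "a \<in> set (letters k)" for a
      using sz_member[OF that] Cons.prems(5) by simp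
    ultimately show "sz (fst (fst z)) \<le> D" "sz (snd (fst z)) \<le> E"
      by (elim disjE conjE; simp only:)+
  qed
  have "\<bar>fst (snd (foldl (unrank_step k r) (unrank_step k r s rw) ys))\<bar> \<le> \<bar>u\<bar> \<and>
    sz (fst (foldl (unrank_step k r) (unrank_step k r s rw) ys)) \<le> D \<and>
    sz (snd (snd (foldl (unrank_step k r) (unrank_step k r s rw) ys)))
      \<le> sz (snd (snd (unrank_step k r s rw))) + length ys * (E + 1)"
    using Cons.prems 1 2 by (intro Cons.IH) (auto simp: step simp del: encode_simps)
  moreover have "sz (snd (snd (unrank_step k r s rw))) \<le> sz (snd (snd s)) + E + 1"
    unfolding step snd_conv sz_Cons using 2 by linarith
  ultimately show ?case by (simp del: encode_simps)
qed (auto simp del: encode_simps)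

lemma ptime_unrank0: "ptime (\<lambda>p. unrank k (fst p) (snd p))"
  unfolding unrank_def
proof (intro ptime_snd ptime_foldl'[where F = "\<lambda>p. unrank_step k (fst p)"]
    ptime_comp3[OF ptime_unrank_step] ptime_intros)
  let ?E = "sz (letters k) + 10"
  show "pb (\<lambda>p :: data \<times> state \<times> int \<times> row list. 30 + 3 * sz p + sz p * (?E + 1))"
    by (intro pb_add pb_mult pb_const pb_sz)
  fix p :: "data \<times> state \<times> int \<times> row list" and ys zs
  assume *: "snd (snd (snd p)) = ys @ zs"
  have p: "sz p = 1 + sz (fst p) + (1 + sz (fst (snd p)) + (1 + sz (fst (snd (snd p))) + sz (ys @ zs)))"
    unfolding sz_prod[of p] sz_prod[of "snd p"] sz_prod[of "snd (snd p)"] * ..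
  let ?s = "foldl (unrank_step k (fst p)) (fst (snd p), fst (snd (snd p)), []) ys"
  have "\<bar>fst (snd ?s)\<bar> \<le> \<bar>fst (snd (snd p))\<bar> \<and> sz (fst ?s) \<le> sz p + 10 \<and>
      sz (snd (snd ?s)) \<le> sz (snd (snd (fst (snd p), fst (snd (snd p)), [] :: int list))) + length ys * (?E + 1)"
  proof (rule unrank_fold)
    fix rw assume "rw \<in> set ys"
    then show "sz rw \<le> sz p + 10" using sz_member[of rw "ys @ zs"] p by (simp del: encode_simps)
  qed (use p in \<open>simp_all del: encode_simps\<close>)
  moreover have "sz ([] :: int list) = 1" by (simp add: floorlog_def)
  moreover have "length ys * (?E + 1) \<le> sz p * (?E + 1)"
    using p length_less_sz[of "ys @ zs"] by (intro mult_right_mono) (auto simp del: encode_simps)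
  moreover have "sz (fst (snd ?s)) \<le> Suc (sz (fst (snd (snd p))))"
    using calculation by (intro sz_of_abs_le) blast
  ultimately show "sz ?s \<le> 30 + 3 * sz p + sz p * (?E + 1)"
    unfolding sz_prod[of ?s] sz_prod[of "snd ?s"] snd_conv using p by linarith
qed
lemmas [ptime_intros] = ptime_comp2[OF ptime_unrank0]

lemma ptime_draw: "ptime (draw k)"
  unfolding draw_def by (intro ptime_intros)

section \<open>Correctness of the greedy allocation\<close>

lemma sorted_insert_item:
  "sorted (map icost xs) \<Longrightarrow> sorted (map icost (insert_item xs x))"
  unfolding insert_item_def sorted_map
  by (fastforce simp: sorted_wrt_append sorted_wrt_filter)

lemma sorted_sort_items: "sorted (map icost (sort_items xs))"
proof -
  have "sorted (map icost ys) \<Longrightarrow> sorted (map icost (foldl insert_item ys xs))" for ys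
    by (induction xs arbitrary: ys) (auto simp: sorted_insert_item)
  then show ?thesis by (simp add: sort_items_def)
qed

text \<open>
  The cost \<open>c\<close> of the item at which the greedy allocation runs out certifies optimality: cheaper
  items are allocated maximally, more expensive ones minimally.
\<close>

lemma fill_spec:
  assumes "distinct ys" "sorted (map icost ys)" "\<And>y. y \<in> set ys \<Longrightarrow> ilo y \<le> ihi y"
    "0 \<le> R" "R \<le> (\<Sum>y\<leftarrow>ys. ihi y - ilo y)"
  shows "\<exists>v c. foldl fill_step (R, out) ys = (0, rev (map (\<lambda>y. (fst y, (icost y, v y))) ys) @ out) \<and>
    (\<forall>y\<in>set ys. ilo y \<le> v y \<and> v y \<le> ihi y \<and> (icost y < c \<longrightarrow> v y = ihi y) \<and> (c < icost y \<longrightarrow> v y = ilo y)) \<and>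
    (\<Sum>y\<leftarrow>ys. v y - ilo y) = R"
  using assms
proof (induction ys arbitrary: R out)
  case (Cons y ys)
  define d where "d = min (ihi y - ilo y) R"
  have d: "max 0 (min (ihi y - ilo y) R) = d" "0 \<le> d" using Cons.prems by (auto simp: d_def)
  have nonneg: "(\<Sum>y\<leftarrow>ys. ihi y - ilo y) \<ge> 0"
    using Cons.prems(3)[OF list.set_intros(2)] by (intro sum_list_nonneg) auto
  have R': "0 \<le> R - d" "R - d \<le> (\<Sum>y\<leftarrow>ys. ihi y - ilo y)"
    using Cons.prems nonneg by (auto simp: d_def)
  obtain v c where v: "foldl fill_step (R - d, (fst y, (icost y, ilo y + d)) # out) ys
      = (0, rev (map (\<lambda>y. (fst y, (icost y, v y))) ys) @ (fst y, (icost y, ilo y + d)) # out)"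
    "\<And>y. y \<in> set ys \<Longrightarrow> ilo y \<le> v y \<and> v y \<le> ihi y \<and> (icost y < c \<longrightarrow> v y = ihi y) \<and> (c < icost y \<longrightarrow> v y = ilo y)"
    "(\<Sum>y\<leftarrow>ys. v y - ilo y) = R - d"
  proof -
    have "distinct ys" "sorted (map icost ys)" using Cons.prems by auto
    from Cons.IH[OF this Cons.prems(3)[OF list.set_intros(2)] R', of "(fst y, (icost y, ilo y + d)) # out"]
    show ?thesis using that by blast
  qed
  define v' where "v' = v(y := ilo y + d)"
  have v'[simp]: "v' y = ilo y + d" "\<And>z. z \<in> set ys \<Longrightarrow> v' z = v z"
    using Cons.prems(1) by (auto simp: v'_def)
  have m: "map (\<lambda>y. (fst y, (icost y, v' y))) ys = map (\<lambda>y. (fst y, (icost y, v y))) ys"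
    "map (\<lambda>y. v' y - ilo y) ys = map (\<lambda>y. v y - ilo y) ys" by auto
  have fold: "foldl fill_step (R, out) (y # ys)
      = (0, rev (map (\<lambda>y. (fst y, (icost y, v' y))) (y # ys)) @ out)"
    using v(1) by (simp add: fill_step_def d Let_def m)
  have sum: "(\<Sum>y\<leftarrow>y # ys. v' y - ilo y) = R" using v(3) unfolding list.map sum_list.Cons m(2) by simp
  have range: "\<forall>z\<in>set (y # ys). ilo z \<le> v' z \<and> v' z \<le> ihi z"
    using v(2) Cons.prems d(2) by (auto simp: d_def)
  have ge: "\<And>z. z \<in> set ys \<Longrightarrow> icost y \<le> icost z" using Cons.prems(2) by auto
  have "\<exists>c. \<forall>z\<in>set (y # ys). (icost z < c \<longrightarrow> v' z = ihi z) \<and> (c < icost z \<longrightarrow> v' z = ilo z)"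
  proof (cases "d = ihi y - ilo y")
    case True
    \<comment> \<open>The threshold for the tail may lie below the cost of \<open>y\<close>, where
      it would demand the lower bound of the full item \<open>y\<close>. Raising it to the cost of
      \<open>y\<close> repairs this and changes nothing in the tail, which contains no cheaper
      item.\<close>
    show ?thesis
    proof (intro exI[of _ "max c (icost y)"] ballI)
      fix z assume "z \<in> set (y # ys)"
      then show "(icost z < max c (icost y) \<longrightarrow> v' z = ihi z) \<and> (max c (icost y) < icost z \<longrightarrow> v' z = ilo z)"
        using v(2)[of z] ge[of z] True by (auto simp: less_max_iff_disj)
    qed
  next
    case False
    \<comment> \<open>As \<open>y\<close> is not full, the surplus is used up: \<open>y\<close> is
      the marginal item and all later ones stay at their lower bounds.\<close>
    then have "R - d = 0" by (auto simp: d_def)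
    moreover have "\<And>x. x \<in> set (map (\<lambda>y. v y - ilo y) ys) \<Longrightarrow> 0 \<le> x"
      using v(2) by force
    ultimately have 0: "\<forall>x\<in>set (map (\<lambda>y. v y - ilo y) ys). x = 0"
      using v(3) sum_list_nonneg_eq_0_iff[of "map (\<lambda>y. v y - ilo y) ys"] by simp
    show ?thesis
    proof (intro exI[of _ "icost y"] ballI)
      fix z assume "z \<in> set (y # ys)"
      then show "(icost z < icost y \<longrightarrow> v' z = ihi z) \<and> (icost y < icost z \<longrightarrow> v' z = ilo z)"
        using ge[of z] 0 by auto
    qed
  qed
  then obtain c' where "\<forall>z\<in>set (y # ys). (icost z < c' \<longrightarrow> v' z = ihi z) \<and> (c' < icost z \<longrightarrow> v' z = ilo z)"
    by blast
  then show ?case using fold sum range by (intro exI[of _ v'] exI[of _ c']) blast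
qed simp

text \<open>The allocation is integral but has to beat all real ones, since the competitors come
  from arbitrary improvising distributions.\<close>

definition optimal_alloc :: "'t item list \<Rightarrow> int \<Rightarrow> ('t item \<Rightarrow> int) \<Rightarrow> bool" where
  "optimal_alloc xs N v \<longleftrightarrow>
    (\<forall>y\<in>set xs. ilo y \<le> v y \<and> v y \<le> ihi y) \<and> (\<Sum>y\<in>set xs. v y) = N \<and>
    (\<forall>z :: 't item \<Rightarrow> real. (\<forall>y\<in>set xs. ilo y \<le> z y \<and> z y \<le> ihi y) \<longrightarrow> (\<Sum>y\<in>set xs. z y) = N \<longrightarrow>
       of_int (\<Sum>y\<in>set xs. icost y * v y) \<le> (\<Sum>y\<in>set xs. icost y * z y))"

lemma greedy_spec:
  assumes "distinct xs" "\<And>y. y \<in> set xs \<Longrightarrow> ilo y \<le> ihi y" "in_range xs N"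
  shows "\<exists>v. mset (greedy xs N) = mset (map (\<lambda>y. (fst y, (icost y, v y))) xs) \<and> optimal_alloc xs N v"
proof -
  let ?ys = "sort_items xs"
  have ms: "mset ?ys = mset xs" by (rule mset_sort_items)
  have st: "set ?ys = set xs" using ms by (rule mset_eq_setD)
  have dis: "distinct ?ys" using ms assms(1) mset_eq_imp_distinct_iff by blast
  have sums: "(\<Sum>y\<leftarrow>xs. f y) = (\<Sum>y\<in>set xs. f y)" "(\<Sum>y\<leftarrow>?ys. f y) = (\<Sum>y\<in>set xs. f y)" for f :: "_ \<Rightarrow> int"
    using sum_list_distinct_conv_sum_set[OF assms(1)] sum_list_distinct_conv_sum_set[OF dis] st by auto
  let ?R = "N - (\<Sum>y\<leftarrow>xs. ilo y)"
  have "\<exists>v c. foldl fill_step (?R, []) ?ys = (0, rev (map (\<lambda>y. (fst y, (icost y, v y))) ?ys) @ []) \<and>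
    (\<forall>y\<in>set ?ys. ilo y \<le> v y \<and> v y \<le> ihi y \<and> (icost y < c \<longrightarrow> v y = ihi y) \<and> (c < icost y \<longrightarrow> v y = ilo y)) \<and>
    (\<Sum>y\<leftarrow>?ys. v y - ilo y) = ?R"
    using assms(2,3)
    by (intro fill_spec dis sorted_sort_items) (auto simp: in_range_def st sums sum_subtractf)
  then obtain v c where v: "foldl fill_step (?R, []) ?ys = (0, rev (map (\<lambda>y. (fst y, (icost y, v y))) ?ys))"
    "\<And>y. y \<in> set xs \<Longrightarrow> ilo y \<le> v y \<and> v y \<le> ihi y"
    "\<And>y. y \<in> set xs \<Longrightarrow> (icost y < c \<longrightarrow> v y = ihi y) \<and> (c < icost y \<longrightarrow> v y = ilo y)"
    "(\<Sum>y\<leftarrow>?ys. v y - ilo y) = ?R" unfolding st by auto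
  show ?thesis
    unfolding optimal_alloc_def
  proof (intro exI[of _ v] conjI ballI allI impI)
    show "mset (greedy xs N) = mset (map (\<lambda>y. (fst y, (icost y, v y))) xs)"
      by (simp add: greedy_def v(1) ms)
    show N: "(\<Sum>y\<in>set xs. v y) = N" using v(4) by (simp add: sums sum_subtractf)
    fix z :: "_ \<Rightarrow> real"
    assume z: "\<forall>y\<in>set xs. ilo y \<le> z y \<and> z y \<le> ihi y" "(\<Sum>y\<in>set xs. z y) = N"
    \<comment> \<open>Complementary slackness, with \<open>c\<close> as the price of a unit of mass:
      each summand is a product of two factors of equal sign, as an item cheaper than
      \<open>c\<close> is full and a dearer one is at its minimum. Both allocations have total mass
      \<open>N\<close>, so the terms with \<open>c\<close> cancel.\<close>
    have "0 \<le> (\<Sum>y\<in>set xs. (icost y - c) * (z y - v y))"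
    proof (rule sum_nonneg)
      fix y assume y: "y \<in> set xs"
      consider "icost y < c" | "icost y = c" | "c < icost y" by linarith
      then show "0 \<le> (icost y - c) * (z y - v y)"
        using z(1)[rule_format, OF y] v(3)[OF y] by cases (auto intro: mult_nonpos_nonpos)
    qed
    also have "\<dots> = (\<Sum>y\<in>set xs. icost y * z y) - of_int (\<Sum>y\<in>set xs. icost y * v y)
        - c * ((\<Sum>y\<in>set xs. z y) - of_int (\<Sum>y\<in>set xs. v y))"
      by (simp add: algebra_simps sum_subtractf sum.distrib sum_distrib_left)
    also have "(\<Sum>y\<in>set xs. z y) - of_int (\<Sum>y\<in>set xs. v y) = 0" using z(2) N by simp
    finally show "of_int (\<Sum>y\<in>set xs. icost y * v y) \<le> (\<Sum>y\<in>set xs. icost y * z y)" by simp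
  qed (use v in auto)
qed


section \<open>Correctness of weighted selection\<close>

lemma pick_Cons:
  assumes "0 \<le> m" shows "pick d ((x, m) # xs) u = (if u < m then (x, u) else pick d xs (u - m))"
proof -
  have "foldl pick_step (True, z) xs = (True, z)" for z :: "'a \<times> int" and xs
    by (induction xs) (auto simp: pick_step_def)
  then show ?thesis using assms by (auto simp: pick_def pick_step_def)
qed

lemma pick_mem:
  assumes "\<And>y. y \<in> set xs \<Longrightarrow> 0 \<le> snd y" "0 \<le> u" "u < (\<Sum>y\<leftarrow>xs. snd y)"
  obtains m where "(fst (pick d xs u), m) \<in> set xs" "0 \<le> snd (pick d xs u)" "snd (pick d xs u) < m"
proof -
  have "\<exists>m. (fst (pick d xs u), m) \<in> set xs \<and> 0 \<le> snd (pick d xs u) \<and> snd (pick d xs u) < m"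
    using assms
  proof (induction xs arbitrary: u)
    case (Cons y xs)
    obtain x m where y: "y = (x, m)" by (cases y)
    have m: "0 \<le> m" using Cons.prems(1)[of y] by (simp add: y)
    show ?case
    proof (cases "u < m")
      case True
      then show ?thesis using Cons.prems(2) by (auto simp: y pick_Cons[OF m])
    next
      case False
      have "\<exists>m'. (fst (pick d xs (u - m)), m') \<in> set xs \<and> 0 \<le> snd (pick d xs (u - m)) \<and> snd (pick d xs (u - m)) < m'"
        using Cons.prems False by (intro Cons.IH) (auto simp: y)
      then show ?thesis using False by (auto simp: y pick_Cons[OF m])
    qed
  qed simp
  then show ?thesis using that by blast
qed

lemma sum_int_shift: "(\<Sum>u\<in>{m..<m + n :: int}. f u) = (\<Sum>u\<in>{0..<n}. f (u + m))"
  by (rule sum.reindex_bij_witness[of _ "\<lambda>u. u + m" "\<lambda>u. u - m"]) auto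

text \<open>Expectations under the draws start as sums over \<open>u\<close>; this regroups them by
  selected item and offset. Values in any commutative monoid are allowed.\<close>

lemma sum_pick:
  fixes F :: "'a \<times> int \<Rightarrow> 'b::comm_monoid_add"
  assumes "\<And>y. y \<in> set xs \<Longrightarrow> 0 \<le> snd y"
  shows "(\<Sum>u\<in>{0..<\<Sum>y\<leftarrow>xs. snd y}. F (pick d xs u)) = (\<Sum>y\<leftarrow>xs. \<Sum>u\<in>{0..<snd y}. F (fst y, u))"
  using assms
proof (induction xs)
  case (Cons y xs)
  obtain x m where y: "y = (x, m)" by (cases y)
  have m: "0 \<le> m" using Cons.prems(1)[of y] by (simp add: y)
  let ?n = "\<Sum>y\<leftarrow>xs. snd y"
  have n: "0 \<le> ?n" using Cons.prems by (intro sum_list_nonneg) auto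
  have "(\<Sum>u\<in>{0..<m + ?n}. F (pick d (y # xs) u))
    = (\<Sum>u\<in>{0..<m}. F (pick d (y # xs) u)) + (\<Sum>u\<in>{m..<m + ?n}. F (pick d (y # xs) u))"
    using m n by (subst sum.union_disjoint[symmetric]) (auto simp: ivl_disj_un)
  also have "(\<Sum>u\<in>{0..<m}. F (pick d (y # xs) u)) = (\<Sum>u\<in>{0..<m}. F (x, u))"
    by (simp add: y pick_Cons[OF m])
  also have "(\<Sum>u\<in>{m..<m + ?n}. F (pick d (y # xs) u)) = (\<Sum>u\<in>{0..<?n}. F (pick d xs u))"
    unfolding sum_int_shift by (rule sum.cong) (auto simp: y pick_Cons[OF m])
  finally show ?case using Cons by (simp add: y)
qed simp

text \<open>Each residue modulo \<open>n\<close> occurs exactly \<open>j\<close> times among the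
  integers below \<open>j * n\<close>.\<close>

lemma sum_mod:
  fixes f :: "int \<Rightarrow> real"
  assumes "0 < n" "0 \<le> j"
  shows "(\<Sum>u\<in>{0..<j * n}. f (u mod n)) = j * (\<Sum>u\<in>{0..<n}. f u)"
  using \<open>0 \<le> j\<close>
proof (induction j rule: int_ge_induct)
  case (step j)
  have "(\<Sum>u\<in>{0..<(j + 1) * n}. f (u mod n))
      = (\<Sum>u\<in>{0..<j * n}. f (u mod n)) + (\<Sum>u\<in>{j * n..<j * n + n}. f (u mod n))"
    using step assms by (subst sum.union_disjoint[symmetric]) (auto simp: ivl_disj_un algebra_simps)
  also have "(\<Sum>u\<in>{j * n..<j * n + n}. f (u mod n)) = (\<Sum>u\<in>{0..<n}. f u)"
    unfolding sum_int_shift by (rule sum.cong) auto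
  finally show ?case using step by (simp add: algebra_simps)
qed simp

section \<open>Correctness of the feasibility test\<close>

definition fval :: "fraction \<Rightarrow> real" where
  "fval x = real_of_int (fst x) / real_of_int (snd x)"

text \<open>
  \<open>W c\<close> is the list of the words of cell \<open>c\<close> in the order in which \<^const>\<open>unrank\<close> enumerates them.
\<close>

locale celled_instance =
  fixes k :: nat and r :: data and W :: "cell \<Rightarrow> nat list list"
  assumes distinct_cells: "distinct (cells k r)"
    and length_W: "c \<in> set (cells k r) \<Longrightarrow> int (length (W c)) = fst (snd c)"
    and distinct_W: "c \<in> set (cells k r) \<Longrightarrow> distinct (W c)"
    and disjoint_W: "c \<in> set (cells k r) \<Longrightarrow> c' \<in> set (cells k r) \<Longrightarrow> c \<noteq> c' \<Longrightarrow> set (W c) \<inter> set (W c') = {}"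
    and unrank_W: "c \<in> set (cells k r) \<Longrightarrow> 0 \<le> u \<Longrightarrow> u < fst (snd c) \<Longrightarrow>
      unrank k r (fst c, (u, snd (snd c))) = map int (W c ! nat u)"
    and distinct_specs: "distinct (map fst (specs_part r))"
    and label_in_specs: "c \<in> set (cells k r) \<Longrightarrow> W c \<noteq> [] \<Longrightarrow> state_label r (fst c) \<in> fst ` set (specs_part r)"
    and snd_pos: "snd (lam_part r) > 0" "snd (rho_part r) > 0" "snd (bound_part r) > 0"
      "s \<in> set (specs_part r) \<Longrightarrow> snd (fst (snd s)) > 0" "s \<in> set (specs_part r) \<Longrightarrow> snd (snd (snd s)) > 0"
    and lam_rho: "0 \<le> fval (lam_part r)" "fval (lam_part r) \<le> fval (rho_part r)"
    and word_bounds: "s \<in> set (specs_part r) \<Longrightarrow> 0 \<le> fval (fst (snd s))"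
      "s \<in> set (specs_part r) \<Longrightarrow> fval (fst (snd s)) \<le> fval (snd (snd s))"
begin

abbreviation "Q \<equiv> denom r"
abbreviation "specs \<equiv> set (specs_part r)"
abbreviation "lo s \<equiv> fst (snd (s :: label_spec))"
abbreviation "hi s \<equiv> snd (snd (s :: label_spec))"

definition cells_of :: "label_spec \<Rightarrow> cell set" where
  "cells_of s = {c \<in> set (cells k r). state_label r (fst c) = fst s}"

definition words_of :: "label_spec \<Rightarrow> nat list set" where
  "words_of s = (\<Union>c\<in>cells_of s. set (W c))"

definition all_words :: "nat list set" where
  "all_words = (\<Union>c\<in>set (cells k r). set (W c))"

lemma finite_cells_of [simp]: "finite (cells_of s)" and cells_of_subset: "cells_of s \<subseteq> set (cells k r)"
  by (auto simp: cells_of_def)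

lemma finite_words_of [simp]: "finite (words_of s)" and finite_all_words [simp]: "finite all_words"
  by (auto simp: words_of_def all_words_def)

lemma denom_pos: "Q > 0"
proof -
  have "(\<Prod>s\<leftarrow>xs. snd (fst (snd s)) * snd (snd (snd s))) > 0" if "set xs \<subseteq> specs" for xs
    using that snd_pos(4,5) by (induction xs) auto
  then show ?thesis using snd_pos(1,2) by (simp add: denom_def)
qed

lemma dvd_denom:
  "snd (lam_part r) dvd Q" "snd (rho_part r) dvd Q"
  "s \<in> specs \<Longrightarrow> snd (lo s) dvd Q" "s \<in> specs \<Longrightarrow> snd (hi s) dvd Q"
proof -
  have "s \<in> set xs \<Longrightarrow> snd (lo s) * snd (hi s) dvd (\<Prod>s\<leftarrow>xs. snd (fst (snd s)) * snd (snd (snd s)))" for xs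
    by (induction xs) (auto intro: dvd_mult dvd_mult2)
  then have "s \<in> specs \<Longrightarrow> snd (lo s) * snd (hi s) dvd Q"
    unfolding denom_def by (intro dvd_mult) auto
  then show "s \<in> specs \<Longrightarrow> snd (lo s) dvd Q" "s \<in> specs \<Longrightarrow> snd (hi s) dvd Q"
    using dvd_mult_left dvd_mult_right by blast+
qed (simp_all add: denom_def)

lemma scaled_eq: "snd x dvd Q \<Longrightarrow> real_of_int (scaled r x) = Q * fval x"
  unfolding scaled_def fval_def by (auto elim!: dvdE)

lemma scaled_simps:
  "real_of_int (scaled r (lam_part r)) = Q * fval (lam_part r)"
  "real_of_int (scaled r (rho_part r)) = Q * fval (rho_part r)"
  "s \<in> specs \<Longrightarrow> real_of_int (scaled r (lo s)) = Q * fval (lo s)"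
  "s \<in> specs \<Longrightarrow> real_of_int (scaled r (hi s)) = Q * fval (hi s)"
  by (rule scaled_eq, rule dvd_denom, assumption?)+

lemma scaled_mono:
  "0 \<le> scaled r (lam_part r)" "scaled r (lam_part r) \<le> scaled r (rho_part r)"
  "s \<in> specs \<Longrightarrow> 0 \<le> scaled r (lo s)" "s \<in> specs \<Longrightarrow> scaled r (lo s) \<le> scaled r (hi s)"
proof -
  have Q: "0 \<le> real_of_int Q" using denom_pos by simp
  have "0 \<le> real_of_int (scaled r (lam_part r))"
    "real_of_int (scaled r (lam_part r)) \<le> real_of_int (scaled r (rho_part r))"
    unfolding scaled_simps using Q lam_rho by (auto intro: mult_left_mono)
  then show "0 \<le> scaled r (lam_part r)" "scaled r (lam_part r) \<le> scaled r (rho_part r)"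
    by simp_all
  assume s: "s \<in> specs"
  have "0 \<le> real_of_int (scaled r (lo s))" "real_of_int (scaled r (lo s)) \<le> real_of_int (scaled r (hi s))"
    unfolding scaled_simps(3,4)[OF s] using Q word_bounds[OF s] by (auto intro: mult_left_mono)
  then show "0 \<le> scaled r (lo s)" "scaled r (lo s) \<le> scaled r (hi s)" by simp_all
qed

lemma count_nonneg: "c \<in> set (cells k r) \<Longrightarrow> 0 \<le> fst (snd c)"
  using length_W by (metis of_nat_0_le_iff)

lemma sum_words_of: "(\<Sum>w\<in>words_of s. f w) = (\<Sum>c\<in>cells_of s. \<Sum>w\<in>set (W c). f w)"
  unfolding words_of_def
proof (intro sum.UNION_disjoint ballI impI)
  fix c c' assume "c \<in> cells_of s" "c' \<in> cells_of s" "c \<noteq> c'"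
  then show "set (W c) \<inter> set (W c') = {}"
    by (intro disjoint_W subsetD[OF cells_of_subset[of s]])
qed simp_all

lemma cells_of_disjoint: "s \<in> specs \<Longrightarrow> s' \<in> specs \<Longrightarrow> s \<noteq> s' \<Longrightarrow> cells_of s \<inter> cells_of s' = {}"
proof (rule ccontr)
  assume s: "s \<in> specs" "s' \<in> specs" "s \<noteq> s'" "cells_of s \<inter> cells_of s' \<noteq> {}"
  then obtain c where "c \<in> cells_of s" "c \<in> cells_of s'" by (metis disjoint_iff)
  then have "fst s = fst s'" by (simp add: cells_of_def)
  moreover have "inj_on fst specs" using distinct_specs by (simp add: distinct_map)
  ultimately show False using s by (metis inj_onD)
qed

lemma all_words_UN: "all_words = (\<Union>s\<in>specs. words_of s)"
proof (intro equalityI subsetI)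
  fix w assume "w \<in> all_words"
  then obtain c where c: "c \<in> set (cells k r)" "w \<in> set (W c)" unfolding all_words_def by (rule UN_E)
  then have "W c \<noteq> []" by (metis empty_iff set_empty)
  from label_in_specs[OF c(1) this] obtain s where s: "state_label r (fst c) = fst s" "s \<in> specs" by (rule imageE)
  then have "c \<in> cells_of s" using c(1) by (simp add: cells_of_def)
  then have "w \<in> words_of s" unfolding words_of_def using c(2) by (rule UN_I)
  with s(2) show "w \<in> (\<Union>s\<in>specs. words_of s)" by (rule UN_I)
next
  fix w assume "w \<in> (\<Union>s\<in>specs. words_of s)"
  then obtain s where "s \<in> specs" "w \<in> words_of s" by (rule UN_E)
  then obtain c where "c \<in> cells_of s" "w \<in> set (W c)" unfolding words_of_def by (elim UN_E)
  then show "w \<in> all_words" unfolding all_words_def using subsetD[OF cells_of_subset] by (intro UN_I) simp_all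
qed

lemma sum_all_words: "(\<Sum>w\<in>all_words. f w) = (\<Sum>s\<in>specs. \<Sum>w\<in>words_of s. f w)"
  unfolding all_words_UN
proof (intro sum.UNION_disjoint ballI impI)
  fix s s' assume s: "s \<in> specs" "s' \<in> specs" "s \<noteq> s'"
  have "set (W c) \<inter> set (W c') = {}" if "c \<in> cells_of s" "c' \<in> cells_of s'" for c c'
  proof (rule disjoint_W)
    show "c \<in> set (cells k r)" "c' \<in> set (cells k r)"
      using that subsetD[OF cells_of_subset[of s]] subsetD[OF cells_of_subset[of s']] by simp_all
    show "c \<noteq> c'" using that cells_of_disjoint[OF s] by (metis disjoint_iff)
  qed
  then show "words_of s \<inter> words_of s' = {}"
    unfolding words_of_def by (simp add: Int_UN_distrib2 del: split_paired_All)
qed auto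

lemma card_W: "c \<in> set (cells k r) \<Longrightarrow> real (card (set (W c))) = fst (snd c)"
  using length_W[of c] distinct_W[of c] by (metis distinct_card of_int_of_nat_eq)

lemma sum_counts: "(\<Sum>c\<in>cells_of s. real_of_int (fst (snd c))) = card (words_of s)"
proof -
  have "real (card (words_of s)) = (\<Sum>w\<in>words_of s. 1)" by simp
  also have "\<dots> = (\<Sum>c\<in>cells_of s. real_of_int (fst (snd c)))"
    unfolding sum_words_of
  proof (intro sum.cong refl)
    fix c assume "c \<in> cells_of s"
    then have "c \<in> set (cells k r)" using cells_of_subset by blast
    then show "(\<Sum>w\<in>set (W c). 1) = real_of_int (fst (snd c))" using card_W[of c] by simp
  qed
  finally show ?thesis ..
qed


section \<open>The allocations within a label and among the labels\<close>

definition item_of :: "label_spec \<Rightarrow> cell \<Rightarrow> cell item" where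
  "item_of s c = (c, (state_cost r (fst c), (scaled r (lo s) * fst (snd c), scaled r (hi s) * fst (snd c))))"

definition cell_list :: "label_spec \<Rightarrow> cell list" where
  "cell_list s = filter (\<lambda>c. state_label r (fst c) = fst s) (cells k r)"

lemma label_items_eq: "label_items k r s = map (item_of s) (cell_list s)"
  by (simp add: label_items_def item_of_def cell_list_def)

lemma set_cell_list: "set (cell_list s) = cells_of s" and distinct_cell_list: "distinct (cell_list s)"
  using distinct_cells by (auto simp: cell_list_def cells_of_def)

lemma inj_item_of: "inj (item_of s)"
  by (auto simp: inj_def item_of_def)

lemma sum_cell_list: "(\<Sum>c\<leftarrow>cell_list s. f c) = (\<Sum>c\<in>cells_of s. f c)"
  by (simp add: sum_list_distinct_conv_sum_set distinct_cell_list set_cell_list)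

definition ok :: "label_spec \<Rightarrow> bool" where
  "ok s \<longleftrightarrow> in_range (label_items k r s) Q"

text \<open>The cells of a label make up its whole class, so the bounds of the items add up to those
  of \<open>card (words_of s)\<close> words. The condition says that a conditional distribution
  within the bounds exists.\<close>

lemma ok_iff:
  assumes s: "s \<in> specs"
  shows "ok s \<longleftrightarrow> card (words_of s) * fval (lo s) \<le> 1 \<and> 1 \<le> card (words_of s) * fval (hi s)"
proof -
  have sum_item: "real_of_int (\<Sum>y\<leftarrow>label_items k r s. f y) = (\<Sum>c\<in>cells_of s. real_of_int (f (item_of s c)))" for f
    by (simp add: label_items_eq o_def sum_cell_list)
  have *: "real_of_int (\<Sum>y\<leftarrow>label_items k r s. ilo y) = Q * (card (words_of s) * fval (lo s))"
    "real_of_int (\<Sum>y\<leftarrow>label_items k r s. ihi y) = Q * (card (words_of s) * fval (hi s))"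
    unfolding sum_counts[symmetric] sum_item sum_distrib_left sum_distrib_right
    by (intro sum.cong refl; simp add: item_of_def scaled_simps s)+
  have "ok s \<longleftrightarrow> real_of_int (\<Sum>y\<leftarrow>label_items k r s. ilo y) \<le> real_of_int Q * 1 \<and>
     real_of_int Q * 1 \<le> real_of_int (\<Sum>y\<leftarrow>label_items k r s. ihi y)"
    unfolding ok_def in_range_def by (simp only: of_int_le_iff mult_1_right)
  also have "\<dots> \<longleftrightarrow> card (words_of s) * fval (lo s) \<le> 1 \<and> 1 \<le> card (words_of s) * fval (hi s)"
    unfolding * using denom_pos by (simp only: mult_le_cancel_left_pos of_int_0_less_iff)
  finally show ?thesis .
qed

lemma set_label_items: "set (label_items k r s) = item_of s ` cells_of s"
  unfolding label_items_eq set_map set_cell_list ..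

lemma item_of_simps:
  "fst (item_of s c) = c" "icost (item_of s c) = state_cost r (fst c)"
  "ilo (item_of s c) = scaled r (lo s) * fst (snd c)" "ihi (item_of s c) = scaled r (hi s) * fst (snd c)"
  by (simp_all add: item_of_def)

lemma sum_label_items: "(\<Sum>y\<in>set (label_items k r s). f y) = (\<Sum>c\<in>cells_of s. f (item_of s c))"
  unfolding set_label_items
  by (rule sum.reindex_cong[OF inj_on_subset[OF inj_item_of subset_UNIV] refl refl])

text \<open>The conditional mass of a cell within its label, in units of \<open>1/Q\<close>. It is
  extracted by choice because \<open>greedy_spec\<close> describes the greedy list only up to order
  and by an existential.\<close>

definition X :: "label_spec \<Rightarrow> cell \<Rightarrow> int" where
  "X s c = (if ok s then (SOME v.
      mset (label_alloc k r s) = mset (map (\<lambda>y. (fst y, (icost y, v y))) (label_items k r s)) \<and>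
      optimal_alloc (label_items k r s) Q v) (item_of s c) else 0)"

lemma X_spec:
  fixes z :: "cell \<Rightarrow> real"
  assumes s: "s \<in> specs" "ok s"
  shows "mset (label_alloc k r s) = mset (map (\<lambda>c. (c, (state_cost r (fst c), X s c))) (cell_list s))"
    "c \<in> cells_of s \<Longrightarrow> scaled r (lo s) * fst (snd c) \<le> X s c"
    "c \<in> cells_of s \<Longrightarrow> X s c \<le> scaled r (hi s) * fst (snd c)"
    "(\<Sum>c\<in>cells_of s. X s c) = Q"
    "(\<And>c. c \<in> cells_of s \<Longrightarrow> scaled r (lo s) * fst (snd c) \<le> z c) \<Longrightarrow>
     (\<And>c. c \<in> cells_of s \<Longrightarrow> z c \<le> scaled r (hi s) * fst (snd c)) \<Longrightarrow>
       (\<Sum>c\<in>cells_of s. z c) = Q \<Longrightarrow>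
       of_int (\<Sum>c\<in>cells_of s. state_cost r (fst c) * X s c) \<le> (\<Sum>c\<in>cells_of s. state_cost r (fst c) * z c)"
proof -
  define v where "v = (SOME v.
      mset (label_alloc k r s) = mset (map (\<lambda>y. (fst y, (icost y, v y))) (label_items k r s)) \<and>
      optimal_alloc (label_items k r s) Q v)"
  have X: "X s c = v (item_of s c)" for c using s(2) by (simp add: X_def v_def)
  have d: "distinct (label_items k r s)"
    by (simp add: label_items_eq distinct_map distinct_cell_list inj_on_subset[OF inj_item_of])
  have le: "ilo y \<le> ihi y" if "y \<in> set (label_items k r s)" for y
  proof -
    obtain c where c: "y = item_of s c" "c \<in> cells_of s"
      using \<open>y \<in> set (label_items k r s)\<close> unfolding set_label_items by (rule imageE)
    then have "0 \<le> fst (snd c)" using count_nonneg[OF subsetD[OF cells_of_subset]] by simp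
    then show ?thesis unfolding c(1) item_of_simps by (rule mult_right_mono[OF scaled_mono(4)[OF s(1)]])
  qed
  have v: "mset (label_alloc k r s) = mset (map (\<lambda>y. (fst y, (icost y, v y))) (label_items k r s)) \<and>
      optimal_alloc (label_items k r s) Q v"
    using someI_ex[OF greedy_spec[OF d le s(2)[unfolded ok_def]]] unfolding v_def label_alloc_def .
  show "mset (label_alloc k r s) = mset (map (\<lambda>c. (c, (state_cost r (fst c), X s c))) (cell_list s))"
    using v by (simp add: label_items_eq o_def item_of_simps X del: mset_map)
  note opt = v[THEN conjunct2, unfolded optimal_alloc_def sum_label_items item_of_simps, folded X]
  show "(\<Sum>c\<in>cells_of s. X s c) = Q" using opt by (elim conjE)
  show "scaled r (lo s) * fst (snd c) \<le> X s c" "X s c \<le> scaled r (hi s) * fst (snd c)" if "c \<in> cells_of s"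
    using opt[THEN conjunct1] that unfolding set_label_items by (simp_all add: item_of_simps X)
  show "of_int (\<Sum>c\<in>cells_of s. state_cost r (fst c) * X s c) \<le> (\<Sum>c\<in>cells_of s. state_cost r (fst c) * z c)"
    if "\<And>c. c \<in> cells_of s \<Longrightarrow> scaled r (lo s) * fst (snd c) \<le> z c"
     "\<And>c. c \<in> cells_of s \<Longrightarrow> z c \<le> scaled r (hi s) * fst (snd c)" "(\<Sum>c\<in>cells_of s. z c) = Q"
    using opt[THEN conjunct2, THEN conjunct2, THEN spec, of "\<lambda>y. z (fst y)"] that
    unfolding set_label_items by (simp add: item_of_simps)
qed

lemma sum_list_mset_cong: "mset xs = mset ys \<Longrightarrow> (\<Sum>x\<leftarrow>xs. f x) = (\<Sum>x\<leftarrow>ys. f x)"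
  for f :: "'z \<Rightarrow> 'y::comm_monoid_add"
  by (metis mset_map sum_mset_sum_list)

lemma sum_label_alloc:
  assumes s: "s \<in> specs" "ok s"
  shows "(\<Sum>z\<leftarrow>label_alloc k r s. f z) = (\<Sum>c\<in>cells_of s. f (c, (state_cost r (fst c), X s c)))"
  unfolding sum_list_mset_cong[OF X_spec(1)[OF s]] by (simp add: o_def sum_cell_list)

lemma alloc_cost_label:
  assumes s: "s \<in> specs" "ok s"
  shows "alloc_cost (label_alloc k r s) = (\<Sum>c\<in>cells_of s. state_cost r (fst c) * X s c)"
  unfolding alloc_cost_def sum_label_alloc[OF s] by simp

lemma X_nonneg: "s \<in> specs \<Longrightarrow> c \<in> cells_of s \<Longrightarrow> 0 \<le> X s c"
proof (cases "ok s")
  case True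
  assume s: "s \<in> specs" "c \<in> cells_of s"
  have "0 \<le> scaled r (lo s) * fst (snd c)"
    using scaled_mono(3)[OF s(1)] count_nonneg[OF subsetD[OF cells_of_subset s(2)]]
    by (rule mult_nonneg_nonneg)
  also have "\<dots> \<le> X s c" by (rule X_spec(2)[OF s(1) True s(2)])
  finally show ?thesis .
qed (simp add: X_def)

text \<open>Both bounds of an empty cell are 0.\<close>

lemma X_zero: "s \<in> specs \<Longrightarrow> c \<in> cells_of s \<Longrightarrow> fst (snd c) = 0 \<Longrightarrow> X s c = 0"
  using X_spec(2,3)[of s c] by (cases "ok s") (simp_all add: X_def)


abbreviation "lab_cost s \<equiv> alloc_cost (label_alloc k r s)"

definition top_hi :: "label_spec \<Rightarrow> int" where
  "top_hi s = (if ok s then scaled r (rho_part r) else 0)"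

definition top_item :: "label_spec \<Rightarrow> (int \<times> (cell \<times> int \<times> int) list) item" where
  "top_item s = ((fst s, label_alloc k r s), (lab_cost s, (scaled r (lam_part r), top_hi s)))"

lemma top_items_eq: "top_items k r = map top_item (specs_part r)"
  by (simp add: top_items_def top_item_def top_hi_def ok_def)

lemma distinct_specs_part: "distinct (specs_part r)"
  using distinct_specs by (simp add: distinct_map)

text \<open>The label is kept in the tag for this purpose: labels whose allocations and bounds agree
  still give distinct items, as \<open>greedy_spec\<close> requires.\<close>

lemma inj_top_item: "inj_on top_item specs"
  using distinct_specs by (simp add: inj_on_def top_item_def distinct_map)

lemma sum_top_items: "(\<Sum>y\<in>set (top_items k r). f y) = (\<Sum>s\<in>specs. f (top_item s))"
  unfolding top_items_eq set_map by (rule sum.reindex_cong[OF inj_top_item refl refl])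

lemma top_item_simps:
  "fst (top_item s) = (fst s, label_alloc k r s)" "icost (top_item s) = lab_cost s"
  "ilo (top_item s) = scaled r (lam_part r)" "ihi (top_item s) = top_hi s"
  by (simp_all add: top_item_def)

text \<open>The mass of a label in units of \<open>1/Q\<close>, extracted by choice like
  \<open>X\<close>.\<close>

definition Y :: "label_spec \<Rightarrow> int" where
  "Y s = (SOME v. mset (top_alloc k r) = mset (map (\<lambda>y. (fst y, (icost y, v y))) (top_items k r)) \<and>
      optimal_alloc (top_items k r) Q v) (top_item s)"

lemma Y_spec:
  fixes z :: "label_spec \<Rightarrow> real"
  assumes "list_all (\<lambda>y. ilo y \<le> ihi y) (top_items k r)" "in_range (top_items k r) Q"
  shows "mset (top_alloc k r) = mset (map (\<lambda>s. ((fst s, label_alloc k r s), (lab_cost s, Y s))) (specs_part r))"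
    "s \<in> specs \<Longrightarrow> scaled r (lam_part r) \<le> Y s"
    "s \<in> specs \<Longrightarrow> Y s \<le> top_hi s"
    "(\<Sum>s\<in>specs. Y s) = Q"
    "(\<And>s. s \<in> specs \<Longrightarrow> scaled r (lam_part r) \<le> z s) \<Longrightarrow> (\<And>s. s \<in> specs \<Longrightarrow> z s \<le> top_hi s) \<Longrightarrow>
       (\<Sum>s\<in>specs. z s) = Q \<Longrightarrow>
       of_int (\<Sum>s\<in>specs. lab_cost s * Y s) \<le> (\<Sum>s\<in>specs. lab_cost s * z s)"
proof -
  define v where "v = (SOME v. mset (top_alloc k r) = mset (map (\<lambda>y. (fst y, (icost y, v y))) (top_items k r)) \<and>
      optimal_alloc (top_items k r) Q v)"
  have Y: "Y s = v (top_item s)" for s by (simp add: Y_def v_def)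
  have d: "distinct (top_items k r)"
    unfolding top_items_eq using inj_top_item distinct_specs_part by (simp add: distinct_map)
  have le: "ilo y \<le> ihi y" if "y \<in> set (top_items k r)" for y
    using assms(1) that by (simp add: list_all_iff)
  have v: "mset (top_alloc k r) = mset (map (\<lambda>y. (fst y, (icost y, v y))) (top_items k r)) \<and>
      optimal_alloc (top_items k r) Q v"
    using someI_ex[OF greedy_spec[OF d le assms(2)]] unfolding v_def top_alloc_def .
  show "mset (top_alloc k r) = mset (map (\<lambda>s. ((fst s, label_alloc k r s), (lab_cost s, Y s))) (specs_part r))"
    using v by (simp add: top_items_eq o_def top_item_simps Y del: mset_map)
  note opt = v[THEN conjunct2, unfolded optimal_alloc_def sum_top_items top_item_simps, folded Y]
  show "(\<Sum>s\<in>specs. Y s) = Q" using opt by (elim conjE)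
  show "scaled r (lam_part r) \<le> Y s" "Y s \<le> top_hi s" if "s \<in> specs"
    using opt[THEN conjunct1] that unfolding top_items_eq set_map by (simp_all add: top_item_simps Y)
  show "of_int (\<Sum>s\<in>specs. lab_cost s * Y s) \<le> (\<Sum>s\<in>specs. lab_cost s * z s)"
    if "\<And>s. s \<in> specs \<Longrightarrow> scaled r (lam_part r) \<le> z s" "\<And>s. s \<in> specs \<Longrightarrow> z s \<le> top_hi s"
      "(\<Sum>s\<in>specs. z s) = Q"
  proof -
    \<comment> \<open>The competitor is given per label while optimality speaks about items;
      injectivity of \<open>top_item\<close> transports it.\<close>
    let ?z = "\<lambda>y. z (inv_into specs top_item y)"
    have inv: "s \<in> specs \<Longrightarrow> ?z (top_item s) = z s" for s using inj_top_item by simp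
    show ?thesis
      using opt[THEN conjunct2, THEN conjunct2, THEN spec, of ?z] that inv
      unfolding top_items_eq set_map by (simp add: top_item_simps cong: sum.cong)
  qed
qed

lemma sum_top_alloc:
  assumes "list_all (\<lambda>y. ilo y \<le> ihi y) (top_items k r)" "in_range (top_items k r) Q"
  shows "(\<Sum>z\<leftarrow>top_alloc k r. f z) = (\<Sum>s\<in>specs. f ((fst s, label_alloc k r s), (lab_cost s, Y s)))"
  unfolding sum_list_mset_cong[OF Y_spec(1)[OF assms]]
  by (simp add: o_def sum_list_distinct_conv_sum_set distinct_specs_part)

lemma alloc_cost_top:
  assumes "list_all (\<lambda>y. ilo y \<le> ihi y) (top_items k r)" "in_range (top_items k r) Q"
  shows "alloc_cost (top_alloc k r) = (\<Sum>s\<in>specs. lab_cost s * Y s)"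
  unfolding alloc_cost_def sum_top_alloc[OF assms] by simp

lemma cost_bound_iff:
  "alloc_cost (top_alloc k r) * snd (bound_part r) \<le> fst (bound_part r) * (Q * Q)
   \<longleftrightarrow> real_of_int (alloc_cost (top_alloc k r)) \<le> Q * Q * fval (bound_part r)"
proof -
  have "real_of_int (alloc_cost (top_alloc k r)) \<le> Q * Q * fval (bound_part r) \<longleftrightarrow>
     real_of_int (alloc_cost (top_alloc k r) * snd (bound_part r)) \<le> real_of_int (fst (bound_part r) * (Q * Q))"
    using snd_pos(3) by (simp add: fval_def field_simps)
  then show ?thesis unfolding of_int_le_iff by simp
qed

end

lemma sum_list_concat_map:
  fixes f :: "'b \<Rightarrow> 'c::comm_monoid_add"
  shows "(\<Sum>y\<leftarrow>concat (map g xs). f y) = (\<Sum>x\<leftarrow>xs. \<Sum>y\<leftarrow>g x. f y)"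
  by (induction xs) auto

lemma prod_list_max_pos: "0 < (\<Prod>x\<leftarrow>xs. max 1 (f x) :: int)"
  by (induction xs) auto

lemma dvd_prod_list: "x \<in> set xs \<Longrightarrow> f x dvd (\<Prod>x\<leftarrow>xs. f x :: int)"
  by (induction xs) (auto intro: dvd_mult)

lemma sum_nth_int:
  assumes "distinct xs"
  shows "(\<Sum>u\<in>{0..<int (length xs)}. f (xs ! nat u)) = (\<Sum>x\<in>set xs. f x)"
proof -
  have "(\<Sum>u\<in>{0..<int (length xs)}. f (xs ! nat u)) = (\<Sum>i\<in>{..<length xs}. f (xs ! i))"
    by (rule sum.reindex_bij_witness[of _ int nat]) auto
  also have "\<dots> = (\<Sum>x\<in>set xs. f x)"
    using sum.reindex_bij_betw[OF bij_betw_nth[OF assms refl refl]] .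
  finally show ?thesis .
qed

section \<open>The distribution of the draws, and both directions of the feasibility test\<close>

context celled_instance
begin

definition improviser_dist :: "nat list pmf" where
  "improviser_dist = map_pmf (\<lambda>u. map nat (draw k (r, u))) (pmf_of_set {0..<total_mass k r})"

text \<open>The probability of one word: \<open>Y s / Q\<close> for its label,
  \<open>X s c / Q\<close> for its cell within the label, divided by the number of words. For an
  empty cell the division by 0 yields 0.\<close>

definition weight :: "label_spec \<Rightarrow> cell \<Rightarrow> real" where
  "weight s c = Y s * X s c / (Q * Q * fst (snd c))"

text \<open>The maximum with 1 in \<open>count_prod\<close> keeps empty cells from annihilating the
  product.\<close>

lemma count_prod_pos: "0 < count_prod k r"
  unfolding count_prod_def by (rule prod_list_max_pos)

lemma dvd_count_prod:
  assumes c: "c \<in> set (cells k r)" and n: "0 < fst (snd c)"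
  shows "fst (snd c) dvd count_prod k r"
proof -
  have "max 1 (fst (snd c)) = fst (snd c)" using n by simp
  then show ?thesis using dvd_prod_list[OF c, of "\<lambda>c. max 1 (fst (snd c))"] by (simp add: count_prod_def)
qed

lemma total_mass_pos: "0 < total_mass k r"
  using denom_pos count_prod_pos by (simp add: total_mass_def)

context
  assumes top_le: "list_all (\<lambda>y. ilo y \<le> ihi y) (top_items k r)"
    and top_range: "in_range (top_items k r) Q"
begin

lemma Y_nonneg: "s \<in> specs \<Longrightarrow> 0 \<le> Y s"
  using Y_spec(2)[OF top_le top_range, of s] scaled_mono(1) by linarith

lemma Y_zero: "s \<in> specs \<Longrightarrow> \<not> ok s \<Longrightarrow> Y s = 0"
  using Y_spec(3)[OF top_le top_range, of s] Y_nonneg[of s] by (simp add: top_hi_def)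

text \<open>For a label that is not \<open>ok\<close> the greedy list has no known content, but the
  label has mass 0, so all its blocks have length 0 and \<open>f0\<close> discards them.\<close>

lemma sum_blocks:
  fixes f :: "cell \<times> int \<Rightarrow> 'b::comm_monoid_add"
  assumes f0: "\<And>c. f (c, 0) = 0"
  shows "(\<Sum>b\<leftarrow>blocks k r. f b) = (\<Sum>s\<in>specs. \<Sum>c\<in>cells_of s. f (c, Y s * X s c * count_prod k r))"
proof -
  have "(\<Sum>b\<leftarrow>blocks k r. f b) = (\<Sum>s\<in>specs. \<Sum>z\<leftarrow>label_alloc k r s. f (fst z, Y s * snd (snd z) * count_prod k r))"
    unfolding blocks_def sum_list_concat_map by (simp add: o_def sum_top_alloc[OF top_le top_range])
  also have "\<dots> = (\<Sum>s\<in>specs. \<Sum>c\<in>cells_of s. f (c, Y s * X s c * count_prod k r))"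
  proof (intro sum.cong refl)
    fix s assume s: "s \<in> specs"
    show "(\<Sum>z\<leftarrow>label_alloc k r s. f (fst z, Y s * snd (snd z) * count_prod k r))
      = (\<Sum>c\<in>cells_of s. f (c, Y s * X s c * count_prod k r))"
    proof (cases "ok s")
      case True
      then show ?thesis by (simp add: sum_label_alloc s)
    next
      case False
      then show ?thesis by (simp add: Y_zero s f0)
    qed
  qed
  finally show ?thesis .
qed

text \<open>Summing the indicator of a violation turns a property of all blocks into an instance of
  \<open>sum_blocks\<close>. The case of length 0 covers the blocks of labels that are not
  \<open>ok\<close>.\<close>

lemma blocks_all:
  assumes "\<And>s c. s \<in> specs \<Longrightarrow> c \<in> cells_of s \<Longrightarrow> P (c, Y s * X s c * count_prod k r)" "\<And>c. P (c, 0)"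
    and b: "b \<in> set (blocks k r)"
  shows "P b"
proof -
  let ?f = "\<lambda>b. if P b then 0 else (1::nat)"
  have "(\<Sum>b\<leftarrow>blocks k r. ?f b) = (\<Sum>s\<in>specs. \<Sum>c\<in>cells_of s. ?f (c, Y s * X s c * count_prod k r))"
    by (rule sum_blocks) (simp only: assms(2) if_True)
  also have "\<dots> = 0" by (intro sum.neutral ballI) (simp only: assms(1) if_True)
  finally have "\<forall>n\<in>set (map ?f (blocks k r)). n = 0" by (simp only: sum_list_eq_0_iff)
  then have "?f b = 0" using imageI[OF b, of ?f] by (simp only: set_map)
  then show ?thesis by (metis zero_neq_one)
qed

text \<open>The factor \<open>Y s\<close> is there for labels that are not \<open>ok\<close>: their
  \<open>X\<close> adds up to 0 instead of \<open>Q\<close>, but their \<open>Y\<close> is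
  0.\<close>

lemma sum_X: "s \<in> specs \<Longrightarrow> Y s * (\<Sum>c\<in>cells_of s. X s c) = Y s * Q"
  using X_spec(4)[of s] Y_zero[of s] by (cases "ok s") simp_all

lemma sum_blocks_total: "(\<Sum>b\<leftarrow>blocks k r. snd b) = total_mass k r"
proof -
  have "(\<Sum>b\<leftarrow>blocks k r. snd b) = (\<Sum>s\<in>specs. \<Sum>c\<in>cells_of s. Y s * X s c * count_prod k r)"
    using sum_blocks[of snd] by simp
  also have "\<dots> = (\<Sum>s\<in>specs. (Y s * (\<Sum>c\<in>cells_of s. X s c)) * count_prod k r)"
    by (simp only: sum_distrib_left sum_distrib_right)
  also have "\<dots> = (\<Sum>s\<in>specs. Y s * Q * count_prod k r)" by (simp add: sum_X)
  also have "\<dots> = (\<Sum>s\<in>specs. Y s) * Q * count_prod k r" by (simp only: sum_distrib_right)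
  also have "\<dots> = total_mass k r"
    by (simp add: Y_spec(4)[OF top_le top_range] total_mass_def)
  finally show ?thesis .
qed

lemma block_props:
  assumes "b \<in> set (blocks k r)"
  shows "0 \<le> snd b \<and> (0 < snd b \<longrightarrow> fst b \<in> set (cells k r) \<and> 0 < fst (snd (fst b)))"
  using assms
proof (rule blocks_all[rotated 2])
  fix s c assume s: "s \<in> specs" "c \<in> cells_of s"
  have c: "c \<in> set (cells k r)" using subsetD[OF cells_of_subset s(2)] .
  have 0: "0 \<le> Y s * X s c * count_prod k r"
    using Y_nonneg[OF s(1)] X_nonneg[OF s] count_prod_pos by simp
  have n: "0 < fst (snd c)" if "0 < Y s * X s c * count_prod k r"
  proof (rule ccontr)
    assume "\<not> 0 < fst (snd c)"
    then have "fst (snd c) = 0" using count_nonneg[OF c] by linarith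
    then show False using that X_zero[OF s] by simp
  qed
  show "0 \<le> snd (c, Y s * X s c * count_prod k r) \<and> (0 < snd (c, Y s * X s c * count_prod k r) \<longrightarrow>
      fst (c, Y s * X s c * count_prod k r) \<in> set (cells k r) \<and> 0 < fst (snd (fst (c, Y s * X s c * count_prod k r))))"
    unfolding fst_conv snd_conv by (intro conjI impI 0 c n)
qed simp

lemma draw_word:
  assumes "0 \<le> u" "u < total_mass k r"
  shows "\<exists>w. draw k (r, u) = map int w"
proof -
  define z where "z = pick ((0, (0, 0)), (0, [])) (blocks k r) u"
  obtain m where m: "(fst z, m) \<in> set (blocks k r)" "0 \<le> snd z" "snd z < m"
  proof (rule pick_mem[of "blocks k r" u "((0, (0, 0)), (0, []))"])
    show "0 \<le> snd y" if "y \<in> set (blocks k r)" for y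
      using block_props[OF that] by simp
    show "0 \<le> u" "u < (\<Sum>y\<leftarrow>blocks k r. snd y)" using assms unfolding sum_blocks_total by simp_all
  qed (rule that, unfold z_def)
  then have c: "fst z \<in> set (cells k r)" "0 < fst (snd (fst z))"
    using block_props[OF m(1)] by simp_all
  have "unrank k r (fst (fst z), (snd z mod fst (snd (fst z)), snd (snd (fst z))))
      = map int (W (fst z) ! nat (snd z mod fst (snd (fst z))))"
    using c(2) by (intro unrank_W[OF c(1)]) simp_all
  then show ?thesis by (simp add: draw_def z_def[symmetric] Let_def)
qed

text \<open>The length of the block is a multiple of the size of the cell because
  \<open>count_prod\<close> is, so the reduction modulo that size hits every word equally often. For
  an empty cell the block is empty and the weight is 0.\<close>

lemma sum_cell_draws:
  fixes \<phi> :: "nat list \<Rightarrow> real"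
  assumes s: "s \<in> specs" "c \<in> cells_of s"
  shows "(\<Sum>u\<in>{0..<Y s * X s c * count_prod k r}.
      \<phi> (map nat (unrank k r (fst c, (u mod fst (snd c), snd (snd c))))))
    = total_mass k r * (weight s c * (\<Sum>w\<in>set (W c). \<phi> w))"
proof -
  have c: "c \<in> set (cells k r)" using subsetD[OF cells_of_subset s(2)] .
  show ?thesis
  proof (cases "fst (snd c) = 0")
    case True
    then show ?thesis using X_zero[OF s] by (simp add: weight_def)
  next
    case False
    define n where "n = fst (snd c)"
    have n: "0 < n" using False count_nonneg[OF c] by (simp add: n_def)
    obtain m where m: "count_prod k r = n * m" using dvd_count_prod[OF c n[unfolded n_def]] unfolding n_def[symmetric] by (rule dvdE)
    have m0: "0 \<le> m" using count_prod_pos n unfolding m by (simp add: zero_less_mult_iff)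
    let ?f = "\<lambda>u. \<phi> (map nat (unrank k r (fst c, (u, snd (snd c)))))"
    have eq: "Y s * X s c * count_prod k r = (Y s * X s c * m) * n" by (simp add: m)
    have "(\<Sum>u\<in>{0..<Y s * X s c * count_prod k r}. ?f (u mod n)) = (Y s * X s c * m) * (\<Sum>u\<in>{0..<n}. ?f u)"
      unfolding eq using Y_nonneg[OF s(1)] X_nonneg[OF s] m0 n by (intro sum_mod) simp_all
    also have "(\<Sum>u\<in>{0..<n}. ?f u) = (\<Sum>u\<in>{0..<n}. \<phi> (W c ! nat u))"
      using unrank_W[OF c] by (intro sum.cong refl) (simp add: n_def o_def)
    also have "\<dots> = (\<Sum>w\<in>set (W c). \<phi> w)"
      using sum_nth_int[OF distinct_W[OF c], of \<phi>] length_W[OF c] by (simp add: n_def)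
    also have "real_of_int (Y s * X s c * m) = total_mass k r * weight s c"
      using n denom_pos by (simp add: total_mass_def weight_def m n_def[symmetric])
    finally show ?thesis by (simp add: n_def mult.assoc)
  qed
qed

text \<open>All properties of the distribution are read off here: probabilities with indicator
  functions for \<open>\<phi>\<close>, the expected cost with the cost of a word.\<close>

lemma expectation_improviser_dist:
  fixes \<phi> :: "nat list \<Rightarrow> real"
  shows "measure_pmf.expectation improviser_dist \<phi>
    = (\<Sum>s\<in>specs. \<Sum>c\<in>cells_of s. weight s c * (\<Sum>w\<in>set (W c). \<phi> w))"
proof -
  let ?F = "\<lambda>z. \<phi> (map nat (unrank k r (fst (fst z), (snd z mod fst (snd (fst z)), snd (snd (fst z))))))"
  have "(\<Sum>u\<in>{0..<total_mass k r}. \<phi> (map nat (draw k (r, u))))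
      = (\<Sum>u\<in>{0..<\<Sum>b\<leftarrow>blocks k r. snd b}. ?F (pick ((0, (0, 0)), (0, [])) (blocks k r) u))"
    unfolding sum_blocks_total by (simp add: draw_def Let_def)
  also have "\<dots> = (\<Sum>b\<leftarrow>blocks k r. \<Sum>u\<in>{0..<snd b}. ?F (fst b, u))"
    using block_props by (intro sum_pick) blast
  also have "\<dots> = (\<Sum>s\<in>specs. \<Sum>c\<in>cells_of s. \<Sum>u\<in>{0..<Y s * X s c * count_prod k r}. ?F (c, u))"
    by (subst sum_blocks) simp_all
  also have "\<dots> = (\<Sum>s\<in>specs. \<Sum>c\<in>cells_of s. total_mass k r * (weight s c * (\<Sum>w\<in>set (W c). \<phi> w)))"
    using sum_cell_draws by (intro sum.cong refl) simp
  finally have *: "(\<Sum>u\<in>{0..<total_mass k r}. \<phi> (map nat (draw k (r, u))))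
      = total_mass k r * (\<Sum>s\<in>specs. \<Sum>c\<in>cells_of s. weight s c * (\<Sum>w\<in>set (W c). \<phi> w))"
    by (simp add: sum_distrib_left)
  have "measure_pmf.expectation improviser_dist \<phi>
      = (\<Sum>u\<in>{0..<total_mass k r}. \<phi> (map nat (draw k (r, u)))) / real (card {0..<total_mass k r})"
    unfolding improviser_dist_def integral_map_pmf using total_mass_pos
    by (subst integral_pmf_of_set) auto
  then show ?thesis using * total_mass_pos by simp
qed

lemma prob_improviser_dist:
  "measure_pmf.prob improviser_dist A
    = (\<Sum>s\<in>specs. \<Sum>c\<in>cells_of s. weight s c * card (set (W c) \<inter> A))"
proof -
  have "measure_pmf.prob improviser_dist A = measure_pmf.expectation improviser_dist (indicat_real A)"
    by simp
  also have "\<dots> = (\<Sum>s\<in>specs. \<Sum>c\<in>cells_of s. weight s c * (\<Sum>w\<in>set (W c). indicat_real A w))"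
    by (rule expectation_improviser_dist)
  also have "\<dots> = (\<Sum>s\<in>specs. \<Sum>c\<in>cells_of s. weight s c * card (set (W c) \<inter> A))"
  proof -
    have "(\<Sum>w\<in>set (W c). indicat_real A w) = card (set (W c) \<inter> A)" for c
      by (simp add: indicator_def sum.If_cases)
    then show ?thesis by (simp only:)
  qed
  finally show ?thesis .
qed

lemma weight_count:
  assumes "s \<in> specs" "c \<in> cells_of s"
  shows "weight s c * real_of_int (fst (snd c)) = Y s * X s c / (Q * Q)"
  using X_zero[OF assms] by (simp add: weight_def)

lemma weighted_sum:
  assumes s: "s \<in> specs"
  shows "(\<Sum>c\<in>cells_of s. weight s c * card (set (W c))) = Y s / Q"
proof -
  have "(\<Sum>c\<in>cells_of s. weight s c * card (set (W c))) = (\<Sum>c\<in>cells_of s. Y s * X s c / (Q * Q))"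
  proof (intro sum.cong refl)
    fix c assume c: "c \<in> cells_of s"
    show "weight s c * card (set (W c)) = Y s * X s c / (Q * Q)"
      unfolding card_W[OF subsetD[OF cells_of_subset c]] by (rule weight_count[OF s c])
  qed
  also have "\<dots> = real_of_int (Y s * (\<Sum>c\<in>cells_of s. X s c)) / (Q * Q)"
    by (simp add: sum_distrib_left sum_divide_distrib)
  also have "\<dots> = Y s / Q" unfolding sum_X[OF s] using denom_pos by simp
  finally show ?thesis .
qed

lemma words_of_disjoint:
  assumes "s \<in> specs" "s' \<in> specs" "s \<noteq> s'" "c \<in> cells_of s" "c' \<in> cells_of s'"
  shows "set (W c) \<inter> set (W c') = {}"
proof (rule disjoint_W)
  show "c \<in> set (cells k r)" "c' \<in> set (cells k r)"
    using subsetD[OF cells_of_subset assms(4)] subsetD[OF cells_of_subset assms(5)] .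
  show "c \<noteq> c'" using assms cells_of_disjoint[OF assms(1-3)] by (metis disjoint_iff)
qed

lemma prob_words_of:
  assumes s: "s \<in> specs"
  shows "measure_pmf.prob improviser_dist (words_of s) = Y s / Q"
proof -
  have "measure_pmf.prob improviser_dist (words_of s)
      = (\<Sum>s'\<in>specs. if s' = s then \<Sum>c\<in>cells_of s. weight s c * card (set (W c)) else 0)"
    unfolding prob_improviser_dist
  proof (intro sum.cong refl)
    fix s' assume s': "s' \<in> specs"
    show "(\<Sum>c\<in>cells_of s'. weight s' c * card (set (W c) \<inter> words_of s))
        = (if s' = s then \<Sum>c\<in>cells_of s. weight s c * card (set (W c)) else 0)"
    proof (cases "s' = s")
      case True
      have "c \<in> cells_of s \<Longrightarrow> set (W c) \<inter> words_of s = set (W c)" for c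
        unfolding words_of_def by blast
      then show ?thesis using True by simp
    next
      case False
      have "set (W c) \<inter> words_of s = {}" if "c \<in> cells_of s'" for c
        unfolding words_of_def Int_UN_distrib using words_of_disjoint[OF s' s False that] by simp
      then show ?thesis using False by simp
    qed
  qed
  also have "\<dots> = Y s / Q" using s by (simp add: weighted_sum)
  finally show ?thesis .
qed

lemma pmf_improviser_dist:
  assumes s: "s \<in> specs" and c: "c \<in> cells_of s" and w: "w \<in> set (W c)"
  shows "pmf improviser_dist w = weight s c"
proof -
  have "measure_pmf.prob improviser_dist {w}
      = (\<Sum>s'\<in>specs. if s' = s then \<Sum>c'\<in>cells_of s. if c' = c then weight s c else 0 else 0)"
    unfolding prob_improviser_dist
  proof (intro sum.cong refl)
    fix s' assume s': "s' \<in> specs"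
    show "(\<Sum>c\<in>cells_of s'. weight s' c * card (set (W c) \<inter> {w}))
        = (if s' = s then \<Sum>c'\<in>cells_of s. if c' = c then weight s c else 0 else 0)"
    proof (cases "s' = s")
      case True
      have "weight s c' * card (set (W c') \<inter> {w}) = (if c' = c then weight s c else 0)" if "c' \<in> cells_of s" for c'
      proof (cases "c' = c")
        case False
        have "set (W c') \<inter> set (W c) = {}"
          using disjoint_W[OF subsetD[OF cells_of_subset that] subsetD[OF cells_of_subset c] False] .
        then have "set (W c') \<inter> {w} = {}" using w by blast
        then show ?thesis using False by simp
      qed (use w in simp)
      then show ?thesis using True by simp
    next
      case False
      have "set (W c') \<inter> {w} = {}" if "c' \<in> cells_of s'" for c'
        using words_of_disjoint[OF s' s False that c] w by blast
      then show ?thesis using False by simp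
    qed
  qed
  also have "\<dots> = weight s c" using s c by simp
  finally show ?thesis by (simp add: measure_pmf_single)
qed

lemma prob_all_words: "measure_pmf.prob improviser_dist all_words = 1"
proof -
  have "measure_pmf.prob improviser_dist all_words
      = (\<Sum>s\<in>specs. \<Sum>c\<in>cells_of s. weight s c * card (set (W c)))"
    unfolding prob_improviser_dist
  proof (intro sum.cong refl)
    fix s c assume "c \<in> cells_of s"
    then have "set (W c) \<subseteq> all_words"
      unfolding all_words_def using subsetD[OF cells_of_subset] by (intro UN_upper) simp
    then show "weight s c * card (set (W c) \<inter> all_words) = weight s c * card (set (W c))"
      by (simp add: Int_absorb2)
  qed
  also have "\<dots> = real_of_int (\<Sum>s\<in>specs. Y s) / Q" by (simp add: weighted_sum sum_divide_distrib)
  also have "\<dots> = 1" unfolding Y_spec(4)[OF top_le top_range] using denom_pos by simp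
  finally show ?thesis .
qed

lemma expectation_cost:
  assumes \<kappa>: "\<And>c w. c \<in> set (cells k r) \<Longrightarrow> w \<in> set (W c) \<Longrightarrow> \<kappa> w = real_of_int (state_cost r (fst c))"
  shows "measure_pmf.expectation improviser_dist \<kappa> = alloc_cost (top_alloc k r) / (Q * Q)"
proof -
  have "measure_pmf.expectation improviser_dist \<kappa> = (\<Sum>s\<in>specs. lab_cost s * Y s / (Q * Q))"
    unfolding expectation_improviser_dist
  proof (intro sum.cong refl)
    fix s assume s: "s \<in> specs"
    have "(\<Sum>c\<in>cells_of s. weight s c * sum \<kappa> (set (W c)))
        = (\<Sum>c\<in>cells_of s. Y s * (state_cost r (fst c) * X s c) / (Q * Q))"
    proof (intro sum.cong refl)
      fix c assume c: "c \<in> cells_of s"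
      have cc: "c \<in> set (cells k r)" using subsetD[OF cells_of_subset c] .
      have "sum \<kappa> (set (W c)) = fst (snd c) * state_cost r (fst c)"
        using \<kappa>[OF cc] card_W[OF cc] by simp
      then have "weight s c * sum \<kappa> (set (W c))
          = weight s c * real_of_int (fst (snd c)) * state_cost r (fst c)" by (simp only: mult.assoc of_int_mult)
      then show "weight s c * sum \<kappa> (set (W c)) = Y s * (state_cost r (fst c) * X s c) / (Q * Q)"
        unfolding weight_count[OF s c] by simp
    qed
    also have "\<dots> = Y s * real_of_int (\<Sum>c\<in>cells_of s. state_cost r (fst c) * X s c) / (Q * Q)"
      by (simp add: sum_distrib_left sum_divide_distrib)
    also have "\<dots> = lab_cost s * Y s / (Q * Q)"
      using alloc_cost_label[OF s] Y_zero[OF s] by (cases "ok s") simp_all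
    finally show "(\<Sum>c\<in>cells_of s. weight s c * sum \<kappa> (set (W c))) = lab_cost s * Y s / (Q * Q)" .
  qed
  also have "\<dots> = alloc_cost (top_alloc k r) / (Q * Q)"
    by (simp add: alloc_cost_top[OF top_le top_range] sum_divide_distrib)
  finally show ?thesis .
qed

end

text \<open>The bounds on words are stated multiplied by the probability of the label, which makes
  sense for labels of probability 0 too. The last clause says that every draw decodes to a list of
  nonnegative integers.\<close>

theorem check_sound:
  assumes "check k r"
  shows "measure_pmf.prob improviser_dist all_words = 1"
    "(\<And>c w. c \<in> set (cells k r) \<Longrightarrow> w \<in> set (W c) \<Longrightarrow> \<kappa> w = real_of_int (state_cost r (fst c))) \<Longrightarrow>
      measure_pmf.expectation improviser_dist \<kappa> \<le> fval (bound_part r)"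
    "s \<in> specs \<Longrightarrow> fval (lam_part r) \<le> measure_pmf.prob improviser_dist (words_of s)"
    "s \<in> specs \<Longrightarrow> measure_pmf.prob improviser_dist (words_of s) \<le> fval (rho_part r)"
    "s \<in> specs \<Longrightarrow> w \<in> words_of s \<Longrightarrow>
      fval (lo s) * measure_pmf.prob improviser_dist (words_of s) \<le> pmf improviser_dist w \<and>
      pmf improviser_dist w \<le> fval (hi s) * measure_pmf.prob improviser_dist (words_of s)"
    "0 \<le> u \<Longrightarrow> u < total_mass k r \<Longrightarrow> \<exists>w. draw k (r, u) = map int w"
proof -
  have top: "list_all (\<lambda>y. ilo y \<le> ihi y) (top_items k r)" "in_range (top_items k r) Q"
    and cost: "real_of_int (alloc_cost (top_alloc k r)) \<le> Q * Q * fval (bound_part r)"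
    using assms(1) unfolding check_def cost_bound_iff by simp_all
  have Q: "0 < real_of_int Q" using denom_pos by simp
  show "measure_pmf.prob improviser_dist all_words = 1" by (rule prob_all_words[OF top])
  show "0 \<le> u \<Longrightarrow> u < total_mass k r \<Longrightarrow> \<exists>w. draw k (r, u) = map int w" by (rule draw_word[OF top])
  show "measure_pmf.expectation improviser_dist \<kappa> \<le> fval (bound_part r)"
    if \<kappa>: "\<And>c w. c \<in> set (cells k r) \<Longrightarrow> w \<in> set (W c) \<Longrightarrow> \<kappa> w = real_of_int (state_cost r (fst c))"
  proof -
    have "measure_pmf.expectation improviser_dist \<kappa> = alloc_cost (top_alloc k r) / (Q * Q)"
      using \<kappa> by (rule expectation_cost[OF top])
    then show ?thesis using cost Q by (simp add: pos_divide_le_eq mult_ac)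
  qed
  assume s: "s \<in> specs"
  have P: "measure_pmf.prob improviser_dist (words_of s) = Y s / Q" by (rule prob_words_of[OF top s])
  have Y: "real_of_int (scaled r (lam_part r)) \<le> Y s" "Y s \<le> real_of_int (top_hi s)"
    using Y_spec(2,3)[OF top s] by simp_all
  have "real_of_int (top_hi s) \<le> Q * fval (rho_part r)"
    using lam_rho Q by (simp add: top_hi_def scaled_simps)
  then show "fval (lam_part r) \<le> measure_pmf.prob improviser_dist (words_of s)"
    "measure_pmf.prob improviser_dist (words_of s) \<le> fval (rho_part r)"
    unfolding P using Y Q by (simp_all add: scaled_simps field_simps)
  assume w: "w \<in> words_of s"
  then obtain c where c: "c \<in> cells_of s" "w \<in> set (W c)" unfolding words_of_def by (rule UN_E)
  have cc: "c \<in> set (cells k r)" using subsetD[OF cells_of_subset c(1)] .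
  have "0 < length (W c)" using c(2) by (metis length_pos_if_in_set)
  then have "0 < fst (snd c)" using length_W[OF cc] by linarith
  then have n: "0 < real_of_int (fst (snd c))" by simp
  show "fval (lo s) * measure_pmf.prob improviser_dist (words_of s) \<le> pmf improviser_dist w \<and>
      pmf improviser_dist w \<le> fval (hi s) * measure_pmf.prob improviser_dist (words_of s)"
  proof (cases "ok s")
    case False
    then show ?thesis unfolding P pmf_improviser_dist[OF top s c] using Y_zero[OF top s] by (simp add: weight_def)
  next
    case True
    have Y0: "0 \<le> real_of_int (Y s)" using Y_nonneg[OF top s] by simp
    have "real_of_int (scaled r (lo s) * fst (snd c)) \<le> X s c" "X s c \<le> real_of_int (scaled r (hi s) * fst (snd c))"
      using X_spec(2,3)[OF s True c(1)] by (simp_all only: of_int_le_iff)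
    then have "Q * fval (lo s) * real_of_int (fst (snd c)) \<le> X s c" "X s c \<le> Q * fval (hi s) * real_of_int (fst (snd c))"
      by (simp_all add: scaled_simps s)
    then have "fval (lo s) \<le> X s c / (Q * fst (snd c))" "X s c / (Q * fst (snd c)) \<le> fval (hi s)"
      using n Q by (simp_all add: field_simps)
    then have "Y s / Q * fval (lo s) \<le> Y s / Q * (X s c / (Q * fst (snd c)))"
      "Y s / Q * (X s c / (Q * fst (snd c))) \<le> Y s / Q * fval (hi s)"
      using Y0 Q by (intro mult_left_mono; simp)+
    moreover have "weight s c = Y s / Q * (X s c / (Q * fst (snd c)))" by (simp add: weight_def)
    ultimately show ?thesis unfolding P pmf_improviser_dist[OF top s c] by (simp add: mult.commute)
  qed
qed

text \<open>The probabilities of the labels under \<open>p\<close>, and its conditional masses on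
  the cells of a label, become real competitors in the two knapsack problems once scaled by
  \<open>Q\<close>; optimality among real allocations bounds the cost found by the algorithm. Only
  sums of \<open>p\<close> over cells enter, which is where averaging takes place.\<close>

theorem check_complete:
  fixes p \<kappa> :: "nat list \<Rightarrow> real"
  assumes nonneg: "\<And>w. 0 \<le> p w"
    and total: "(\<Sum>w\<in>all_words. p w) = 1"
    and \<kappa>: "\<And>c w. c \<in> set (cells k r) \<Longrightarrow> w \<in> set (W c) \<Longrightarrow> \<kappa> w = real_of_int (state_cost r (fst c))"
    and cost: "(\<Sum>w\<in>all_words. p w * \<kappa> w) \<le> fval (bound_part r)"
    and label: "\<And>s. s \<in> specs \<Longrightarrow> fval (lam_part r) \<le> (\<Sum>w\<in>words_of s. p w)"
      "\<And>s. s \<in> specs \<Longrightarrow> (\<Sum>w\<in>words_of s. p w) \<le> fval (rho_part r)"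
    and word: "\<And>s w. s \<in> specs \<Longrightarrow> 0 < (\<Sum>w\<in>words_of s. p w) \<Longrightarrow> w \<in> words_of s \<Longrightarrow>
        fval (lo s) * (\<Sum>w\<in>words_of s. p w) \<le> p w"
      "\<And>s w. s \<in> specs \<Longrightarrow> 0 < (\<Sum>w\<in>words_of s. p w) \<Longrightarrow> w \<in> words_of s \<Longrightarrow>
        p w \<le> fval (hi s) * (\<Sum>w\<in>words_of s. p w)"
  shows "check k r"
proof -
  define P where "P s = (\<Sum>w\<in>words_of s. p w)" for s
  have Q: "0 < real_of_int Q" using denom_pos by simp
  have P0: "0 \<le> P s" for s unfolding P_def using nonneg by (intro sum_nonneg) simp
  have sumP: "(\<Sum>s\<in>specs. P s) = 1" using total unfolding sum_all_words P_def .
  \<comment> \<open>Summing the bounds on the words over the whole class and cancelling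
    \<open>P s\<close> leaves the condition of \<open>ok_iff\<close>.\<close>
  have okP: "ok s" if s: "s \<in> specs" "0 < P s" for s
  proof -
    have "card (words_of s) * (fval (lo s) * P s) \<le> (\<Sum>w\<in>words_of s. p w)"
      using word(1)[OF s(1) s(2)[unfolded P_def]] unfolding P_def by (intro sum_bounded_below)
    moreover have "(\<Sum>w\<in>words_of s. p w) \<le> card (words_of s) * (fval (hi s) * P s)"
      using word(2)[OF s(1) s(2)[unfolded P_def]] unfolding P_def by (intro sum_bounded_above)
    ultimately have "(card (words_of s) * fval (lo s)) * P s \<le> 1 * P s"
      "1 * P s \<le> (card (words_of s) * fval (hi s)) * P s"
      unfolding P_def[symmetric] by (simp_all add: mult.assoc)
    then show ?thesis unfolding ok_iff[OF s(1)] using s(2) by (simp only: mult_le_cancel_right_pos)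
  qed
  have hi: "Q * P s \<le> top_hi s" if s: "s \<in> specs" for s
  proof (cases "ok s")
    case True
    then show ?thesis using label(2)[OF s] Q by (simp add: top_hi_def scaled_simps P_def)
  next
    case False
    \<comment> \<open>A label without an admissible conditional distribution is avoided by
      \<open>p\<close> as well, so the upper bound 0 imposed on it excludes no competitor.\<close>
    then have "P s = 0" using okP[OF s] P0[of s] by fastforce
    then show ?thesis using False by (simp add: top_hi_def)
  qed
  have lo: "scaled r (lam_part r) \<le> Q * P s" if s: "s \<in> specs" for s
    using label(1)[OF s] Q by (simp add: scaled_simps P_def)
  have top1: "list_all (\<lambda>y. ilo y \<le> ihi y) (top_items k r)"
  proof -
    have "scaled r (lam_part r) \<le> top_hi s" if "s \<in> specs" for s
      using lo[OF that] hi[OF that] by linarith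
    then show ?thesis unfolding top_items_eq list_all_iff by (simp add: top_item_simps)
  qed
  have sum_specs: "real_of_int (\<Sum>s\<leftarrow>specs_part r. f s) = (\<Sum>s\<in>specs. real_of_int (f s))" for f
    by (simp add: sum_list_distinct_conv_sum_set distinct_specs_part)
  have QP: "(\<Sum>s\<in>specs. Q * P s) = Q" using sumP by (simp flip: sum_distrib_left)
  have top2: "in_range (top_items k r) Q"
  proof -
    have "real_of_int (\<Sum>s\<leftarrow>specs_part r. scaled r (lam_part r)) \<le> real_of_int Q"
      unfolding sum_specs by (rule order_trans[OF sum_mono[OF lo] eq_refl[OF QP]])
    moreover have "real_of_int Q \<le> real_of_int (\<Sum>s\<leftarrow>specs_part r. top_hi s)"
      unfolding sum_specs by (rule order_trans[OF eq_refl[OF QP[symmetric]] sum_mono[OF hi]])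
    ultimately show ?thesis
      unfolding in_range_def top_items_eq map_map o_def top_item_simps of_int_le_iff by blast
  qed
  have lab: "lab_cost s * (Q * P s) \<le> Q * Q * (\<Sum>w\<in>words_of s. p w * \<kappa> w)" if s: "s \<in> specs" for s
  proof (cases "P s = 0")
    case True
    \<comment> \<open>Here \<open>lab_cost s\<close> may be meaningless, as the label need not be
      \<open>ok\<close>; both sides vanish.\<close>
    then have "p w = 0" if "w \<in> words_of s" for w
      using that nonneg unfolding P_def by (simp add: sum_nonneg_eq_0_iff)
    then show ?thesis using True by simp
  next
    case False
    then have Ps: "0 < P s" using P0[of s] by simp
    define z where "z c = Q * (\<Sum>w\<in>set (W c). p w) / P s" for c
    have bounds: "scaled r (lo s) * fst (snd c) \<le> z c" "z c \<le> scaled r (hi s) * fst (snd c)" if c: "c \<in> cells_of s" for c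
    proof -
      have cc: "c \<in> set (cells k r)" using subsetD[OF cells_of_subset c] .
      have sub: "set (W c) \<subseteq> words_of s" unfolding words_of_def using c by (rule UN_upper)
      have "card (set (W c)) * (fval (lo s) * P s) \<le> (\<Sum>w\<in>set (W c). p w)"
        using word(1)[OF s Ps[unfolded P_def] subsetD[OF sub]] unfolding P_def by (intro sum_bounded_below)
      then have "Q * (fval (lo s) * real_of_int (fst (snd c))) * P s \<le> Q * (\<Sum>w\<in>set (W c). p w)"
        unfolding card_W[OF cc] using Q by (simp add: mult_ac)
      then show "scaled r (lo s) * fst (snd c) \<le> z c"
        unfolding z_def using Ps by (simp add: scaled_simps s pos_le_divide_eq mult_ac)
      have "(\<Sum>w\<in>set (W c). p w) \<le> card (set (W c)) * (fval (hi s) * P s)"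
        using word(2)[OF s Ps[unfolded P_def] subsetD[OF sub]] unfolding P_def by (intro sum_bounded_above)
      then have "Q * (\<Sum>w\<in>set (W c). p w) \<le> Q * (fval (hi s) * real_of_int (fst (snd c))) * P s"
        unfolding card_W[OF cc] using Q by (simp add: mult_ac)
      then show "z c \<le> scaled r (hi s) * fst (snd c)"
        unfolding z_def using Ps by (simp add: scaled_simps s pos_divide_le_eq mult_ac)
    qed
    have sumz: "(\<Sum>c\<in>cells_of s. z c) = Q"
    proof -
      have "(\<Sum>c\<in>cells_of s. z c) = Q * (\<Sum>w\<in>words_of s. p w) / P s"
        unfolding sum_words_of by (simp add: z_def sum_distrib_left sum_divide_distrib)
      then show ?thesis using Ps by (simp add: P_def)
    qed
    have "real_of_int (lab_cost s) \<le> (\<Sum>c\<in>cells_of s. state_cost r (fst c) * z c)"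
      unfolding alloc_cost_label[OF s okP[OF s Ps]]
      by (rule X_spec(5)[OF s okP[OF s Ps] bounds sumz])
    also have "\<dots> = (\<Sum>c\<in>cells_of s. Q / P s * (\<Sum>w\<in>set (W c). p w * \<kappa> w))"
    proof (intro sum.cong refl)
      fix c assume c: "c \<in> cells_of s"
      have cc: "c \<in> set (cells k r)" using subsetD[OF cells_of_subset c] .
      have "(\<Sum>w\<in>set (W c). p w * \<kappa> w) = (\<Sum>w\<in>set (W c). p w) * state_cost r (fst c)"
        using \<kappa>[OF cc] by (simp add: sum_distrib_right)
      then show "state_cost r (fst c) * z c = Q / P s * (\<Sum>w\<in>set (W c). p w * \<kappa> w)"
        by (simp add: z_def)
    qed
    also have "\<dots> = Q / P s * (\<Sum>w\<in>words_of s. p w * \<kappa> w)"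
      unfolding sum_words_of by (simp add: sum_distrib_left)
    finally have "lab_cost s * (Q * P s) \<le> (Q / P s * (\<Sum>w\<in>words_of s. p w * \<kappa> w)) * (Q * P s)"
      using Q Ps by (intro mult_right_mono) simp_all
    also have "\<dots> = Q * Q * (\<Sum>w\<in>words_of s. p w * \<kappa> w)" using Ps by simp
    finally show ?thesis .
  qed
  have "real_of_int (alloc_cost (top_alloc k r)) \<le> (\<Sum>s\<in>specs. lab_cost s * (Q * P s))"
    unfolding alloc_cost_top[OF top1 top2] using lo hi QP by (rule Y_spec(5)[OF top1 top2])
  also have "\<dots> \<le> (\<Sum>s\<in>specs. Q * Q * (\<Sum>w\<in>words_of s. p w * \<kappa> w))"
    using lab by (rule sum_mono)
  also have "\<dots> = Q * Q * (\<Sum>w\<in>all_words. p w * \<kappa> w)"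
    unfolding sum_all_words by (simp add: sum_distrib_left)
  also have "\<dots> \<le> Q * Q * fval (bound_part r)" using cost Q by (intro mult_left_mono) simp_all
  finally show ?thesis using top1 top2 unfolding check_def cost_bound_iff by blast
qed

end

section \<open>Rejection sampling\<close>

lemma nn_integral_measure_spmf_bind_pmf:
  "(\<integral>\<^sup>+ x. g x \<partial>measure_spmf (bind_pmf G f)) = (\<integral>\<^sup>+ i. (\<integral>\<^sup>+ x. g x \<partial>measure_spmf (f i)) \<partial>measure_pmf G)"
  unfolding measure_spmf_bind_pmf
  by (subst nn_integral_bind[where B = "count_space UNIV"]) (auto simp: space_subprob_algebra)

lemma expectation_if:
  "measure_pmf.expectation G (\<lambda>i. if A i then a else b :: real)
    = a * measure_pmf.prob G {i. A i} + b * (1 - measure_pmf.prob G {i. A i})"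
proof -
  have "(\<lambda>i. if A i then a else b) = (\<lambda>i. b + (a - b) * indicat_real {i. A i} i)"
    by (auto simp: indicator_def)
  then have "measure_pmf.expectation G (\<lambda>i. if A i then a else b)
      = measure_pmf.expectation G (\<lambda>i. b + (a - b) * indicat_real {i. A i} i)" by simp
  also have "\<dots> = b + (a - b) * measure_pmf.prob G {i. A i}"
  proof -
    have "integrable (measure_pmf G) (indicat_real {i. A i})"
      by (rule measure_pmf.integrable_const_bound[where B = 1]) (auto simp: indicator_def)
    then show ?thesis by simp
  qed
  finally show ?thesis by (simp add: algebra_simps)
qed

text \<open>\<open>G\<close> is one round of a loop and \<open>A\<close> its acceptance test;
  \<open>t1\<close> is the time of an accepting round and \<open>t2\<close> that of a rejected one,
  after which the loop starts afresh. The loop is used only through this fixed-point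
  equation.\<close>

context
  fixes p :: "('v \<times> nat) spmf" and G :: "'i pmf" and A :: "'i \<Rightarrow> bool" and h :: "'i \<Rightarrow> 'v"
    and t1 t2 :: "'i \<Rightarrow> nat" and T :: nat
  assumes p_eq: "p = bind_pmf G (\<lambda>i. if A i then return_spmf (h i, t1 i)
      else map_spmf (\<lambda>(w, t). (w, t + t2 i)) p)"
    and accept: "1 / 2 \<le> measure_pmf.prob G {i. A i}"
    and time: "\<And>i. i \<in> set_pmf G \<Longrightarrow> t1 i \<le> T" "\<And>i. i \<in> set_pmf G \<Longrightarrow> t2 i \<le> T"
begin

text \<open>With acceptance probability a, the weight satisfies w = a + (1 - a) w, which forces w =
  1 as a is positive.\<close>

lemma rejection_lossless: "lossless_spmf p"
proof -
  let ?a = "measure_pmf.prob G {i. A i}"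
  have "weight_spmf p = weight_spmf (bind_spmf (spmf_of_pmf G) (\<lambda>i. if A i then return_spmf (h i, t1 i)
      else map_spmf (\<lambda>(w, t). (w, t + t2 i)) p))" using p_eq by simp
  also have "\<dots> = measure_pmf.expectation G (\<lambda>i. if A i then 1 else weight_spmf p)"
    unfolding weight_bind_spmf by (auto intro!: Bochner_Integration.integral_cong)
  also have "\<dots> = ?a + weight_spmf p * (1 - ?a)" by (simp add: expectation_if)
  finally have "?a * weight_spmf p = ?a * 1" by (simp add: algebra_simps)
  then show ?thesis using accept unfolding lossless_spmf_def by (subst (asm) mult_left_cancel) auto
qed

text \<open>\<open>R\<close> is the law of \<open>h\<close> given acceptance, stated without
  division. Every point mass of the output solves a linear equation like that of the weight.\<close>

lemma rejection_output:
  assumes R: "\<And>v. pmf R v * measure_pmf.prob G {i. A i} = measure_pmf.prob G {i. A i \<and> h i = v}"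
  shows "map_spmf fst p = spmf_of_pmf R"
proof (rule spmf_eqI)
  fix v
  let ?a = "measure_pmf.prob G {i. A i}"
  let ?q = "map_spmf fst p"
  have "?q = map_spmf fst (bind_spmf (spmf_of_pmf G) (\<lambda>i. if A i then return_spmf (h i, t1 i)
      else map_spmf (\<lambda>(w, t). (w, t + t2 i)) p))" using p_eq by simp
  also have "\<dots> = bind_spmf (spmf_of_pmf G) (\<lambda>i. if A i then return_spmf (h i) else ?q)"
    unfolding map_spmf_bind_spmf by (intro bind_spmf_cong) (auto simp: spmf.map_comp o_def split_def)
  finally have "spmf ?q v = spmf (bind_spmf (spmf_of_pmf G) (\<lambda>i. if A i then return_spmf (h i) else ?q)) v"
    by (rule arg_cong)
  also have "\<dots> = measure_pmf.expectation G (\<lambda>i. spmf (if A i then return_spmf (h i) else ?q) v)"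
    by (simp add: spmf_bind del: bind_spmf_of_pmf)
  also have "\<dots> = measure_pmf.expectation G (\<lambda>i. indicat_real {i. A i \<and> h i = v} i + (if A i then 0 else spmf ?q v))"
    by (intro Bochner_Integration.integral_cong) (auto simp: indicator_def)
  also have "\<dots> = measure_pmf.prob G {i. A i \<and> h i = v} + spmf ?q v * (1 - ?a)"
    by (subst Bochner_Integration.integral_add)
      (auto intro!: measure_pmf.integrable_const_bound[where B = 1] simp: indicator_def expectation_if pmf_le_1)
  finally have "?a * spmf ?q v = ?a * pmf R v" using R[of v] by (simp add: algebra_simps)
  then show "spmf ?q v = spmf (spmf_of_pmf R) v" using accept by simp
qed

text \<open>The fixed-point equation gives E \<le> T + E / 2 for the expected time, but this implies
  E \<le> 2 T only if E is known to be finite. So the time is truncated at \<open>n\<close>, where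
  finiteness is evident, and monotone convergence removes the truncation.\<close>

lemma rejection_time: "(\<integral>\<^sup>+ (v, t). of_nat t \<partial>measure_spmf p) \<le> of_nat (2 * T)"
proof -
  let ?a = "measure_pmf.prob G {i. A i}"
  define E where "E n = (\<integral>\<^sup>+ x. of_nat (min (snd x) n) \<partial>measure_spmf p)" for n
  have E: "E n \<le> of_nat (2 * T)" for n
  proof -
    have bound: "(\<integral>\<^sup>+ x. of_nat c + f x \<partial>measure_spmf q) \<le> of_nat c + (\<integral>\<^sup>+ x. f x \<partial>measure_spmf q)" for c :: nat and f and q :: "('v \<times> nat) spmf"
    proof -
      have "(\<integral>\<^sup>+ x. of_nat c + f x \<partial>measure_spmf q) = (\<integral>\<^sup>+ x. of_nat c \<partial>measure_spmf q) + (\<integral>\<^sup>+ x. f x \<partial>measure_spmf q)"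
        by (rule nn_integral_add) auto
      also have "(\<integral>\<^sup>+ x. of_nat c \<partial>measure_spmf q) \<le> of_nat c * 1"
        by (simp add: measure_spmf.emeasure_space_le_1 mult_left_mono del: mult_1_right)
      finally show ?thesis by (simp add: add_mono)
    qed
    have fin: "E n \<le> of_nat n"
    proof -
      have "E n \<le> (\<integral>\<^sup>+ x. of_nat n + 0 \<partial>measure_spmf p)"
        unfolding E_def by (intro nn_integral_mono) simp
      also have "\<dots> \<le> of_nat n" using bound[where c = n and f = "\<lambda>_. 0" and q = p] by simp
      finally show ?thesis .
    qed
    then obtain e where e: "E n = ennreal e" "0 \<le> e"
      by (metis ennreal_cases ennreal_of_nat_eq_real_of_nat ennreal_neq_top top.extremum_unique)
    have "E n = (\<integral>\<^sup>+ i. (\<integral>\<^sup>+ x. of_nat (min (snd x) n) \<partial>measure_spmf (if A i then return_spmf (h i, t1 i)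
      else map_spmf (\<lambda>(w, t). (w, t + t2 i)) p)) \<partial>measure_pmf G)"
      unfolding E_def by (subst p_eq) (rule nn_integral_measure_spmf_bind_pmf)
    also have "\<dots> \<le> (\<integral>\<^sup>+ i. of_nat T + ennreal (if A i then 0 else e) \<partial>measure_pmf G)"
    proof (rule nn_integral_mono_AE, rule AE_pmfI)
      fix i assume i: "i \<in> set_pmf G"
      show "(\<integral>\<^sup>+ x. of_nat (min (snd x) n) \<partial>measure_spmf (if A i then return_spmf (h i, t1 i)
          else map_spmf (\<lambda>(w, t). (w, t + t2 i)) p)) \<le> of_nat T + ennreal (if A i then 0 else e)"
      proof (cases "A i")
        case True
        then show ?thesis using time(1)[OF i]
          by (simp add: nn_integral_measure_spmf_bind_pmf measure_spmf_return_spmf nn_integral_return min.coboundedI1)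
      next
        case False
        have "(\<integral>\<^sup>+ x. of_nat (min (snd x) n) \<partial>measure_spmf (map_spmf (\<lambda>(w, t). (w, t + t2 i)) p))
            = (\<integral>\<^sup>+ x. of_nat (min (snd x + t2 i) n) \<partial>measure_spmf p)"
          by (simp add: o_def split_def)
        also have "\<dots> \<le> (\<integral>\<^sup>+ x. of_nat T + of_nat (min (snd x) n) \<partial>measure_spmf p)"
        proof (rule nn_integral_mono)
          fix x :: "'v \<times> nat"
          have "min (snd x + t2 i) n \<le> T + min (snd x) n" using time(2)[OF i] by simp
          then show "(of_nat (min (snd x + t2 i) n) :: ennreal) \<le> of_nat T + of_nat (min (snd x) n)"
            by (metis of_nat_add of_nat_mono)
        qed
        also have "\<dots> \<le> of_nat T + E n" unfolding E_def by (rule bound)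
        finally show ?thesis using False e by simp
      qed
    qed
    also have "\<dots> = of_nat T + (\<integral>\<^sup>+ i. ennreal (if A i then 0 else e) \<partial>measure_pmf G)"
      by (subst nn_integral_add) auto
    also have "(\<integral>\<^sup>+ i. ennreal (if A i then 0 else e) \<partial>measure_pmf G)
        = ennreal (measure_pmf.expectation G (\<lambda>i. if A i then 0 else e))"
      by (rule nn_integral_eq_integral) (auto intro!: measure_pmf.integrable_const_bound[where B = e] simp: e)
    also have "measure_pmf.expectation G (\<lambda>i. if A i then 0 else e) = e * (1 - ?a)" by (simp add: expectation_if)
    also have "of_nat T + ennreal (e * (1 - ?a)) = ennreal (T + e * (1 - ?a))"
      using e(2) measure_pmf.prob_le_1[of G "{i. A i}"] by (simp add: ennreal_of_nat_eq_real_of_nat ennreal_plus)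
    finally have "ennreal e \<le> ennreal (T + e * (1 - ?a))" unfolding e(1) .
    moreover have "0 \<le> T + e * (1 - ?a)"
      using e(2) measure_pmf.prob_le_1[of G "{i. A i}"] by simp
    ultimately have "e \<le> T + e * (1 - ?a)" by (simp only: ennreal_le_iff)
    moreover have "e * (1 - ?a) \<le> e * (1 / 2)" using accept e(2) by (intro mult_left_mono) auto
    ultimately have "e \<le> real (2 * T)" by simp
    then show ?thesis unfolding e(1) by (simp add: ennreal_of_nat_eq_real_of_nat ennreal_leI del: of_nat_mult)
  qed
  have "(\<integral>\<^sup>+ (v, t). of_nat t \<partial>measure_spmf p) = (\<integral>\<^sup>+ x. (SUP n. of_nat (min (snd x) n)) \<partial>measure_spmf p)"
  proof (rule nn_integral_cong)
    fix x :: "'v \<times> nat"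
    have "(SUP n. of_nat (min (snd x) n) :: ennreal) = of_nat (snd x)"
      by (rule antisym) (auto intro!: SUP_least SUP_upper2[of "snd x"])
    then show "(case x of (v, t) \<Rightarrow> of_nat t) = (SUP n. of_nat (min (snd x) n) :: ennreal)" by (simp add: split_def)
  qed
  also have "\<dots> = (SUP n. E n)"
    unfolding E_def by (rule nn_integral_monotone_convergence_SUP) (auto simp: incseq_def le_fun_def min.coboundedI2 intro!: of_nat_mono)
  also have "\<dots> \<le> of_nat (2 * T)" using E by (rule SUP_least)
  finally show ?thesis .
qed

end


section \<open>A uniform sampler\<close>

definition gen_test :: expr where
  "gen_test = Bin_Op Less (Un_Op Fst (Un_Op Snd (Var 0))) (Un_Op Fst (Var 0))"

text \<open>From (M, (B, a)) to (M, (2 B, 2 a + e)): one more bit is appended. The bit is a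
  parameter so that \<open>Flip\<close> can be traded for a constant in the analysis.\<close>

definition gen_arg :: "expr \<Rightarrow> expr" where
  "gen_arg e = Bin_Op Mk_Branch (Un_Op Fst (Var 0)) (Bin_Op Mk_Branch
       (Bin_Op Add (Un_Op Fst (Un_Op Snd (Var 0))) (Un_Op Fst (Un_Op Snd (Var 0))))
       (Bin_Op Add (Bin_Op Add (Un_Op Snd (Un_Op Snd (Var 0))) (Un_Op Snd (Un_Op Snd (Var 0)))) e))"

text \<open>
  Called with \<open>(M, (1, 0))\<close>, the function yields a random number of \<open>j\<close> bits, where \<open>j\<close> is minimal
  with \<open>M \<le> 2 ^ j\<close>.
\<close>

definition gen_body :: "nat \<Rightarrow> expr" where
  "gen_body f = Cond gen_test (Call f (gen_arg Flip)) (Un_Op Snd (Un_Op Snd (Var 0)))"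

text \<open>A dyadic interval splits into two halves of equal length, between which the next bit
  decides.\<close>

lemma uniform_halves:
  fixes a :: int
  shows "bind_pmf (pmf_of_set UNIV) (\<lambda>b. pmf_of_set {(2 * a + of_bool b) * 2 ^ j..<(2 * a + of_bool b + 1) * 2 ^ j})
    = pmf_of_set {a * 2 ^ Suc j..<(a + 1) * 2 ^ Suc j}"
proof (rule pmf_eqI)
  fix x
  have ne: "{c * 2 ^ j..<(c + 1) * 2 ^ j} \<noteq> {}" for c :: int and j :: nat
    by (simp add: algebra_simps)
  have card: "card {c * 2 ^ j..<(c + 1) * 2 ^ j} = 2 ^ j" for c :: int and j :: nat
    by (simp add: algebra_simps nat_power_eq)
  have pm: "pmf (pmf_of_set {c * 2 ^ j..<(c + 1) * 2 ^ j}) x = indicat_real {c * 2 ^ j..<(c + 1) * 2 ^ j} x / 2 ^ j"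
    for c :: int and j :: nat
    using card[of c j] by (subst pmf_of_set[OF ne]) auto
  have "pmf (bind_pmf (pmf_of_set UNIV) (\<lambda>b. pmf_of_set {(2 * a + of_bool b) * 2 ^ j..<(2 * a + of_bool b + 1) * 2 ^ j})) x
    = (indicat_real {(2 * a + 1) * 2 ^ j..<(2 * a + 1 + 1) * 2 ^ j} x / 2 ^ j
       + indicat_real {(2 * a + 0) * 2 ^ j..<(2 * a + 0 + 1) * 2 ^ j} x / 2 ^ j) / 2"
    unfolding pmf_bind by (subst integral_pmf_of_set) (auto simp: UNIV_bool pm[of "2 * a + of_bool _"] pm)
  also have "\<dots> = indicat_real {a * 2 ^ Suc j..<(a + 1) * 2 ^ Suc j} x / 2 ^ Suc j"
    by (auto simp: indicator_def algebra_simps)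
  also have "\<dots> = pmf (pmf_of_set {a * 2 ^ Suc j..<(a + 1) * 2 ^ Suc j}) x" by (simp only: pm)
  finally show "pmf (bind_pmf (pmf_of_set UNIV) (\<lambda>b. pmf_of_set {(2 * a + of_bool b) * 2 ^ j..<(2 * a + of_bool b + 1) * 2 ^ j})) x
    = pmf (pmf_of_set {a * 2 ^ Suc j..<(a + 1) * 2 ^ Suc j}) x" .
qed

lemma gen_arg_eval:
  "\<exists>t. eval_expr P (gen_arg (Const (Num c))) [encode (M :: int, (B :: int, a :: int))]
      = return_spmf (encode (M, (B + B, a + a + c)), t) \<and>
    t \<le> 8 * vsize (Num M) + 12 * vsize (Num B) + 12 * vsize (Num a) + 4 * vsize (Num (B + B))
      + 4 * vsize (Num (a + a)) + vsize (Num c) + 4 * vsize (Num (a + a + c)) + 100"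
  by (simp add: gen_arg_def eval_simps del: vsize.simps(1))

text \<open>\<open>j\<close> counts the bits still to be drawn, and the last hypothesis makes it
  minimal; the result is \<open>a\<close> followed by these bits. \<open>B < 2 * M\<close> ties all
  sizes to that of \<open>M\<close>, and the time bound holds for every outcome.\<close>

lemma gen_eval:
  fixes M B a :: int
  assumes P: "body P f = gen_body f"
    and "0 < M" "0 \<le> a" "a < B" "B < 2 * M" "M \<le> 2 ^ j * B" "j = 0 \<or> 2 ^ (j - 1) * B < M"
  shows "\<exists>G. eval_expr P (gen_body f) [encode (M, (B, a))] = spmf_of_pmf G \<and>
     map_pmf fst G = map_pmf Num (pmf_of_set {a * 2 ^ j..<(a + 1) * 2 ^ j}) \<and>
     (\<forall>x\<in>set_pmf G. snd x \<le> (j + 1) * (100 * sz M + 500))"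
  using assms(2-)
proof (induction j arbitrary: B a)
  case 0
  have s: "sz B \<le> Suc (Suc (sz M))" "sz a \<le> Suc (Suc (sz M))"
  proof -
    have "\<bar>B\<bar> < 2 ^ Suc (sz M)" "\<bar>a\<bar> < 2 ^ Suc (sz M)"
      using 0 abs_less_power_sz[of M] by auto
    from this[THEN sz_le_of_abs_less]
    show "sz B \<le> Suc (Suc (sz M))" "sz a \<le> Suc (Suc (sz M))" .
  qed
  obtain t where t: "eval_expr P (gen_body f) [encode (M, (B, a))] = return_spmf (Num a, t)" "t \<le> 100 * sz M + 500"
    using 0 s by (auto simp: gen_body_def gen_test_def eval_simps floorlog_def)
  have "{a..<a + 1} = {a}" by auto
  then show ?case using t
    by (intro exI[of _ "return_pmf (Num a, t)"]) (auto simp: pmf_of_set_singleton)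
next
  case (Suc j)
  have s: "sz B \<le> Suc (Suc (sz M))" "sz a \<le> Suc (Suc (sz M))"
  proof -
    have "\<bar>B\<bar> < 2 ^ Suc (sz M)" "\<bar>a\<bar> < 2 ^ Suc (sz M)"
      using Suc.prems abs_less_power_sz[of M] by auto
    from this[THEN sz_le_of_abs_less]
    show "sz B \<le> Suc (Suc (sz M))" "sz a \<le> Suc (Suc (sz M))" .
  qed
  have BM: "B < M"
  proof -
    have "1 * B \<le> 2 ^ j * B" using Suc.prems by (intro mult_right_mono) simp_all
    moreover have "2 ^ j * B < M" using Suc.prems by simp
    ultimately show ?thesis by linarith
  qed
  have "\<forall>b. \<exists>G. eval_expr P (gen_body f) [encode (M, (2 * B, 2 * a + of_bool b))] = spmf_of_pmf G \<and>
     map_pmf fst G = map_pmf Num (pmf_of_set {(2 * a + of_bool b) * 2 ^ j..<(2 * a + of_bool b + 1) * 2 ^ j}) \<and>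
     (\<forall>x\<in>set_pmf G. snd x \<le> (j + 1) * (100 * sz M + 500))"
  proof (intro allI Suc.IH)
    fix b
    show "0 < M" "0 \<le> 2 * a + of_bool b" "2 * B < 2 * M" using Suc.prems BM by simp_all
    show "2 * a + of_bool b < 2 * B" using Suc.prems by (cases b) simp_all
    show "M \<le> 2 ^ j * (2 * B)" using Suc.prems by (simp add: mult_ac)
    show "j = 0 \<or> 2 ^ (j - 1) * (2 * B) < M" using Suc.prems by (cases j) (simp_all add: mult_ac)
  qed
  then obtain G where G: "\<And>b. eval_expr P (gen_body f) [encode (M, (2 * B, 2 * a + of_bool b))] = spmf_of_pmf (G b)"
     "\<And>b. map_pmf fst (G b) = map_pmf Num (pmf_of_set {(2 * a + of_bool b) * 2 ^ j..<(2 * a + of_bool b + 1) * 2 ^ j})"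
     "\<And>b x. x \<in> set_pmf (G b) \<Longrightarrow> snd x \<le> (j + 1) * (100 * sz M + 500)"
    by metis
  define \<rho> where "\<rho> = [encode (M, (B, a))]"
  let ?v = "\<lambda>b. encode (M, (2 * B, 2 * a + of_bool b))"
  obtain ta where ta: "eval_expr P gen_test \<rho> = return_spmf (Num 1, ta)" "ta \<le> 40 * sz M + 200"
    using BM s by (auto simp: \<rho>_def gen_test_def eval_simps floorlog_def)
  \<comment> \<open>The coin is the only randomness in the argument, so it can be tossed beforehand;
    what remains is deterministic and covered by \<open>gen_arg_eval\<close>.\<close>
  have flip: "eval_expr P (gen_arg Flip) \<rho>
      = bind_spmf coin_spmf (\<lambda>b. eval_expr P (gen_arg (Const (Num (of_bool b)))) \<rho>)"
    by (simp add: \<rho>_def gen_arg_def eval_simps eval_Flip map_spmf_conv_bind_spmf)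
  have s2: "sz (B + B) \<le> Suc (Suc (Suc (sz M)))" "sz (a + a) \<le> Suc (Suc (Suc (sz M)))"
    "sz (a + a + of_bool b) \<le> Suc (Suc (Suc (sz M)))" for b
  proof -
    have M: "M < 2 ^ sz M" using abs_less_power_sz[of M] by simp
    have "\<bar>B + B\<bar> < 2 ^ Suc (Suc (sz M))" "\<bar>a + a\<bar> < 2 ^ Suc (Suc (sz M))"
      "\<bar>a + a + of_bool b\<bar> < 2 ^ Suc (Suc (sz M))"
      unfolding power_Suc using Suc.prems M BM by (cases b; simp)+
    from this[THEN sz_le_of_abs_less]
    show "sz (B + B) \<le> Suc (Suc (Suc (sz M)))" "sz (a + a) \<le> Suc (Suc (Suc (sz M)))"
      "sz (a + a + of_bool b) \<le> Suc (Suc (Suc (sz M)))" .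
  qed
  have "\<forall>b. \<exists>t. eval_expr P (gen_arg (Const (Num (of_bool b)))) \<rho> = return_spmf (?v b, t) \<and> t \<le> 60 * sz M + 250"
  proof
    fix b
    show "\<exists>t. eval_expr P (gen_arg (Const (Num (of_bool b)))) \<rho> = return_spmf (?v b, t) \<and> t \<le> 60 * sz M + 250"
    proof -
      obtain t where t: "eval_expr P (gen_arg (Const (Num (of_bool b)))) [encode (M, (B, a))]
          = return_spmf (encode (M, (B + B, a + a + of_bool b)), t)"
        "t \<le> 8 * vsize (Num M) + 12 * vsize (Num B) + 12 * vsize (Num a) + 4 * vsize (Num (B + B))
          + 4 * vsize (Num (a + a)) + vsize (Num (of_bool b)) + 4 * vsize (Num (a + a + of_bool b)) + 100"
        using gen_arg_eval[of P "of_bool b" M B a] by (elim exE conjE)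
      have "t \<le> 60 * sz M + 250"
        using t(2) s s2(1,2) s2(3)[of b] sz_bool[of b] unfolding encode_simps by linarith
      then show ?thesis using t(1) unfolding \<rho>_def mult_2 by (intro exI[of _ t] conjI)
    qed
  qed
  then obtain tb where tb: "\<And>b. eval_expr P (gen_arg (Const (Num (of_bool b)))) \<rho> = return_spmf (?v b, tb b)"
    "\<And>b. tb b \<le> 60 * sz M + 250" by metis
  define c where "c b = ta + tb b + 2" for b
  have c: "eval_expr P (gen_body f) [encode (M, (B, a))]
      = bind_spmf coin_spmf (\<lambda>b. bind_spmf (eval_expr P (gen_body f) [?v b]) (\<lambda>(v, t). return_spmf (v, t + c b)))"
    unfolding \<rho>_def[symmetric]
    by (subst (1) gen_body_def)
      (simp add: eval_Cond eval_Call ta flip tb P split_def c_def add_ac del: encode_simps)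
  have c_le: "c b \<le> 100 * sz M + 500" for b using ta(2) tb(2)[of b] by (simp add: c_def del: encode_simps vsize.simps)
  define G' where "G' = bind_pmf (pmf_of_set UNIV) (\<lambda>b. map_pmf (\<lambda>(v, t). (v, t + c b)) (G b))"
  show ?case
  proof (intro exI[of _ G'] conjI ballI)
    show "eval_expr P (gen_body f) [encode (M, (B, a))] = spmf_of_pmf G'"
      unfolding c G(1) G'_def
      by (simp add: spmf_of_pmf_bind spmf_of_pmf_pmf_of_set[symmetric] map_pmf_def split_def
          del: spmf_of_pmf_pmf_of_set)
    have "map_pmf fst G' = bind_pmf (pmf_of_set UNIV) (\<lambda>b. map_pmf fst (G b))"
      by (simp add: G'_def map_bind_pmf pmf.map_comp o_def split_def)
    also have "\<dots> = map_pmf Num (bind_pmf (pmf_of_set UNIV)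
        (\<lambda>b. pmf_of_set {(2 * a + of_bool b) * 2 ^ j..<(2 * a + of_bool b + 1) * 2 ^ j}))"
      by (simp only: G(2) map_bind_pmf)
    finally show "map_pmf fst G' = map_pmf Num (pmf_of_set {a * 2 ^ Suc j..<(a + 1) * 2 ^ Suc j})"
      by (simp only: uniform_halves)
    fix x assume "x \<in> set_pmf G'"
    then obtain b y where y: "y \<in> set_pmf (G b)" "snd x = snd y + c b"
      unfolding G'_def by (auto simp: split_def)
    show "snd x \<le> (Suc j + 1) * (100 * sz M + 500)"
      using G(3)[OF y(1)] c_le[of b] y(2) by simp
  qed
qed

text \<open>At index 0 is the drawn integer, at index 1 the pair of the input and the exclusive
  upper bound. Rejection calls function 1, the loop, with the same pair.\<close>

definition loop_branch :: "expr \<Rightarrow> expr" where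
  "loop_branch eD = Cond (Bin_Op Less (Var 0) (Un_Op Snd (Var 1)))
     (Bind (Bin_Op Mk_Branch (Un_Op Fst (Var 1)) (Var 0)) eD) (Call 1 (Var 1))"

definition loop_body :: "expr \<Rightarrow> expr" where
  "loop_body eD = Bind (Call 2 (Bin_Op Mk_Branch (Un_Op Snd (Var 0))
     (Const (Branch (Num 1) (Num 0))))) (loop_branch eD)"

text \<open>The bound is computed by \<open>eM\<close> once, before the loop. Three functions
  precede \<open>Q\<close>, whence the position 3 in \<open>sampler_core\<close>.\<close>

definition sampler_program :: "expr \<Rightarrow> expr \<Rightarrow> program \<Rightarrow> val \<Rightarrow> program" where
  "sampler_program eM eD Q v = Bind (Const v) (Call 1 (Bin_Op Mk_Branch (Var 0) eM))
     # loop_body eD # gen_body 2 # Q"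

lemma lookup_1: "lookup (u # v # \<rho>) 1 = v"
  by simp

lemma floorlog_0_1 [simp]: "floorlog 2 0 = 0" "floorlog 2 (Suc 0) = 1"
  by (simp_all add: floorlog_def)

text \<open>The number j of bits is minimal with \<open>f x\<close> \<le> 2^j, hence 2^j < 2
  \<open>f x\<close>: a round is accepted with probability above 1/2, and every drawn integer lies
  in the range in which \<open>W\<close> is a bound.\<close>

lemma sampler_core:
  fixes f :: "'a::enc \<Rightarrow> int" and g :: "'a \<times> int \<Rightarrow> 'b::enc"
  assumes f: "implements 3 Q eM f Tf" and g: "implements 3 Q eD g Tg"
    and pos: "0 < f x" and W: "\<And>u. 0 \<le> u \<Longrightarrow> u < 2 * f x \<Longrightarrow> Tg (x, u) \<le> W"
  defines "P \<equiv> sampler_program eM eD Q (encode x)"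
  shows "output_dist P (Num 0)
      = spmf_of_pmf (map_pmf (\<lambda>u. encode (g (x, u))) (pmf_of_set {0..<f x}))" (is ?out)
    and "expected_time P (Num 0) \<le> of_nat (2 * ((sz (f x) + 1) * (100 * sz (f x) + 500)
      + 100 * sz x + 200 * sz (f x) + 1000 + W) + (100 * sz x + 100 * sz (f x) + 1000 + Tf x))" (is ?time)
proof -
  let ?M = "f x"
  let ?arg = "encode (x, ?M)"
  define A where "A = [Bind (Const (encode x)) (Call 1 (Bin_Op Mk_Branch (Var 0) eM)), loop_body eD, gen_body 2]"
  have P: "P = A @ Q @ []" and lA: "length A = 3" by (simp_all add: P_def A_def sampler_program_def)
  have b: "body P 0 = Bind (Const (encode x)) (Call 1 (Bin_Op Mk_Branch (Var 0) eM))"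
    "body P 1 = loop_body eD" "body P 2 = gen_body 2"
    by (simp_all add: body_def P_def sampler_program_def)
  define j where "j = (LEAST j. ?M \<le> 2 ^ j)"
  have ex: "?M \<le> 2 ^ sz ?M" using abs_less_power_sz[of ?M] by linarith
  have j: "?M \<le> 2 ^ j" "j \<le> sz ?M"
    unfolding j_def using ex by (rule LeastI, intro Least_le ex)
  have j': "j = 0 \<or> 2 ^ (j - 1) < ?M"
    using not_less_Least[of "j - 1" "\<lambda>j. ?M \<le> 2 ^ j"] unfolding j_def[symmetric] by (cases "j = 0") auto
  have N: "(2::int) ^ j < 2 * ?M" using j' pos by (cases j) auto
  obtain G where G: "eval_expr P (gen_body 2) [encode (?M, (1 :: int, 0 :: int))] = spmf_of_pmf G"
    "map_pmf fst G = map_pmf Num (pmf_of_set {0 * 2 ^ j..<(0 + 1) * 2 ^ j})"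
    "\<And>y. y \<in> set_pmf G \<Longrightarrow> snd y \<le> (j + 1) * (100 * sz ?M + 500)"
    using gen_eval[OF b(3), of ?M 0 1 j] pos j j' by auto
  have ne: "{0..<(2::int) ^ j} \<noteq> {}" by simp
  have supp: "\<exists>u. fst y = Num u \<and> 0 \<le> u \<and> u < 2 ^ j" if "y \<in> set_pmf G" for y
  proof -
    have "fst y \<in> set_pmf (map_pmf fst G)" using that by simp
    then show ?thesis unfolding G(2) using ne by (auto simp: set_pmf_of_set)
  qed
  define p where "p = eval_expr P (loop_body eD) [?arg]"
  define C where "C = 40 * sz x + 60 * sz ?M + 300 + W"
  have branch: "\<exists>t\<le>C. eval_expr P (loop_branch eD) [Num u, ?arg] =
     (if u < ?M then return_spmf (encode (g (x, u)), t) else map_spmf (\<lambda>(w, t'). (w, t' + t)) p)"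
    if u: "0 \<le> u" "u < 2 ^ j" for u
  proof -
    have "\<bar>u\<bar> < 2 ^ Suc (sz ?M)" using u N abs_less_power_sz[of ?M] by simp
    from sz_le_of_abs_less[OF this] have su: "sz u \<le> sz ?M + 2" by simp
    show ?thesis
    proof (cases "u < ?M")
      case True
      obtain t where t: "t \<le> Tg (x, u)"
        "eval_expr P eD (encode (x, u) # [Num u, ?arg]) = return_spmf (encode (g (x, u)), t)"
        unfolding P using implementsD[OF g lA] by blast
      then have "t \<le> W" using W[of u] u N by simp
      then show ?thesis using True t(2) su
        by (simp add: loop_branch_def eval_simps C_def)
    next
      case False
      then obtain ta where ta: "eval_expr P (Bin_Op Less (Var 0) (Un_Op Snd (Var 1))) [Num u, ?arg] = return_spmf (Num 0, ta)"
        "ta \<le> 10 * sz x + 30 * sz ?M + 100"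
        using su by (auto simp: eval_simps)
      have "eval_expr P (loop_branch eD) [Num u, ?arg] = map_spmf (\<lambda>(w, t). (w, t + (ta + vsize ?arg + 1 + 1 + 1))) p"
        unfolding p_def loop_branch_def
        by (simp add: eval_Cond eval_Call eval_Var ta b(2) map_spmf_conv_bind_spmf split_def add_ac lookup_1 del: encode_simps One_nat_def)
      moreover have "ta + vsize ?arg + 1 + 1 + 1 \<le> C" using ta(2) by (simp add: C_def)
      ultimately show ?thesis using False by (intro exI[of _ "ta + vsize ?arg + 1 + 1 + 1"] conjI) (simp_all only: if_False)
    qed
  qed
  define tb where "tb u = (SOME t. t \<le> C \<and> eval_expr P (loop_branch eD) [Num u, ?arg] =
     (if u < ?M then return_spmf (encode (g (x, u)), t) else map_spmf (\<lambda>(w, t'). (w, t' + t)) p))" for u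
  have tb: "tb u \<le> C" "eval_expr P (loop_branch eD) [Num u, ?arg] =
     (if u < ?M then return_spmf (encode (g (x, u)), tb u) else map_spmf (\<lambda>(w, t'). (w, t' + tb u)) p)"
    if "0 \<le> u" "u < 2 ^ j" for u
  proof -
    have *: "tb u \<le> C \<and> eval_expr P (loop_branch eD) [Num u, ?arg] =
       (if u < ?M then return_spmf (encode (g (x, u)), tb u) else map_spmf (\<lambda>(w, t'). (w, t' + tb u)) p)"
      using someI_ex[OF branch[OF that]] unfolding tb_def .
    show "tb u \<le> C" by (rule conjunct1[OF *])
    show "eval_expr P (loop_branch eD) [Num u, ?arg] =
       (if u < ?M then return_spmf (encode (g (x, u)), tb u) else map_spmf (\<lambda>(w, t'). (w, t' + tb u)) p)"
      by (rule conjunct2[OF *])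
  qed
  obtain t0 where t0: "eval_expr P (Bin_Op Mk_Branch (Un_Op Snd (Var 0)) (Const (Branch (Num 1) (Num 0)))) [?arg]
      = return_spmf (encode (?M, (1 :: int, 0 :: int)), t0)" "t0 \<le> 10 * sz x + 30 * sz ?M + 100"
    by (auto simp: eval_simps floorlog_def)
  define t1 where "t1 y = t0 + snd y + tb (num (fst y)) + 2" for y
  define T where "T = t0 + (j + 1) * (100 * sz ?M + 500) + C + 2"
  let ?acc = "\<lambda>y :: val \<times> nat. num (fst y) < ?M"
  have "p = bind_spmf (spmf_of_pmf G) (\<lambda>y. bind_spmf (eval_expr P (loop_branch eD) [fst y, ?arg])
      (\<lambda>(v, t). return_spmf (v, t + (t0 + snd y + 2))))"
    unfolding p_def loop_body_def
    by (simp add: eval_Bind eval_Call t0 b(3) G(1) split_def add_ac del: encode_simps bind_spmf_of_pmf)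
  also have "\<dots> = bind_pmf G (\<lambda>y. bind_spmf (eval_expr P (loop_branch eD) [fst y, ?arg])
      (\<lambda>(v, t). return_spmf (v, t + (t0 + snd y + 2))))" by (rule bind_spmf_of_pmf)
  also have "\<dots> = bind_pmf G (\<lambda>y. if ?acc y then return_spmf (encode (g (x, num (fst y))), t1 y)
      else map_spmf (\<lambda>(w, t). (w, t + t1 y)) p)"
  proof (rule bind_pmf_cong[OF refl])
    fix y assume "y \<in> set_pmf G"
    then obtain u where u: "fst y = Num u" "0 \<le> u" "u < 2 ^ j" using supp by blast
    show "bind_spmf (eval_expr P (loop_branch eD) [fst y, ?arg]) (\<lambda>(v, t). return_spmf (v, t + (t0 + snd y + 2)))
      = (if ?acc y then return_spmf (encode (g (x, num (fst y))), t1 y)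
      else map_spmf (\<lambda>(w, t). (w, t + t1 y)) p)"
      unfolding u(1) tb(2)[OF u(2,3)]
      by (simp add: u(1) t1_def map_spmf_conv_bind_spmf split_def add_ac)
  qed
  finally have p_eq: "p = bind_pmf G (\<lambda>y. if ?acc y then return_spmf (encode (g (x, num (fst y))), t1 y)
      else map_spmf (\<lambda>(w, t). (w, t + t1 y)) p)" .
  have t1: "t1 y \<le> T" if "y \<in> set_pmf G" for y
  proof -
    obtain u where u: "fst y = Num u" "0 \<le> u" "u < 2 ^ j" using supp \<open>y \<in> set_pmf G\<close> by blast
    show ?thesis using tb(1)[OF u(2,3)] G(3)[OF that] by (simp add: t1_def T_def u(1) del: encode_simps)
  qed
  have prob: "measure_pmf.prob G {y. ?acc y \<and> H (num (fst y))}
      = card {u \<in> {0..<?M}. H u} / 2 ^ j" for H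
  proof -
    have "measure_pmf.prob G {y. ?acc y \<and> H (num (fst y))}
        = measure_pmf.prob (map_pmf fst G) {v. num v < ?M \<and> H (num v)}"
      by (simp add: vimage_def)
    also have "\<dots> = measure_pmf.prob (pmf_of_set {0..<2 ^ j}) {u. u < ?M \<and> H u}"
      unfolding G(2) by (simp add: vimage_def)
    also have "\<dots> = card ({0..<2 ^ j} \<inter> {u. u < ?M \<and> H u}) / card {0..<(2::int) ^ j}"
      by (rule measure_pmf_of_set) auto
    also have "{0..<2 ^ j} \<inter> {u. u < ?M \<and> H u} = {u \<in> {0..<?M}. H u}" using j(1) by auto
    also have "card {0..<(2::int) ^ j} = 2 ^ j" by (simp add: nat_power_eq)
    finally show ?thesis by simp
  qed
  have acc: "measure_pmf.prob G {y. ?acc y} = ?M / 2 ^ j"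
  proof -
    have s: "{u \<in> {0..<?M}. True} = {0..<?M}" by auto
    show ?thesis using prob[of "\<lambda>_. True", unfolded s] pos by simp
  qed
  have "real_of_int (2 ^ j) < real_of_int (2 * ?M)" using N by (simp only: of_int_less_iff)
  then have accept: "1 / 2 \<le> measure_pmf.prob G {y. ?acc y}"
    unfolding acc by (simp add: field_simps)
  have lossless: "lossless_spmf p" by (rule rejection_lossless[OF p_eq accept t1 t1])
  have out: "map_spmf fst p = spmf_of_pmf (map_pmf (\<lambda>u. encode (g (x, u))) (pmf_of_set {0..<?M}))"
  proof (rule rejection_output[OF p_eq accept t1 t1])
    fix v
    have "pmf (map_pmf (\<lambda>u. encode (g (x, u))) (pmf_of_set {0..<?M})) v
        = measure_pmf.prob (pmf_of_set {0..<?M}) {u. encode (g (x, u)) = v}"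
      by (simp add: pmf_map vimage_def)
    also have "\<dots> = card ({0..<?M} \<inter> {u. encode (g (x, u)) = v}) / card {0..<?M}"
      using pos by (intro measure_pmf_of_set) auto
    also have "{0..<?M} \<inter> {u. encode (g (x, u)) = v} = {u \<in> {0..<?M}. encode (g (x, u)) = v}" by auto
    finally show "pmf (map_pmf (\<lambda>u. encode (g (x, u))) (pmf_of_set {0..<?M})) v * measure_pmf.prob G {y. ?acc y}
        = measure_pmf.prob G {y. ?acc y \<and> encode (g (x, num (fst y))) = v}"
      unfolding acc prob[of "\<lambda>u. encode (g (x, u)) = v"] using pos by simp
  qed
  have time: "(\<integral>\<^sup>+ (v, t). of_nat t \<partial>measure_spmf p) \<le> of_nat (2 * T)"
    by (rule rejection_time[OF p_eq accept t1 t1])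
  obtain tf where tf: "tf \<le> Tf x" "eval_expr P eM (encode x # [Num 0]) = return_spmf (encode ?M, tf)"
    unfolding P using implementsD[OF f lA] by blast
  obtain c where c: "run P (Num 0) = map_spmf (\<lambda>(w, t). (w, t + c)) p" "c \<le> 100 * sz x + 100 * sz ?M + 1000 + Tf x"
  proof (rule that)
    show "run P (Num 0) = map_spmf (\<lambda>(w, t). (w, t + (tf + (sz x + sz x) + vsize ?arg + 1 + 1 + 1 + 1 + 1))) p"
      unfolding run_def b(1) p_def
      by (simp add: eval_simps tf(2)[simplified] b(2)[simplified] map_spmf_conv_bind_spmf split_def add_ac)
    show "tf + (sz x + sz x) + vsize ?arg + 1 + 1 + 1 + 1 + 1 \<le> 100 * sz x + 100 * sz ?M + 1000 + Tf x" using tf(1) by simp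
  qed
  show ?out
    unfolding output_dist_def c(1) out[symmetric] by (simp add: spmf.map_comp o_def split_def)
  have "expected_time P (Num 0) = (\<integral>\<^sup>+ (w, t). of_nat t + of_nat c \<partial>measure_spmf p)"
    unfolding expected_time_def c(1) using lossless by (simp add: o_def split_def)
  also have "\<dots> = (\<integral>\<^sup>+ (w, t). of_nat t \<partial>measure_spmf p) + of_nat c"
    using lossless unfolding split_def
    by (subst nn_integral_add) (auto simp: lossless_spmf_def measure_spmf.emeasure_eq_measure)
  also have "\<dots> \<le> of_nat (2 * T) + of_nat (100 * sz x + 100 * sz ?M + 1000 + Tf x)"
    using time c(2) by (intro add_mono of_nat_mono)
  also have "\<dots> = of_nat (2 * T + (100 * sz x + 100 * sz ?M + 1000 + Tf x))" by simp
  also have "\<dots> \<le> of_nat (2 * ((sz ?M + 1) * (100 * sz ?M + 500)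
      + 100 * sz x + 200 * sz ?M + 1000 + W) + (100 * sz x + 100 * sz ?M + 1000 + Tf x))"
  proof (rule of_nat_mono)
    have bound: "2 * (t0 + U + (40 * m + 60 * n + 300 + W) + 2) + R \<le> 2 * (V + 100 * m + 200 * n + 1000 + W) + R"
      if "U \<le> V" "t0 \<le> 10 * m + 30 * n + 100" for U V m n R :: nat
      using that by simp
    have "(j + 1) * (100 * sz ?M + 500) \<le> (sz ?M + 1) * (100 * sz ?M + 500)"
      using j(2) by (intro mult_right_mono) simp_all
    then show "2 * T + (100 * sz x + 100 * sz ?M + 1000 + Tf x) \<le> 2 * ((sz ?M + 1) * (100 * sz ?M + 500)
      + 100 * sz x + 200 * sz ?M + 1000 + W) + (100 * sz x + 100 * sz ?M + 1000 + Tf x)"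
      unfolding T_def C_def using t0(2) by (rule bound)
  qed
  finally show ?time .
qed

text \<open>The code and the bound \<open>T\<close> are chosen before \<open>x\<close>: one program
  serves all inputs, each of which enters as a constant.\<close>

theorem sampler:
  fixes f :: "'a::enc \<Rightarrow> int" and g :: "'a \<times> int \<Rightarrow> 'b::enc"
  assumes f: "ptime f" and g: "ptime g"
  shows "\<exists>eM eD Q T. pb T \<and> (\<forall>x. 0 < f x \<longrightarrow>
    output_dist (sampler_program eM eD Q (encode x)) (Num 0)
      = spmf_of_pmf (map_pmf (\<lambda>u. encode (g (x, u))) (pmf_of_set {0..<f x})) \<and>
    expected_time (sampler_program eM eD Q (encode x)) (Num 0) \<le> of_nat (T x))"
proof -
  obtain Tf where Tf: "pb Tf" "\<And>x. sz (f x) \<le> Tf x" "\<And>n. \<exists>P e. implements n P e f Tf"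
    using ptimeE[OF f] by blast
  obtain Tg where Tg: "pb Tg" "\<And>x. sz (g x) \<le> Tg x" "\<And>n. \<exists>P e. implements n P e g Tg"
    using ptimeE[OF g] by blast
  obtain Q eM eD where Q: "implements 3 Q eM f Tf" "implements 3 Q eD g Tg"
    using implements2[OF Tf(3) Tg(3)] by blast
  obtain Tg' where Tg': "\<And>x. Tg x \<le> Tg' (sz x)" "mono Tg'" "\<And>S :: 'a \<Rightarrow> nat. pb S \<Longrightarrow> pb (\<lambda>x. Tg' (S x))"
    using pb_comp_bound[OF Tg(1), where 'b = 'a] by metis
  define W where "W x = Tg' (sz x + sz (f x) + 10)" for x
  define T where "T x = 2 * ((sz (f x) + 1) * (100 * sz (f x) + 500)
      + 100 * sz x + 200 * sz (f x) + 1000 + W x) + (100 * sz x + 100 * sz (f x) + 1000 + Tf x)" for x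
  have W: "Tg (x, u) \<le> W x" if "0 \<le> u" "u < 2 * f x" for x u
  proof -
    have "\<bar>u\<bar> < 2 ^ Suc (sz (f x))" using that abs_less_power_sz[of "f x"] by simp
    from sz_le_of_abs_less[OF this] have "sz (x, u) \<le> sz x + sz (f x) + 10" by simp
    then show ?thesis unfolding W_def using Tg'(1,2) by (meson le_trans monoD)
  qed
  have "pb W" unfolding W_def by (intro Tg'(3) pb_add pb_sz pb_const ptime_pb[OF f])
  then have pbT: "pb T" unfolding T_def by (intro pb_add pb_mult pb_sz pb_const ptime_pb[OF f] Tf(1))
  show ?thesis
  proof (rule exI[of _ eM], rule exI[of _ eD], rule exI[of _ Q], intro exI[of _ T] conjI allI impI)
    show "pb T" by (rule pbT)
  next
    fix x assume pos: "0 < f x"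
    show "output_dist (sampler_program eM eD Q (encode x)) (Num 0)
        = spmf_of_pmf (map_pmf (\<lambda>u. encode (g (x, u))) (pmf_of_set {0..<f x}))"
      by (rule sampler_core(1)[OF Q pos W])
    show "expected_time (sampler_program eM eD Q (encode x)) (Num 0) \<le> of_nat (T x)"
      unfolding T_def by (rule sampler_core(2)[OF Q pos W])
  qed
qed

section \<open>Words of the cells\<close>

lemma pick_map_one:
  assumes "0 \<le> u" "u < int (length xs)"
  shows "fst (pick d (map (\<lambda>x. (x, 1)) xs) u) = xs ! nat u"
  using assms
proof (induction xs arbitrary: u)
  case (Cons x xs)
  show ?case
  proof (cases "u < 1")
    case True
    then show ?thesis using Cons.prems by (simp add: pick_Cons)
  next
    case False
    then have "nat u = Suc (nat (u - 1))" using Cons.prems by simp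
    then show ?thesis using False Cons by (simp add: pick_Cons)
  qed
qed simp

lemma nthd_eq: "i < length xs \<Longrightarrow> nthd d xs (int i) = xs ! i"
  by (simp add: nthd_def pick_map_one)

lemma distinct_concat_map:
  assumes "distinct xs" "\<And>x. x \<in> set xs \<Longrightarrow> distinct (f x)"
    "\<And>x y. x \<in> set xs \<Longrightarrow> y \<in> set xs \<Longrightarrow> x \<noteq> y \<Longrightarrow> set (f x) \<inter> set (f y) = {}"
  shows "distinct (concat (map f xs))"
  using assms
proof (induction xs)
  case (Cons x xs)
  have "set (f x) \<inter> set (f y) = {}" if "y \<in> set xs" for y
    using Cons.prems(1) that by (intro Cons.prems(3)) auto
  moreover have "distinct (concat (map f xs))" using Cons by simp
  ultimately show ?case using Cons.prems(2)[of x] by auto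
qed simp

text \<open>Choosing a block by weight and then an offset amounts to indexing the concatenation of
  the blocks.\<close>

lemma pick_concat:
  assumes "\<And>x m. (x, m) \<in> set xs \<Longrightarrow> m = int (length (f x))" "0 \<le> u" "u < (\<Sum>y\<leftarrow>xs. snd y)"
  shows "\<exists>x u' m. pick d xs u = (x, u') \<and> (x, m) \<in> set xs \<and> 0 \<le> u' \<and> u' < int (length (f x)) \<and>
    concat (map (\<lambda>y. f (fst y)) xs) ! nat u = f x ! nat u'"
  using assms
proof (induction xs arbitrary: u)
  case (Cons y xs)
  obtain x m where y: "y = (x, m)" by (cases y)
  have m: "m = int (length (f x))" using Cons.prems(1) by (simp add: y)
  show ?case
  proof (cases "u < m")
    case True
    then show ?thesis using Cons.prems(2) m
      by (intro exI[of _ x] exI[of _ u] exI[of _ m]) (auto simp: y pick_Cons nth_append)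
  next
    case False
    have "\<exists>x' u' m'. pick d xs (u - m) = (x', u') \<and> (x', m') \<in> set xs \<and> 0 \<le> u' \<and> u' < int (length (f x')) \<and>
      concat (map (\<lambda>y. f (fst y)) xs) ! nat (u - m) = f x' ! nat u'"
      using Cons.prems False by (intro Cons.IH) (auto simp: y)
    moreover have "nat u - length (f x) = nat (u - m)" "\<not> nat u < length (f x)"
      using False m Cons.prems(2) by auto
    ultimately show ?thesis using False m by (auto simp: y pick_Cons nth_append)
  qed
qed simp

text \<open>The enumeration behind \<open>unrank\<close>: the loops over states and letters are
  nested exactly as in \<open>predecessors\<close>, so that ranks agree with list positions.\<close>

fun state_words :: "nat \<Rightarrow> data \<Rightarrow> nat \<Rightarrow> state \<Rightarrow> nat list list" where
  "state_words k r 0 q = (if q = pstart r then [[]] else [])"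
| "state_words k r (Suc j) q = concat (map (\<lambda>p. concat (map (\<lambda>a. map (\<lambda>w. w @ [nat a]) (state_words k r j p))
     (filter (\<lambda>a. pstep r p a = q) (letters k)))) (pstates r))"

lemma concat_map_concat_map:
  "concat (map f (concat (map g xs))) = concat (map (\<lambda>x. concat (map f (g x))) xs)"
  by (induction xs) auto

lemma length_concat_map_int: "int (length (concat (map f xs))) = (\<Sum>x\<leftarrow>xs. int (length (f x)))"
  by (induction xs) auto

lemma row_at_words: "row_at k r j = map (\<lambda>q. (q, int (length (state_words k r j q)))) (pstates r)"
proof (induction j)
  case 0
  then show ?case by (simp add: row_at_def row0_def)
next
  case (Suc j)
  have "row_at k r (Suc j) = next_row k r (row_at k r j)" by (simp add: row_at_def)
  then show ?case unfolding Suc next_row_def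
    by (simp add: o_def length_concat_map_int sum_list_map_filter' cong: if_cong)
qed

lemma predecessors_words:
  "concat (map (\<lambda>y. map (\<lambda>w. w @ [nat (snd (fst y))]) (state_words k r j (fst (fst y)))) (predecessors k r (row_at k r j) q))
   = state_words k r (Suc j) q"
  unfolding predecessors_def row_at_words
  by (simp add: concat_map_concat_map o_def)

text \<open>The accumulator \<open>acc\<close> is the suffix decoded so far; it is generalized for
  the induction.\<close>

lemma unrank_words:
  assumes "0 \<le> u" "u < int (length (state_words k r j q))"
  shows "snd (snd (foldl (unrank_step k r) (q, (u, acc)) (map (row_at k r) (rev [0..<j]))))
    = map int (state_words k r j q ! nat u) @ acc"
  using assms
proof (induction j arbitrary: q u acc)
  case 0
  then show ?case by (auto split: if_splits)
next
  case (Suc j)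
  let ?xs = "predecessors k r (row_at k r j) q"
  let ?f = "\<lambda>x :: state \<times> int. map (\<lambda>w. w @ [nat (snd x)]) (state_words k r j (fst x))"
  have mem: "m = int (length (state_words k r j (fst x))) \<and> snd x \<in> set (letters k)" if "(x, m) \<in> set ?xs" for x m
    using that by (auto simp: predecessors_def row_at_words)
  have words: "concat (map (\<lambda>y. ?f (fst y)) ?xs) = state_words k r (Suc j) q"
    using predecessors_words[of k r j q] by simp
  have "(\<Sum>y\<leftarrow>?xs. snd y) = (\<Sum>y\<leftarrow>?xs. int (length (?f (fst y))))"
    using mem by (intro arg_cong[where f = sum_list] map_cong refl) force
  also have "\<dots> = int (length (state_words k r (Suc j) q))"
    unfolding words[symmetric] length_concat_map_int ..
  finally have "u < (\<Sum>y\<leftarrow>?xs. snd y)" using Suc.prems by simp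
  then obtain x u' m where x: "pick ((0, (0, 0)), 0) ?xs u = (x, u')" "(x, m) \<in> set ?xs" "0 \<le> u'"
    "u' < int (length (?f x))" "concat (map (\<lambda>y. ?f (fst y)) ?xs) ! nat u = ?f x ! nat u'"
    using pick_concat[of ?xs ?f u "((0, (0, 0)), 0)"] mem Suc.prems(1) by force
  have a: "0 \<le> snd x" using mem[OF x(2)] by (auto simp: letters_def)
  have u': "u' < int (length (state_words k r j (fst x)))" using x(4) by simp
  have step: "unrank_step k r (q, (u, acc)) (row_at k r j) = (fst x, (u', snd x # acc))"
    by (simp add: unrank_step_def x(1) Let_def)
  have "state_words k r (Suc j) q ! nat u = (state_words k r j (fst x) ! nat u') @ [nat (snd x)]"
    using x(3,5) u' unfolding words by simp
  then show ?case using Suc.IH[OF x(3) u', of "snd x # acc"] a by (simp add: step)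
qed

section \<open>Instances as data\<close>

definition dfa_data :: "'o dfa \<Rightarrow> int \<times> int list list \<times> 'o list" where
  "dfa_data A = (int (start A), (map (map int) (delta A), annot A))"

text \<open>The components have different types, so nested pairs stand for the encoded list; the
  final unit value supplies the \<open>Num 0\<close> that ends it.\<close>

definition instance_data :: "dfa_lqci \<Rightarrow> data" where
  "instance_data c = (dfa_data (hard_dfa c), (dfa_data (cost_dfa c), (dfa_data (label_dfa c),
     (replicate (lo_len c) 0, (replicate (hi_len c) 0,
     (quotient_of (cbound c), (quotient_of (lam c), (quotient_of (rho c),
     (map (\<lambda>(l, a, b). (l, (quotient_of a, quotient_of b))) (label_specs c), ())))))))))"

lemma encode_map: "encode (map f xs) = enc_list (\<lambda>x. encode (f x)) xs"
  by (induction xs) (simp_all add: enc_list_def)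

lemma encode_list_eq: "encode xs = enc_list encode xs"
  by (simp add: encode_list_def)

lemma encode_quotient_of: "encode (quotient_of q) = enc_rat q"
  by (cases "quotient_of q") (simp add: enc_rat_def)

lemma encode_dfa_data: "encode (dfa_data A) = enc_dfa encode A"
  unfolding dfa_data_def enc_dfa_def encode_simps(1,5) encode_map encode_list_eq[of "annot A"]
  by (simp add: enc_nat_def[abs_def])

lemma encode_instance_data: "encode (instance_data c) = enc_dfa_lqci c"
proof -
  have int: "(encode :: int \<Rightarrow> val) = Num" and bool: "(encode :: bool \<Rightarrow> val) = enc_bool"
    by (simp_all add: encode_int_def encode_bool_def)
  show ?thesis
    unfolding instance_data_def enc_dfa_lqci_def encode_simps(3,5) encode_dfa_data encode_map encode_quotient_of
      enc_unary_def int bool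
    by (simp add: enc_list_def int encode_list_eq encode_quotient_of split_def)
qed

definition dfa_run :: "'o dfa \<Rightarrow> nat list \<Rightarrow> nat" where
  "dfa_run A w = foldl (\<lambda>q a. delta A ! q ! a) (start A) w"

lemma dfa_run_less:
  assumes A: "dfa_wf k A" and w: "w \<in> lists {..<k}"
  shows "dfa_run A w < length (annot A)"
  using w
proof (induction w rule: rev_induct)
  case Nil
  then show ?case using A by (simp add: dfa_run_def dfa_wf_def)
next
  case (snoc a w)
  let ?q = "dfa_run A w"
  have q: "?q < length (delta A)" using snoc A by (simp add: dfa_wf_def)
  then have row: "delta A ! ?q \<in> set (delta A)" by simp
  then have "a < length (delta A ! ?q)" using A snoc.prems by (auto simp: dfa_wf_def)
  then have "delta A ! ?q ! a \<in> set (delta A ! ?q)" by simp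
  then show ?case using A row by (auto simp: dfa_wf_def dfa_run_def)
qed

locale dfa_instance =
  fixes k :: nat and c :: dfa_lqci
  assumes c: "c \<in> dfa_lqci_class k"
begin

abbreviation "r \<equiv> instance_data c"
abbreviation "C \<equiv> lqci_of_dfa k c"

lemma wf: "dfa_wf k (hard_dfa c)" "dfa_wf k (cost_dfa c)" "dfa_wf k (label_dfa c)"
  and distinct_labels: "distinct (map fst (label_specs c))"
  and inst: "lqci_instance {..<k} C"
  using c by (simp_all add: dfa_lqci_class_def)

definition run3 :: "nat list \<Rightarrow> state" where
  "run3 w = (int (dfa_run (hard_dfa c) w), (int (dfa_run (cost_dfa c) w), int (dfa_run (label_dfa c) w)))"

lemma pstart_eq: "pstart r = run3 []"
  by (simp add: pstart_def run3_def dfa_run_def instance_data_def dfa_data_def)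

lemma dfa_step:
  assumes A: "dfa_wf k A" and w: "w \<in> lists {..<k}" and a: "a < k"
  shows "nthd 0 (nthd [] (fst (snd (dfa_data A))) (int (dfa_run A w))) (int a) = int (dfa_run A (w @ [a]))"
proof -
  have q: "dfa_run A w < length (delta A)" using dfa_run_less[OF A w] A by (simp add: dfa_wf_def)
  then have "delta A ! dfa_run A w \<in> set (delta A)" by simp
  then have "a < length (delta A ! dfa_run A w)" using A a by (auto simp: dfa_wf_def)
  then show ?thesis using q by (simp add: dfa_data_def nthd_eq) (simp add: dfa_run_def)
qed

lemma pstep_run3: "w \<in> lists {..<k} \<Longrightarrow> a < k \<Longrightarrow> pstep r (run3 w) (int a) = run3 (w @ [a])"
  unfolding pstep_def run3_def by (simp add: instance_data_def dfa_step wf)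

lemma set_pstates: "set (pstates r) = (int ` {..<length (annot (hard_dfa c))}) \<times>
    (int ` {..<length (annot (cost_dfa c))}) \<times> (int ` {..<length (annot (label_dfa c))})"
proof -
  have parts: "snd (snd (hard_part r)) = annot (hard_dfa c)" "snd (snd (cost_part r)) = annot (cost_dfa c)"
    "snd (snd (label_part r)) = annot (label_dfa c)"
    by (simp_all add: instance_data_def dfa_data_def)
  have "(h, (a, l)) \<in> set (pstates r) \<longleftrightarrow> h \<in> set (idx (annot (hard_dfa c))) \<and>
      a \<in> set (idx (annot (cost_dfa c))) \<and> l \<in> set (idx (annot (label_dfa c)))" for h a l
    unfolding pstates_def parts by auto
  then show ?thesis by (auto simp: idx_eq lessThan_atLeast0)
qed

lemma run3_in_pstates: "w \<in> lists {..<k} \<Longrightarrow> run3 w \<in> set (pstates r)"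
  using dfa_run_less[OF wf(1)] dfa_run_less[OF wf(2)] dfa_run_less[OF wf(3)]
  by (auto simp: set_pstates run3_def)

lemma distinct_pstates: "distinct (pstates r)"
  unfolding pstates_def idx_eq
  by (intro distinct_concat_map) (auto simp: distinct_map inj_on_def)

text \<open>The recursion ranges over \<open>pstates\<close>, and well-formedness of the automata
  keeps every run inside it, so no word is lost.\<close>

lemma set_state_words: "set (state_words k r j q) = {w \<in> lists {..<k}. length w = j \<and> run3 w = q}"
proof (induction j arbitrary: q)
  case 0
  then show ?case by (auto simp: pstart_eq)
next
  case (Suc j)
  show ?case
  proof (intro equalityI subsetI)
    fix v assume "v \<in> set (state_words k r (Suc j) q)"
    then obtain p a w where "p \<in> set (pstates r)" "a < k" "pstep r p (int a) = q" "w \<in> set (state_words k r j p)" "v = w @ [a]"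
      by (auto simp: letters_def)
    then show "v \<in> {w \<in> lists {..<k}. length w = Suc j \<and> run3 w = q}"
      unfolding Suc using pstep_run3[of w a] by auto
  next
    fix v assume v: "v \<in> {w \<in> lists {..<k}. length w = Suc j \<and> run3 w = q}"
    then obtain w a where w: "v = w @ [a]" "length w = j" by (cases v rule: rev_exhaust) auto
    have wa: "w \<in> lists {..<k}" "a < k" using v w by auto
    have "w \<in> set (state_words k r j (run3 w))" using wa w unfolding Suc by simp
    moreover have "pstep r (run3 w) (int a) = q" using pstep_run3[OF wa] v w by simp
    ultimately show "v \<in> set (state_words k r (Suc j) q)"
      using run3_in_pstates[OF wa(1)] wa(2) w(1)
      by (auto simp: letters_def intro!: bexI[of _ "run3 w"] bexI[of _ "int a"])
  qed
qed

lemma distinct_state_words: "distinct (state_words k r j q)"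
proof (induction j arbitrary: q)
  case (Suc j)
  show ?case
    unfolding state_words.simps
  proof (intro distinct_concat_map distinct_pstates)
    fix p :: state
    show "distinct (filter (\<lambda>a. pstep r p a = q) (letters k))"
      by (simp add: letters_def distinct_map)
  next
    fix p :: state and a show "distinct (map (\<lambda>w. w @ [nat a]) (state_words k r j p))"
      using Suc by (simp add: distinct_map inj_on_def)
  next
    fix p :: state and a b assume "a \<in> set (filter (\<lambda>a. pstep r p a = q) (letters k))"
      "b \<in> set (filter (\<lambda>a. pstep r p a = q) (letters k))" "a \<noteq> b"
    then show "set (map (\<lambda>w. w @ [nat a]) (state_words k r j p)) \<inter> set (map (\<lambda>w. w @ [nat b]) (state_words k r j p)) = {}"
      by (auto simp: letters_def)
  next
    fix p p' :: state assume "p \<noteq> p'"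
    then have "set (state_words k r j p) \<inter> set (state_words k r j p') = {}"
      by (auto simp: set_state_words)
    then show "set (concat (map (\<lambda>a. map (\<lambda>w. w @ [nat a]) (state_words k r j p)) (filter (\<lambda>a. pstep r p a = q) (letters k)))) \<inter>
        set (concat (map (\<lambda>a. map (\<lambda>w. w @ [nat a]) (state_words k r j p')) (filter (\<lambda>a. pstep r p' a = q) (letters k)))) = {}"
      by auto
  qed
qed simp

definition cell_words :: "cell \<Rightarrow> nat list list" where
  "cell_words y = state_words k r (length (snd (snd y))) (fst y)"

definition cell_at :: "nat \<Rightarrow> state \<Rightarrow> cell" where
  "cell_at j q = (q, (int (length (state_words k r j q)), map (row_at k r) (rev [0..<j])))"

lemma cells_eq: "cells k r = concat (map (\<lambda>j. map (cell_at j) (filter (accepts r) (pstates r)))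
    (filter (\<lambda>j. lo_len c \<le> j) (rev [0..<Suc (hi_len c)])))"
proof -
  have "filter (\<lambda>y. int (length (lo_part r)) \<le> int (length (snd y))) (levels k r)
      = map (level k r) (filter (\<lambda>j. lo_len c \<le> j) (rev [0..<Suc (hi_len c)]))"
    unfolding levels_eq filter_map by (simp add: level_def o_def instance_data_def)
  moreover have "map (\<lambda>z. (fst z, (snd z, snd (level k r j)))) (filter (\<lambda>z. accepts r (fst z)) (fst (level k r j)))
      = map (cell_at j) (filter (accepts r) (pstates r))" for j
    unfolding level_def row_at_words fst_conv snd_conv filter_map by (simp add: cell_at_def o_def row_at_words)
  ultimately show ?thesis unfolding cells_def by (simp add: o_def)
qed

lemma cells_mem: "y \<in> set (cells k r) \<longleftrightarrow>
    (\<exists>j q. lo_len c \<le> j \<and> j \<le> hi_len c \<and> q \<in> set (pstates r) \<and> accepts r q \<and> y = cell_at j q)"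
  unfolding cells_eq by (simp add: less_Suc_eq_le image_iff Bex_def del: split_paired_Ex upt_Suc) blast

lemma cell_words_at: "cell_words (cell_at j q) = state_words k r j q"
  by (simp add: cell_words_def cell_at_def)

lemma accepts_run3: "w \<in> lists {..<k} \<Longrightarrow> accepts r (run3 w) \<longleftrightarrow> dfa_output (hard_dfa c) w"
  using dfa_run_less[OF wf(1)]
  by (simp add: accepts_def run3_def instance_data_def dfa_data_def nthd_eq dfa_output_def dfa_run_def)

lemma state_cost_run3: "w \<in> lists {..<k} \<Longrightarrow> state_cost r (run3 w) = dfa_output (cost_dfa c) w"
  using dfa_run_less[OF wf(2)]
  by (simp add: state_cost_def run3_def instance_data_def dfa_data_def nthd_eq dfa_output_def dfa_run_def)

lemma state_label_run3: "w \<in> lists {..<k} \<Longrightarrow> state_label r (run3 w) = dfa_output (label_dfa c) w"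
  using dfa_run_less[OF wf(3)]
  by (simp add: state_label_def run3_def instance_data_def dfa_data_def nthd_eq dfa_output_def dfa_run_def)

lemma specs_part_eq: "specs_part r = map (\<lambda>(l, a, b). (l, (quotient_of a, quotient_of b))) (label_specs c)"
  by (simp add: instance_data_def)

lemma fval_quotient_of: "fval (quotient_of q) = real_of_rat q"
proof -
  obtain a b where ab: "quotient_of q = (a, b)" by (cases "quotient_of q")
  then show ?thesis using quotient_of_div[OF ab] by (simp add: fval_def of_rat_divide)
qed

lemma snd_quotient_of: "0 < snd (quotient_of q)"
  by (metis prod.collapse quotient_of_denom_pos)

lemma fst_specs: "map fst (specs_part r) = map fst (label_specs c)"
  by (simp add: specs_part_eq split_def o_def)

lemma specs_bounds:
  assumes "(l, a, b) \<in> set (label_specs c)"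
  shows "0 \<le> a" "a \<le> b" "word_lo C l = a" "word_hi C l = b"
proof -
  have m: "map_of (label_specs c) l = Some (a, b)"
    using assms distinct_labels by (simp add: map_of_eq_Some_iff)
  have "l \<in> labels C" using assms by (force simp: lqci_of_dfa_def)
  moreover show w: "word_lo C l = a" "word_hi C l = b" by (simp_all add: lqci_of_dfa_def m)
  ultimately show "0 \<le> a" "a \<le> b" using inst unfolding lqci_instance_def w[symmetric] by blast+
qed

sublocale celled_instance k r cell_words
proof
  show "distinct (cells k r)"
    unfolding cells_eq
  proof (intro distinct_concat_map)
    fix j show "distinct (map (cell_at j) (filter (accepts r) (pstates r)))"
      using distinct_pstates by (simp add: distinct_map inj_on_def cell_at_def)
  next
    \<comment> \<open>Cells of different word lengths are told apart by the number of their stored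
      rows, even if states and counts agree.\<close>
    fix i j :: nat assume "i \<noteq> j"
    then have "snd (snd (cell_at i q)) \<noteq> snd (snd (cell_at j q'))" for q q'
      unfolding cell_at_def snd_conv by (metis length_map length_rev length_upt minus_nat.diff_0)
    then have "cell_at i q \<noteq> cell_at j q'" for q q' by metis
    then show "set (map (cell_at i) (filter (accepts r) (pstates r))) \<inter> set (map (cell_at j) (filter (accepts r) (pstates r))) = {}"
      unfolding set_map by blast
  qed simp
next
  fix y assume "y \<in> set (cells k r)"
  then obtain j q where y: "y = cell_at j q" unfolding cells_mem by blast
  show "int (length (cell_words y)) = fst (snd y)" unfolding y cell_words_at by (simp add: cell_at_def)
  show "distinct (cell_words y)" unfolding y cell_words_at by (rule distinct_state_words)
  show "unrank k r (fst y, (u, snd (snd y))) = map int (cell_words y ! nat u)" if "0 \<le> u" "u < fst (snd y)" for u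
    using unrank_words[of u k r j q "[]"] that
    unfolding y cell_words_at unrank_def by (simp add: cell_at_def)
  show "state_label r (fst y) \<in> fst ` set (specs_part r)" if ne: "cell_words y \<noteq> []"
  proof -
    obtain w where "w \<in> set (cell_words y)" using ne by (cases "cell_words y") auto
    then have w: "w \<in> lists {..<k}" "run3 w = fst y" unfolding y cell_words_at set_state_words by (simp_all add: cell_at_def)
    have "label_of C w \<in> labels C" using inst w(1) unfolding lqci_instance_def by blast
    then show ?thesis using state_label_run3[OF w(1)] fst_specs unfolding w(2)
      by (metis (no_types, lifting) lqci.select_convs(3,4) lqci_of_dfa_def set_map)
  qed
next
  fix y y' assume "y \<in> set (cells k r)" "y' \<in> set (cells k r)" "y \<noteq> y'"
  then obtain j q j' q' where y: "y = cell_at j q" "y' = cell_at j' q'" "\<not> (j = j' \<and> q = q')" unfolding cells_mem by blast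
  then show "set (cell_words y) \<inter> set (cell_words y') = {}" unfolding y(1,2) cell_words_at set_state_words by auto
next
  show "distinct (map fst (specs_part r))" using distinct_labels by (simp add: fst_specs)
  show "0 < snd (lam_part r)" "0 < snd (rho_part r)" "0 < snd (bound_part r)"
    by (simp_all add: instance_data_def snd_quotient_of)
  show "0 \<le> fval (lam_part r)" "fval (lam_part r) \<le> fval (rho_part r)"
    using inst by (simp_all add: instance_data_def fval_quotient_of lqci_instance_def lqci_of_dfa_def of_rat_less_eq)
next
  fix s assume "s \<in> set (specs_part r)"
  then obtain l a b where s: "s = (l, (quotient_of a, quotient_of b))" "(l, a, b) \<in> set (label_specs c)"
    unfolding specs_part_eq by auto
  show "0 < snd (fst (snd s))" "0 < snd (snd (snd s))" by (simp_all add: s(1) snd_quotient_of)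
  show "0 \<le> fval (fst (snd s))" "fval (fst (snd s)) \<le> fval (snd (snd s))"
    using specs_bounds[OF s(2)] by (simp_all add: s(1) fval_quotient_of of_rat_less_eq)
qed

end

section \<open>Correctness for instances given by DFAs\<close>

context dfa_instance
begin

lemma cell_word:
  assumes "y \<in> set (cells k r)" "w \<in> set (cell_words y)"
  shows "w \<in> lists {..<k}" "run3 w = fst y" "accepts r (fst y)" "lo_len c \<le> length w" "length w \<le> hi_len c"
proof -
  obtain j q where y: "lo_len c \<le> j" "j \<le> hi_len c" "accepts r q" "y = cell_at j q"
    using assms(1) unfolding cells_mem by blast
  then show "w \<in> lists {..<k}" "run3 w = fst y" "accepts r (fst y)" "lo_len c \<le> length w" "length w \<le> hi_len c"
    using assms(2) unfolding y(4) cell_words_at set_state_words by (simp_all add: cell_at_def)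
qed

lemma word_cell:
  assumes "w \<in> lists {..<k}" "accepts r (run3 w)" "lo_len c \<le> length w" "length w \<le> hi_len c"
  shows "cell_at (length w) (run3 w) \<in> set (cells k r)" "w \<in> set (cell_words (cell_at (length w) (run3 w)))"
  using assms run3_in_pstates[OF assms(1)]
  unfolding cells_mem cell_words_at set_state_words by blast+

lemma improvisations_eq: "improvisations {..<k} C = all_words"
proof (intro equalityI subsetI)
  fix w assume "w \<in> improvisations {..<k} C"
  then have w: "w \<in> lists {..<k}" "accepts r (run3 w)" "lo_len c \<le> length w" "length w \<le> hi_len c"
    using accepts_run3[of w] by (simp_all add: improvisations_def lqci_of_dfa_def)
  show "w \<in> all_words" unfolding all_words_def using word_cell[OF w] by (rule UN_I)
next
  fix w assume "w \<in> all_words"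
  then obtain y where y: "y \<in> set (cells k r)" "w \<in> set (cell_words y)" unfolding all_words_def by (rule UN_E)
  note * = cell_word[OF y]
  have "dfa_output (hard_dfa c) w" using accepts_run3[OF *(1)] *(2,3) by simp
  then show "w \<in> improvisations {..<k} C" using *(1,4,5) by (simp add: improvisations_def lqci_of_dfa_def)
qed

lemma words_of_eq: "words_of s = label_class {..<k} C (fst s)"
proof (intro equalityI subsetI)
  fix w assume "w \<in> words_of s"
  then obtain y where y: "y \<in> cells_of s" "w \<in> set (cell_words y)" unfolding words_of_def by (rule UN_E)
  have yc: "y \<in> set (cells k r)" using subsetD[OF cells_of_subset y(1)] .
  have "w \<in> all_words" unfolding all_words_def using yc y(2) by (rule UN_I)
  moreover have "dfa_output (label_dfa c) w = fst s"
    using state_label_run3[OF cell_word(1)[OF yc y(2)]] y(1) cell_word(2)[OF yc y(2)] by (simp add: cells_of_def)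
  ultimately show "w \<in> label_class {..<k} C (fst s)"
    by (simp add: label_class_def improvisations_eq) (simp add: lqci_of_dfa_def)
next
  fix w assume w: "w \<in> label_class {..<k} C (fst s)"
  then have "w \<in> all_words" by (simp add: label_class_def improvisations_eq)
  then obtain y where y: "y \<in> set (cells k r)" "w \<in> set (cell_words y)" unfolding all_words_def by (rule UN_E)
  have "dfa_output (label_dfa c) w = fst s" using w by (simp add: label_class_def lqci_of_dfa_def)
  then have "y \<in> cells_of s"
    using state_label_run3[OF cell_word(1)[OF y]] cell_word(2)[OF y] y(1) by (simp add: cells_of_def)
  then show "w \<in> words_of s" unfolding words_of_def using y(2) by (rule UN_I)
qed

definition word_cost :: "nat list \<Rightarrow> real" where
  "word_cost w = real_of_rat (cost_of C w)"

lemma word_cost_cell: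
  "y \<in> set (cells k r) \<Longrightarrow> w \<in> set (cell_words y) \<Longrightarrow> word_cost w = real_of_int (state_cost r (fst y))"
  using state_cost_run3[OF cell_word(1)] cell_word(2) by (simp add: word_cost_def lqci_of_dfa_def)

lemma spec_of_label:
  assumes "l \<in> labels C"
  obtains s where "s \<in> set (specs_part r)" "fst s = l" "fval (fst (snd s)) = real_of_rat (word_lo C l)"
    "fval (snd (snd s)) = real_of_rat (word_hi C l)"
proof -
  obtain a b where ab: "(l, a, b) \<in> set (label_specs c)" using assms by (force simp: lqci_of_dfa_def)
  have "(l, (quotient_of a, quotient_of b)) \<in> set (specs_part r)" using ab by (force simp: specs_part_eq)
  then show ?thesis
    using specs_bounds(3,4)[OF ab]
    by (intro that[of "(l, (quotient_of a, quotient_of b))"]) (simp_all add: fval_quotient_of)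
qed

lemma label_of_spec:
  assumes "s \<in> set (specs_part r)"
  shows "fst s \<in> labels C" "fval (fst (snd s)) = real_of_rat (word_lo C (fst s))"
    "fval (snd (snd s)) = real_of_rat (word_hi C (fst s))"
proof -
  obtain l a b where s: "s = (l, (quotient_of a, quotient_of b))" "(l, a, b) \<in> set (label_specs c)"
    using assms unfolding specs_part_eq by auto
  then show "fst s \<in> labels C" by (force simp: lqci_of_dfa_def)
  show "fval (fst (snd s)) = real_of_rat (word_lo C (fst s))" "fval (snd (snd s)) = real_of_rat (word_hi C (fst s))"
    using specs_bounds(3,4)[OF s(2)] by (simp_all add: s(1) fval_quotient_of)
qed

lemma fval_parts: "fval (lam_part r) = real_of_rat (label_lo C)" "fval (rho_part r) = real_of_rat (label_hi C)"
  "fval (bound_part r) = real_of_rat (cost_bound C)"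
  by (simp_all add: instance_data_def fval_quotient_of lqci_of_dfa_def)

lemma cond_prob_word:
  assumes "y \<in> A"
  shows "\<P>(w in measure_pmf D. w = y \<bar> w \<in> A) = pmf D y / measure_pmf.prob D A"
proof -
  have "{w. w = y \<and> w \<in> A} = {y}" using assms by auto
  then show ?thesis by (simp add: cond_prob_def measure_pmf_single)
qed

lemma improvising_dist:
  assumes "check k r"
  shows "improvising {..<k} C improviser_dist"
proof -
  note sound = check_sound[OF assms]
  have "AE w in measure_pmf improviser_dist. w \<in> all_words"
    using sound(1) by (simp add: measure_pmf.prob_eq_1)
  then have set: "set_pmf improviser_dist \<subseteq> all_words" by (auto simp: AE_measure_pmf_iff)
  have lists: "all_words \<subseteq> lists {..<k}" unfolding improvisations_eq[symmetric] improvisations_def by blast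
  show ?thesis
    unfolding improvising_def improvisations_eq
  proof (intro conjI ballI impI)
    show "set_pmf improviser_dist \<subseteq> lists {..<k}" using set lists by (rule order_trans)
    show "measure_pmf.prob improviser_dist all_words = 1" by (rule sound(1))
    show "measure_pmf.expectation improviser_dist (\<lambda>w. real_of_rat (cost_of C w)) \<le> real_of_rat (cost_bound C)"
      unfolding word_cost_def[symmetric] fval_parts[symmetric] using word_cost_cell by (rule sound(2))
  next
    fix l assume l: "l \<in> labels C"
    obtain s where s: "s \<in> set (specs_part r)" "fst s = l" "fval (fst (snd s)) = real_of_rat (word_lo C l)"
      "fval (snd (snd s)) = real_of_rat (word_hi C l)" using l by (rule spec_of_label)
    have cls: "label_class {..<k} C l = words_of s" using words_of_eq[of s] s(2) by simp
    show "real_of_rat (label_lo C) \<le> measure_pmf.prob improviser_dist (label_class {..<k} C l)"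
      "measure_pmf.prob improviser_dist (label_class {..<k} C l) \<le> real_of_rat (label_hi C)"
      using sound(3,4)[OF s(1)] unfolding cls fval_parts by simp_all
    assume pos: "measure_pmf.prob improviser_dist (label_class {..<k} C l) > 0"
    fix y assume y: "y \<in> label_class {..<k} C l"
    have b: "real_of_rat (word_lo C l) * measure_pmf.prob improviser_dist (words_of s) \<le> pmf improviser_dist y"
      "pmf improviser_dist y \<le> real_of_rat (word_hi C l) * measure_pmf.prob improviser_dist (words_of s)"
      using sound(5)[OF s(1) y[unfolded cls]] unfolding s(3,4) by simp_all
    show "real_of_rat (word_lo C l) \<le> \<P>(w in measure_pmf improviser_dist. w = y \<bar> w \<in> label_class {..<k} C l)"
      "\<P>(w in measure_pmf improviser_dist. w = y \<bar> w \<in> label_class {..<k} C l) \<le> real_of_rat (word_hi C l)"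
      unfolding cond_prob_word[OF y] using b pos unfolding cls
      by (simp_all add: pos_le_divide_eq pos_divide_le_eq)
  qed
qed

text \<open>The improvisations form a finite set that carries all the mass, so the probabilities and
  the expected cost are finite sums of point masses, as \<open>check_complete\<close>
  expects.\<close>

lemma check_of_feasible:
  assumes "improvising {..<k} C D"
  shows "check k r"
proof -
  have imp: "measure_pmf.prob D all_words = 1"
    "measure_pmf.expectation D word_cost \<le> fval (bound_part r)"
    and lab: "\<And>l. l \<in> labels C \<Longrightarrow> real_of_rat (label_lo C) \<le> measure_pmf.prob D (label_class {..<k} C l) \<and>
        measure_pmf.prob D (label_class {..<k} C l) \<le> real_of_rat (label_hi C)"
    and word: "\<And>l y. l \<in> labels C \<Longrightarrow> measure_pmf.prob D (label_class {..<k} C l) > 0 \<Longrightarrow> y \<in> label_class {..<k} C l \<Longrightarrow>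
           real_of_rat (word_lo C l) \<le> \<P>(w in D. w = y \<bar> w \<in> label_class {..<k} C l) \<and>
           \<P>(w in D. w = y \<bar> w \<in> label_class {..<k} C l) \<le> real_of_rat (word_hi C l)"
    using assms unfolding improvising_def improvisations_eq fval_parts word_cost_def[abs_def] by blast+
  have "AE w in measure_pmf D. w \<in> all_words" using imp(1) by (simp add: measure_pmf.prob_eq_1)
  then have set: "set_pmf D \<subseteq> all_words" by (auto simp: AE_measure_pmf_iff)
  have P: "(\<Sum>w\<in>words_of s. pmf D w) = measure_pmf.prob D (label_class {..<k} C (fst s))" for s
    unfolding words_of_eq[symmetric] by (simp add: measure_measure_pmf_finite)
  show ?thesis
  proof (rule check_complete[where p = "pmf D" and \<kappa> = word_cost])
    show "(\<Sum>w\<in>all_words. pmf D w) = 1" using imp(1) by (simp add: measure_measure_pmf_finite)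
    have "measure_pmf.expectation D word_cost = (\<Sum>w\<in>all_words. word_cost w * pmf D w)"
      using set by (intro integral_measure_pmf_real) auto
    then show "(\<Sum>w\<in>all_words. pmf D w * word_cost w) \<le> fval (bound_part r)"
      using imp(2) by (simp add: mult.commute)
  next
    fix s assume s: "s \<in> set (specs_part r)"
    show "fval (lam_part r) \<le> (\<Sum>w\<in>words_of s. pmf D w)" "(\<Sum>w\<in>words_of s. pmf D w) \<le> fval (rho_part r)"
      using lab[OF label_of_spec(1)[OF s]] unfolding P fval_parts by simp_all
    fix w assume pos: "0 < (\<Sum>w\<in>words_of s. pmf D w)" and w: "w \<in> words_of s"
    have w': "w \<in> label_class {..<k} C (fst s)" using w by (simp add: words_of_eq)
    note b = word[OF label_of_spec(1)[OF s] pos[unfolded P] w', unfolded cond_prob_word[OF w']]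
    show "fval (fst (snd s)) * (\<Sum>w\<in>words_of s. pmf D w) \<le> pmf D w"
      "pmf D w \<le> fval (snd (snd s)) * (\<Sum>w\<in>words_of s. pmf D w)"
      using b pos unfolding P label_of_spec(2,3)[OF s] by (simp_all add: pos_le_divide_eq pos_divide_le_eq)
  qed (simp_all add: word_cost_cell)
qed

lemma feasible_iff_check: "feasible {..<k} C \<longleftrightarrow> check k r"
  unfolding feasible_def using improvising_dist check_of_feasible by blast

text \<open>Programs compute with integers while words consist of naturals. On the support of the
  uniform distribution all drawn letters are nonnegative, so \<open>nat\<close> loses
  nothing.\<close>

lemma draws_eq:
  assumes "check k r"
  shows "map_pmf (\<lambda>u. encode (draw k (r, u))) (pmf_of_set {0..<total_mass k r}) = map_pmf enc_word improviser_dist"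
proof -
  have enc: "enc_word w = encode (map int w)" for w
    unfolding enc_word_def encode_map by (simp add: enc_nat_def[abs_def])
  have eq: "encode (draw k (r, u)) = enc_word (map nat (draw k (r, u)))"
    if "u \<in> set_pmf (pmf_of_set {0..<total_mass k r})" for u
  proof -
    have "u \<in> {0..<total_mass k r}" using that total_mass_pos by (subst (asm) set_pmf_of_set) auto
    then have "0 \<le> u" "u < total_mass k r" by simp_all
    then obtain w where "draw k (r, u) = map int w"
      using check_sound(6)[OF assms] by metis
    then show ?thesis unfolding enc by (simp add: o_def)
  qed
  show ?thesis unfolding improviser_dist_def pmf.map_comp o_def by (rule map_pmf_cong[OF refl eq])
qed

end

section \<open>Assembly of the scheme\<close>

lemma ptime_encode: "ptime (\<lambda>x. encode x)"
\<comment> \<open>On trees this is the identity, but its type changes; projecting a pair realizes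
  it.\<close>
proof (rule ptime_uop[of "\<lambda>x. (x, x)" _ Fst])
  show "ptime (\<lambda>x. (x, x))" by (intro ptime_Pair ptime_id)
qed simp

lemma ptime_Branch: "ptime f \<Longrightarrow> ptime g \<Longrightarrow> ptime (\<lambda>x. Branch (f x) (g x))"
  by (rule ptime_bop[of f g _ Mk_Branch]) simp_all

lemma pb_poly:
  assumes "pb T"
  shows "\<exists>p :: nat poly. \<forall>x. T x \<le> poly p (sz x)"
proof -
  obtain d where "\<And>x. T x \<le> (sz x + 2) ^ d" using assms unfolding pb_def by blast
  then have "T x \<le> poly ([:2, 1:] ^ d) (sz x)" for x by (simp add: poly_power add.commute)
  then show ?thesis by (intro exI[of _ "[:2, 1:] ^ d"] allI)
qed

lemma ptime_run:
  assumes "ptime h"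
  shows "\<exists>S T. pb T \<and> (\<forall>x. \<exists>t\<le>T x. run S (encode x) = return_spmf (encode (h x), t))"
proof -
  obtain T where T: "pb T \<and> (\<forall>x. sz (h x) \<le> T x) \<and> (\<forall>n. \<exists>P e. implements n P e h T)"
    using assms unfolding ptime_def by (rule exE)
  then obtain P e where P: "implements 1 P e h T" by metis
  show ?thesis
  proof (intro exI[of _ "e # P"] exI[of _ T] conjI allI)
    fix x
    have "length [e] = 1" by simp
    from implementsD[OF P this, of x "[]" "[]"] obtain t where
      "t \<le> T x" "eval_expr ([e] @ P @ []) e [encode x] = return_spmf (encode (h x), t)" by blast
    moreover have "run (e # P) (encode x) = eval_expr ([e] @ P @ []) e [encode x]"
      by (simp add: run_def body_def)
    ultimately show "\<exists>t\<le>T x. run (e # P) (encode x) = return_spmf (encode (h x), t)" by metis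
  qed (rule conjunct1[OF T])
qed

theorem theorem3:
  fixes k :: nat
  shows "\<exists>S. polynomial_time_scheme {..<k} (dfa_lqci_class k) (lqci_of_dfa k) enc_dfa_lqci S"
proof -
  obtain eM eD Q T where *: "pb T \<and> (\<forall>x. 0 < total_mass k x \<longrightarrow>
    output_dist (sampler_program eM eD Q (encode x)) (Num 0)
      = spmf_of_pmf (map_pmf (\<lambda>u. encode (draw k (x, u))) (pmf_of_set {0..<total_mass k x})) \<and>
    expected_time (sampler_program eM eD Q (encode x)) (Num 0) \<le> of_nat (T x))"
    using sampler[OF ptime_total_mass[of k] ptime_draw[of k]] by (elim exE) (rule that)
  note pbT = *[THEN conjunct1]
  note samp = *[THEN conjunct2, THEN spec, THEN mp, THEN conjunct1] *[THEN conjunct2, THEN spec, THEN mp, THEN conjunct2]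
  define prog where "prog x = sampler_program eM eD Q (encode x)" for x :: data
  define h where "h x = (if check k x then answer_improviser (prog x) else answer_infeasible)" for x
  \<comment> \<open>The emitted code is a constant tree except for the place of
    \<open>encode x\<close>, so a fixed number of branchings assembles it.\<close>
  have prog: "answer_improviser (prog x) = Branch (Num 1) (Branch (Branch (Num 5) (Branch (Branch (Num 0) (encode x))
      (enc_expr (Call 1 (Bin_Op Mk_Branch (Var 0) eM))))) (enc_program (loop_body eD # gen_body 2 # Q)))" for x
    by (simp add: answer_improviser_def prog_def sampler_program_def enc_program_def enc_list_def)
  have "ptime h"
    unfolding h_def prog by (intro ptime_if ptime_check ptime_Branch ptime_const ptime_encode)
  from ptime_run[OF this] obtain S T' where pbT': "pb T'"
    and S: "\<forall>x. \<exists>t\<le>T' x. run S (encode x) = return_spmf (encode (h x), t)"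
    by (elim exE conjE) (rule that)
  from pb_poly[OF pbT'] obtain p :: "nat poly" where p: "\<forall>x. T' x \<le> poly p (sz x)" by (rule exE)
  from pb_poly[OF pbT] obtain q :: "nat poly" where q: "\<forall>x. T x \<le> poly q (sz x)" by (rule exE)
  have run: "\<exists>t\<le>poly p (vsize (enc_dfa_lqci c)). run S (enc_dfa_lqci c) = return_spmf (h (instance_data c), t)" for c
    using S[rule_format, of "instance_data c"] p[rule_format, of "instance_data c"] unfolding encode_instance_data encode_simps
    by (meson le_trans)
  have out: "output_dist S (enc_dfa_lqci c) = return_spmf (h (instance_data c))" for c
    using run[of c] by (auto simp: output_dist_def)
  have time: "expected_time (prog (instance_data c)) (Num 0) \<le> of_nat (poly q (vsize (enc_dfa_lqci c)))"
    if "c \<in> dfa_lqci_class k" for c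
  proof -
    interpret dfa_instance k c using that by unfold_locales
    have "expected_time (prog r) (Num 0) \<le> of_nat (T r)" unfolding prog_def by (rule samp(2)[OF total_mass_pos])
    also have "\<dots> \<le> of_nat (poly q (vsize (enc_dfa_lqci c)))"
      using q[rule_format, of r] unfolding encode_instance_data by (rule of_nat_mono)
    finally show ?thesis .
  qed
  have correct: "correct_answer {..<k} (lqci_of_dfa k c) (h (instance_data c))" if cc: "c \<in> dfa_lqci_class k" for c
  proof -
    interpret dfa_instance k c using cc by unfold_locales
    show ?thesis
    proof (cases "check k r")
      case True
      have "expected_time (prog r) (Num 0) < \<infinity>" using time[OF cc] by (rule le_less_trans) (simp add: of_nat_less_top)
      moreover have "output_dist (prog r) (Num 0) = spmf_of_pmf (map_pmf enc_word improviser_dist)"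
        unfolding prog_def samp(1)[OF total_mass_pos] draws_eq[OF True] ..
      ultimately have "improviser {..<k} C (prog r)"
        unfolding improviser_def using improvising_dist[OF True] by blast
      then show ?thesis using True by (auto simp: correct_answer_def feasible_iff_check h_def)
    next
      case False
      then show ?thesis by (simp add: correct_answer_def feasible_iff_check h_def)
    qed
  qed
  have "improvisation_scheme {..<k} (dfa_lqci_class k) (lqci_of_dfa k) enc_dfa_lqci S"
    unfolding improvisation_scheme_def
  proof (intro ballI conjI)
    fix c assume c: "c \<in> dfa_lqci_class k"
    obtain t where "run S (enc_dfa_lqci c) = return_spmf (h (instance_data c), t)" using run by blast
    then show "expected_time S (enc_dfa_lqci c) < \<infinity>"
      by (simp add: expected_time_def measure_spmf_return_spmf nn_integral_return of_nat_less_top)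
    fix v assume "v \<in> set_spmf (output_dist S (enc_dfa_lqci c))"
    then show "correct_answer {..<k} (lqci_of_dfa k c) v" using correct[OF c] by (simp add: out)
  qed
  moreover have "\<forall>c\<in>dfa_lqci_class k. \<forall>(v, t)\<in>set_spmf (run S (enc_dfa_lqci c)). t \<le> poly p (vsize (enc_dfa_lqci c))"
  proof
    fix c
    show "\<forall>(v, t)\<in>set_spmf (run S (enc_dfa_lqci c)). t \<le> poly p (vsize (enc_dfa_lqci c))"
      using run[of c] by auto
  qed
  moreover have "\<forall>c\<in>dfa_lqci_class k. \<forall>P. answer_improviser P \<in> set_spmf (output_dist S (enc_dfa_lqci c)) \<longrightarrow>
      expected_time P (Num 0) \<le> of_nat (poly q (vsize (enc_dfa_lqci c)))"
  proof (intro ballI allI impI)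
    fix c P assume c: "c \<in> dfa_lqci_class k" and "answer_improviser P \<in> set_spmf (output_dist S (enc_dfa_lqci c))"
    then have "answer_improviser P = h (instance_data c)" by (simp add: out)
    \<comment> \<open>The time bound concerns every program with this code; injectivity of the
      encoding leaves only the emitted one.\<close>
    then have "enc_program P = enc_program (prog (instance_data c))"
      by (simp add: h_def answer_improviser_def answer_infeasible_def split: if_splits)
    then have "P = prog (instance_data c)" using inj_enc_program by (simp add: inj_def)
    then show "expected_time P (Num 0) \<le> of_nat (poly q (vsize (enc_dfa_lqci c)))" using time[OF c] by simp
  qed
  ultimately show ?thesis unfolding polynomial_time_scheme_def by blast
qed

end
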